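(* Let $M(\phi,\xi,\eta,g_M)$ be a cosymplectic manifold, let $(N,g_N)$ be a Riemannian manifold, and let $F:M(\phi,\xi,\eta,g_M)\to(N,g_N)$ be an anti-invariant Riemannian submersion such that $\phi(\ker F_* )=(\ker F_* )^\perp$. Then $F$ is a totally geodesic map if and only if $$\mathcal{T}_W\phi V=0\quad\text{for all } W,V\in\Gamma(\ker F_* )$$ and $$\mathcal{A}_X\phi W=0\quad\text{for all } X\in\Gamma((\ker F_* )^\perp),\ W\in\Gamma(\ker F_* ).$$
   Context: An almost contact metric structure $(\phi,\xi,\eta,g)$ on a $(2m+1)$-dimensional manifold $M$ consists of a $(1,1)$-tensor field $\phi$, a vector field $\xi$, a 1-form $\eta$ and a Riemannian metric $g$ with $\phi^2=-I+\eta\otimes\xi$, $\phi\xi=0$, $\eta\circ\phi=0$, $\eta(\xi)=1$, $g(\phi X,\phi Y)=g(X,Y)-\eta(X)\eta(Y)$, $\eta(X)=g(X,\xi)$. It is cosymplectic if it is normal ($[\phi,\phi]+2d\eta\otimes\xi=0$) and both $\eta$ and $\Phi(X,Y)=g(X,\phi Y)$ are closed; the structure equation of a cosymplectic manifold is $(\nabla_X\phi)Y=0$, where $\nabla$ is the Levi-Civita connection of $g$, and then $\nabla_X\xi=0$. A Riemannian submersion $F:(M,g_M)\to(N,g_N)$ is a smooth surjective map of maximal rank whose differential $F_*$ preserves the lengths of horizontal vectors. Vectors in $\ker F_*$ are vertical and vectors in $(\ker F_* )^\perp$ are horizontal; $\mathcal{V}$ and $\mathcal{H}$ are the orthogonal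 projections on $\ker F_*$ and $(\ker F_* )^\perp$. $F$ is anti-invariant if $\phi(\ker F_* )\subseteq(\ker F_* )^\perp$. O'Neill's tensors: for vector fields $E,G$ on $M$, $\mathcal{T}_EG=\mathcal{H}\nabla_{\mathcal{V}E}\mathcal{V}G+\mathcal{V}\nabla_{\mathcal{V}E}\mathcal{H}G$ and $\mathcal{A}_EG=\mathcal{V}\nabla_{\mathcal{H}E}\mathcal{H}G+\mathcal{H}\nabla_{\mathcal{H}E}\mathcal{V}G$. The second fundamental form of $F$ is $(\nabla F_* )(X,Y)=\nabla^F_XF_*(Y)-F_*(\nabla_XY)$, where $\nabla^F$ is the pullback connection. $F$ is called totally geodesic if $\nabla F_*=0$. *)

theory Defs
  imports "HOL-Analysis.Analysis" "HOL-Library.Function_Algebras"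
begin

section \<open>Smooth manifolds\<close>

text \<open>
  Smoothness on open subsets of a finite-dimensional space: all iterated directional derivatives
  exist (as Frechet derivatives) and are continuous.
\<close>

fun C_k_on :: "nat \<Rightarrow> 'a::real_normed_vector set \<Rightarrow> ('a \<Rightarrow> 'b::real_normed_vector) \<Rightarrow> bool" where
  "C_k_on 0 S f \<longleftrightarrow> continuous_on S f"
| "C_k_on (Suc k) S f \<longleftrightarrow>
     (\<forall>x\<in>S. f differentiable (at x)) \<and>
     (\<forall>v. C_k_on k S (\<lambda>x. frechet_derivative f (at x) v))"

definition smooth_on :: "'a::real_normed_vector set \<Rightarrow> ('a \<Rightarrow> 'b::real_normed_vector) \<Rightarrow> bool" where
  "smooth_on S f \<longleftrightarrow> (\<forall>k. C_k_on k S f)"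

text \<open>
  The points of a manifold form a whole type; a chart is a pair of its domain and its coordinate
  map.  The model space is a finite-dimensional inner product space rather than a type of class
  \<open>euclidean_space\<close>, because the latter excludes dimension 0.  The dimension of the manifold is
  the dimension of the model space.
\<close>

type_synonym ('m, 'a) chart = "'m set \<times> ('m \<Rightarrow> 'a)"

definition smooth_manifold ::
    "('m::{t2_space,second_countable_topology}, 'a::real_inner) chart set \<Rightarrow> bool" where
  "smooth_manifold A \<longleftrightarrow>
     (\<exists>B::'a set. finite B \<and> span B = UNIV) \<and>
     (\<forall>(U, c)\<in>A. open U \<and> open (c ` U) \<and> homeomorphism U (c ` U) c (inv_into U c)) \<and>
     (\<Union>(U, c)\<in>A. U) = UNIV \<and>
     (\<forall>(U, c)\<in>A. \<forall>(V, d)\<in>A. smooth_on (c ` (U \<inter> V)) (d \<circ> inv_into U c))"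

definition smooth_fun ::
    "('m::topological_space, 'a::real_inner) chart set \<Rightarrow> ('m \<Rightarrow> real) \<Rightarrow> bool" where
  "smooth_fun A f \<longleftrightarrow> (\<forall>(U, c)\<in>A. smooth_on (c ` U) (f \<circ> inv_into U c))"

definition smooth_map ::
    "('m::topological_space, 'a::real_inner) chart set \<Rightarrow>
     ('n::topological_space, 'b::real_inner) chart set \<Rightarrow> ('m \<Rightarrow> 'n) \<Rightarrow> bool" where
  "smooth_map A B F \<longleftrightarrow>
     continuous_on UNIV F \<and>
     (\<forall>(U, c)\<in>A. \<forall>(V, d)\<in>B. smooth_on (c ` (U \<inter> F -` V)) (d \<circ> F \<circ> inv_into U c))"

definition smooth_curve ::
    "('m::topological_space, 'a::real_inner) chart set \<Rightarrow> real set \<Rightarrow> (real \<Rightarrow> 'm) \<Rightarrow> bool" where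
  "smooth_curve A I \<gamma> \<longleftrightarrow>
     continuous_on I \<gamma> \<and> (\<forall>(U, c)\<in>A. smooth_on (I \<inter> \<gamma> -` U) (c \<circ> \<gamma>))"


section \<open>Tangent vectors and vector fields\<close>

text \<open>
  A tangent vector at \<open>p\<close> is the operator sending a smooth function \<open>f\<close> to the derivative of
  \<open>f \<circ> \<gamma>\<close> at 0, for a smooth curve \<open>\<gamma>\<close> with \<open>\<gamma> 0 = p\<close>.  Functions that are not smooth are sent
  to 0, so that equality of tangent vectors is equality of HOL functions.  The vector space
  operations are pointwise.
\<close>

type_synonym 'm tvec = "('m \<Rightarrow> real) \<Rightarrow> real"
type_synonym 'm vfield = "'m \<Rightarrow> 'm tvec"

definition tv_scale :: "real \<Rightarrow> 'm tvec \<Rightarrow> 'm tvec" where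
  "tv_scale a v = (\<lambda>f. a * v f)"

definition vf_scale :: "('m \<Rightarrow> real) \<Rightarrow> ('m \<Rightarrow> 'n tvec) \<Rightarrow> ('m \<Rightarrow> 'n tvec)" where
  "vf_scale f X = (\<lambda>p. tv_scale (f p) (X p))"

definition velocity ::
    "('m::topological_space, 'a::real_inner) chart set \<Rightarrow> (real \<Rightarrow> 'm) \<Rightarrow> 'm tvec" where
  "velocity A \<gamma> = (\<lambda>f. if smooth_fun A f then deriv (f \<circ> \<gamma>) 0 else 0)"

definition tangent_space ::
    "('m::topological_space, 'a::real_inner) chart set \<Rightarrow> 'm \<Rightarrow> 'm tvec set" where
  "tangent_space A p =
     {velocity A \<gamma> | \<gamma> e. e > 0 \<and> smooth_curve A {-e<..<e} \<gamma> \<and> \<gamma> 0 = p}"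

definition vector_fields_along ::
    "('m::topological_space, 'a::real_inner) chart set \<Rightarrow>
     ('n::topological_space, 'b::real_inner) chart set \<Rightarrow> ('m \<Rightarrow> 'n) \<Rightarrow> ('m \<Rightarrow> 'n tvec) set" where
  "vector_fields_along A B F =
     {\<sigma>. (\<forall>p. \<sigma> p \<in> tangent_space B (F p)) \<and>
         (\<forall>f. smooth_fun B f \<longrightarrow> smooth_fun A (\<lambda>p. \<sigma> p f))}"

definition vector_fields ::
    "('m::topological_space, 'a::real_inner) chart set \<Rightarrow> 'm vfield set" where
  "vector_fields A = vector_fields_along A A (\<lambda>p. p)"

definition vf_apply :: "'m vfield \<Rightarrow> ('m \<Rightarrow> real) \<Rightarrow> ('m \<Rightarrow> real)" where
  "vf_apply X f = (\<lambda>p. X p f)"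

definition lie_bracket :: "'m vfield \<Rightarrow> 'm vfield \<Rightarrow> 'm vfield" where
  "lie_bracket X Y = (\<lambda>p f. X p (vf_apply Y f) - Y p (vf_apply X f))"


section \<open>Tensor fields and Riemannian metrics\<close>

definition endo_field ::
    "('m::topological_space, 'a::real_inner) chart set \<Rightarrow> ('m \<Rightarrow> 'm tvec \<Rightarrow> 'm tvec) \<Rightarrow> bool" where
  "endo_field A \<phi> \<longleftrightarrow>
     (\<forall>p. \<forall>v\<in>tangent_space A p. \<phi> p v \<in> tangent_space A p) \<and>
     (\<forall>p a b. \<forall>v\<in>tangent_space A p. \<forall>w\<in>tangent_space A p.
        \<phi> p (tv_scale a v + tv_scale b w) = tv_scale a (\<phi> p v) + tv_scale b (\<phi> p w)) \<and>
     (\<forall>X\<in>vector_fields A. (\<lambda>p. \<phi> p (X p)) \<in> vector_fields A)"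

definition one_form ::
    "('m::topological_space, 'a::real_inner) chart set \<Rightarrow> ('m \<Rightarrow> 'm tvec \<Rightarrow> real) \<Rightarrow> bool" where
  "one_form A \<eta> \<longleftrightarrow>
     (\<forall>p a b. \<forall>v\<in>tangent_space A p. \<forall>w\<in>tangent_space A p.
        \<eta> p (tv_scale a v + tv_scale b w) = a * \<eta> p v + b * \<eta> p w) \<and>
     (\<forall>X\<in>vector_fields A. smooth_fun A (\<lambda>p. \<eta> p (X p)))"

definition riemannian_metric ::
    "('m::topological_space, 'a::real_inner) chart set \<Rightarrow>
     ('m \<Rightarrow> 'm tvec \<Rightarrow> 'm tvec \<Rightarrow> real) \<Rightarrow> bool" where
  "riemannian_metric A g \<longleftrightarrow>
     (\<forall>p a b. \<forall>u\<in>tangent_space A p. \<forall>v\<in>tangent_space A p. \<forall>w\<in>tangent_space A p.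
        g p (tv_scale a u + tv_scale b v) w = a * g p u w + b * g p v w) \<and>
     (\<forall>p. \<forall>v\<in>tangent_space A p. \<forall>w\<in>tangent_space A p. g p v w = g p w v) \<and>
     (\<forall>p. \<forall>v\<in>tangent_space A p. v \<noteq> 0 \<longrightarrow> g p v v > 0) \<and>
     (\<forall>X\<in>vector_fields A. \<forall>Y\<in>vector_fields A. smooth_fun A (\<lambda>p. g p (X p) (Y p)))"

definition riemannian_manifold ::
    "('m::{t2_space,second_countable_topology}, 'a::real_inner) chart set \<Rightarrow>
     ('m \<Rightarrow> 'm tvec \<Rightarrow> 'm tvec \<Rightarrow> real) \<Rightarrow> bool" where
  "riemannian_manifold A g \<longleftrightarrow> smooth_manifold A \<and> riemannian_metric A g"

definition affine_connection ::
    "('m::topological_space, 'a::real_inner) chart set \<Rightarrow>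
     ('m vfield \<Rightarrow> 'm vfield \<Rightarrow> 'm vfield) \<Rightarrow> bool" where
  "affine_connection A D \<longleftrightarrow>
     (\<forall>X\<in>vector_fields A. \<forall>Y\<in>vector_fields A. D X Y \<in> vector_fields A) \<and>
     (\<forall>X\<in>vector_fields A. \<forall>Y\<in>vector_fields A. \<forall>Z\<in>vector_fields A.
        D (X + Y) Z = D X Z + D Y Z \<and> D X (Y + Z) = D X Y + D X Z) \<and>
     (\<forall>X\<in>vector_fields A. \<forall>Y\<in>vector_fields A. \<forall>f. smooth_fun A f \<longrightarrow>
        D (vf_scale f X) Y = vf_scale f (D X Y) \<and>
        D X (vf_scale f Y) = vf_scale f (D X Y) + vf_scale (vf_apply X f) Y)"

definition levi_civita ::
    "('m::topological_space, 'a::real_inner) chart set \<Rightarrow>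
     ('m \<Rightarrow> 'm tvec \<Rightarrow> 'm tvec \<Rightarrow> real) \<Rightarrow> ('m vfield \<Rightarrow> 'm vfield \<Rightarrow> 'm vfield) \<Rightarrow> bool" where
  "levi_civita A g D \<longleftrightarrow>
     affine_connection A D \<and>
     (\<forall>X\<in>vector_fields A. \<forall>Y\<in>vector_fields A. D X Y - D Y X = lie_bracket X Y) \<and>
     (\<forall>X\<in>vector_fields A. \<forall>Y\<in>vector_fields A. \<forall>Z\<in>vector_fields A. \<forall>p.
        vf_apply X (\<lambda>q. g q (Y q) (Z q)) p = g p (D X Y p) (Z p) + g p (Y p) (D X Z p))"


section \<open>Almost contact metric and cosymplectic manifolds\<close>

definition almost_contact_metric ::
    "('m::{t2_space,second_countable_topology}, 'a::real_inner) chart set \<Rightarrow>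
     ('m \<Rightarrow> 'm tvec \<Rightarrow> 'm tvec) \<Rightarrow> 'm vfield \<Rightarrow> ('m \<Rightarrow> 'm tvec \<Rightarrow> real) \<Rightarrow>
     ('m \<Rightarrow> 'm tvec \<Rightarrow> 'm tvec \<Rightarrow> real) \<Rightarrow> bool" where
  "almost_contact_metric A \<phi> \<xi> \<eta> g \<longleftrightarrow>
     riemannian_manifold A g \<and> (\<exists>m. dim (UNIV::'a set) = 2 * m + 1) \<and>
     endo_field A \<phi> \<and> \<xi> \<in> vector_fields A \<and> one_form A \<eta> \<and>
     (\<forall>p. \<phi> p (\<xi> p) = 0 \<and> \<eta> p (\<xi> p) = 1) \<and>
     (\<forall>p. \<forall>v\<in>tangent_space A p.
        \<phi> p (\<phi> p v) = - v + tv_scale (\<eta> p v) (\<xi> p) \<and>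
        \<eta> p (\<phi> p v) = 0 \<and>
        \<eta> p v = g p v (\<xi> p)) \<and>
     (\<forall>p. \<forall>v\<in>tangent_space A p. \<forall>w\<in>tangent_space A p.
        g p (\<phi> p v) (\<phi> p w) = g p v w - \<eta> p v * \<eta> p w)"

definition endo_apply :: "('m \<Rightarrow> 'm tvec \<Rightarrow> 'm tvec) \<Rightarrow> 'm vfield \<Rightarrow> 'm vfield" where
  "endo_apply \<phi> X = (\<lambda>p. \<phi> p (X p))"

text \<open>
  Exterior derivatives by the invariant formula, with the factors 1/2 and 1/3 that go with the
  normality condition \<open>[\<phi>,\<phi>] + 2 d\<eta> \<otimes> \<xi> = 0\<close>.
\<close>

definition ext_deriv1 :: "('m \<Rightarrow> 'm tvec \<Rightarrow> real) \<Rightarrow> 'm vfield \<Rightarrow> 'm vfield \<Rightarrow> 'm \<Rightarrow> real" where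
  "ext_deriv1 \<eta> X Y p =
     (vf_apply X (\<lambda>q. \<eta> q (Y q)) p - vf_apply Y (\<lambda>q. \<eta> q (X q)) p
      - \<eta> p (lie_bracket X Y p)) / 2"

definition ext_deriv2 ::
    "('m \<Rightarrow> 'm tvec \<Rightarrow> 'm tvec \<Rightarrow> real) \<Rightarrow> 'm vfield \<Rightarrow> 'm vfield \<Rightarrow> 'm vfield \<Rightarrow> 'm \<Rightarrow> real" where
  "ext_deriv2 \<omega> X Y Z p =
     (vf_apply X (\<lambda>q. \<omega> q (Y q) (Z q)) p
      + vf_apply Y (\<lambda>q. \<omega> q (Z q) (X q)) p
      + vf_apply Z (\<lambda>q. \<omega> q (X q) (Y q)) p
      - \<omega> p (lie_bracket X Y p) (Z p)
      - \<omega> p (lie_bracket Y Z p) (X p)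
      - \<omega> p (lie_bracket Z X p) (Y p)) / 3"

definition nijenhuis ::
    "('m \<Rightarrow> 'm tvec \<Rightarrow> 'm tvec) \<Rightarrow> 'm vfield \<Rightarrow> 'm vfield \<Rightarrow> 'm vfield" where
  "nijenhuis \<phi> X Y =
     endo_apply \<phi> (endo_apply \<phi> (lie_bracket X Y))
     + lie_bracket (endo_apply \<phi> X) (endo_apply \<phi> Y)
     - endo_apply \<phi> (lie_bracket (endo_apply \<phi> X) Y)
     - endo_apply \<phi> (lie_bracket X (endo_apply \<phi> Y))"

definition fundamental_form ::
    "('m \<Rightarrow> 'm tvec \<Rightarrow> 'm tvec) \<Rightarrow> ('m \<Rightarrow> 'm tvec \<Rightarrow> 'm tvec \<Rightarrow> real) \<Rightarrow>
     'm \<Rightarrow> 'm tvec \<Rightarrow> 'm tvec \<Rightarrow> real" where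
  "fundamental_form \<phi> g = (\<lambda>p v w. g p v (\<phi> p w))"

definition cosymplectic ::
    "('m::{t2_space,second_countable_topology}, 'a::real_inner) chart set \<Rightarrow>
     ('m \<Rightarrow> 'm tvec \<Rightarrow> 'm tvec) \<Rightarrow> 'm vfield \<Rightarrow> ('m \<Rightarrow> 'm tvec \<Rightarrow> real) \<Rightarrow>
     ('m \<Rightarrow> 'm tvec \<Rightarrow> 'm tvec \<Rightarrow> real) \<Rightarrow> bool" where
  "cosymplectic A \<phi> \<xi> \<eta> g \<longleftrightarrow>
     almost_contact_metric A \<phi> \<xi> \<eta> g \<and>
     (\<forall>X\<in>vector_fields A. \<forall>Y\<in>vector_fields A.
        nijenhuis \<phi> X Y + vf_scale (\<lambda>p. 2 * ext_deriv1 \<eta> X Y p) \<xi> = 0) \<and>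
     (\<forall>X\<in>vector_fields A. \<forall>Y\<in>vector_fields A. \<forall>p. ext_deriv1 \<eta> X Y p = 0) \<and>
     (\<forall>X\<in>vector_fields A. \<forall>Y\<in>vector_fields A. \<forall>Z\<in>vector_fields A. \<forall>p.
        ext_deriv2 (fundamental_form \<phi> g) X Y Z p = 0)"


section \<open>Riemannian submersions\<close>

definition pushforward ::
    "('n::topological_space, 'b::real_inner) chart set \<Rightarrow> ('m \<Rightarrow> 'n) \<Rightarrow> 'm tvec \<Rightarrow> 'n tvec" where
  "pushforward B F v = (\<lambda>f. if smooth_fun B f then v (f \<circ> F) else 0)"

definition vertical_space ::
    "('m::topological_space, 'a::real_inner) chart set \<Rightarrow>
     ('n::topological_space, 'b::real_inner) chart set \<Rightarrow> ('m \<Rightarrow> 'n) \<Rightarrow> 'm \<Rightarrow> 'm tvec set" where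
  "vertical_space A B F p = {v \<in> tangent_space A p. pushforward B F v = 0}"

definition horizontal_space ::
    "('m::topological_space, 'a::real_inner) chart set \<Rightarrow>
     ('m \<Rightarrow> 'm tvec \<Rightarrow> 'm tvec \<Rightarrow> real) \<Rightarrow>
     ('n::topological_space, 'b::real_inner) chart set \<Rightarrow> ('m \<Rightarrow> 'n) \<Rightarrow> 'm \<Rightarrow> 'm tvec set" where
  "horizontal_space A g B F p =
     {v \<in> tangent_space A p. \<forall>w\<in>vertical_space A B F p. g p v w = 0}"

definition vertical_fields ::
    "('m::topological_space, 'a::real_inner) chart set \<Rightarrow>
     ('n::topological_space, 'b::real_inner) chart set \<Rightarrow> ('m \<Rightarrow> 'n) \<Rightarrow> 'm vfield set" where
  "vertical_fields A B F = {X \<in> vector_fields A. \<forall>p. X p \<in> vertical_space A B F p}"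

definition horizontal_fields ::
    "('m::topological_space, 'a::real_inner) chart set \<Rightarrow>
     ('m \<Rightarrow> 'm tvec \<Rightarrow> 'm tvec \<Rightarrow> real) \<Rightarrow>
     ('n::topological_space, 'b::real_inner) chart set \<Rightarrow> ('m \<Rightarrow> 'n) \<Rightarrow> 'm vfield set" where
  "horizontal_fields A g B F = {X \<in> vector_fields A. \<forall>p. X p \<in> horizontal_space A g B F p}"

text \<open>The third conjunct is the maximal rank condition.\<close>

definition riemannian_submersion ::
    "('m::topological_space, 'a::real_inner) chart set \<Rightarrow>
     ('m \<Rightarrow> 'm tvec \<Rightarrow> 'm tvec \<Rightarrow> real) \<Rightarrow>
     ('n::topological_space, 'b::real_inner) chart set \<Rightarrow>
     ('n \<Rightarrow> 'n tvec \<Rightarrow> 'n tvec \<Rightarrow> real) \<Rightarrow> ('m \<Rightarrow> 'n) \<Rightarrow> bool" where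
  "riemannian_submersion A g B h F \<longleftrightarrow>
     smooth_map A B F \<and> surj F \<and>
     (\<forall>p. pushforward B F ` tangent_space A p = tangent_space B (F p)) \<and>
     (\<forall>p. \<forall>v\<in>horizontal_space A g B F p.
        sqrt (h (F p) (pushforward B F v) (pushforward B F v)) = sqrt (g p v v))"

definition anti_invariant ::
    "('m::topological_space, 'a::real_inner) chart set \<Rightarrow> ('m \<Rightarrow> 'm tvec \<Rightarrow> 'm tvec) \<Rightarrow>
     ('m \<Rightarrow> 'm tvec \<Rightarrow> 'm tvec \<Rightarrow> real) \<Rightarrow>
     ('n::topological_space, 'b::real_inner) chart set \<Rightarrow> ('m \<Rightarrow> 'n) \<Rightarrow> bool" where
  "anti_invariant A \<phi> g B F \<longleftrightarrow>
     (\<forall>p. \<phi> p ` vertical_space A B F p \<subseteq> horizontal_space A g B F p)"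

definition vert_part ::
    "('m::topological_space, 'a::real_inner) chart set \<Rightarrow>
     ('m \<Rightarrow> 'm tvec \<Rightarrow> 'm tvec \<Rightarrow> real) \<Rightarrow>
     ('n::topological_space, 'b::real_inner) chart set \<Rightarrow> ('m \<Rightarrow> 'n) \<Rightarrow> 'm vfield \<Rightarrow> 'm vfield" where
  "vert_part A g B F X =
     (\<lambda>p. THE v. v \<in> vertical_space A B F p \<and> X p - v \<in> horizontal_space A g B F p)"

definition hor_part ::
    "('m::topological_space, 'a::real_inner) chart set \<Rightarrow>
     ('m \<Rightarrow> 'm tvec \<Rightarrow> 'm tvec \<Rightarrow> real) \<Rightarrow>
     ('n::topological_space, 'b::real_inner) chart set \<Rightarrow> ('m \<Rightarrow> 'n) \<Rightarrow> 'm vfield \<Rightarrow> 'm vfield" where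
  "hor_part A g B F X =
     (\<lambda>p. THE v. v \<in> horizontal_space A g B F p \<and> X p - v \<in> vertical_space A B F p)"

definition oneill_T ::
    "('m::topological_space, 'a::real_inner) chart set \<Rightarrow>
     ('m \<Rightarrow> 'm tvec \<Rightarrow> 'm tvec \<Rightarrow> real) \<Rightarrow> ('m vfield \<Rightarrow> 'm vfield \<Rightarrow> 'm vfield) \<Rightarrow>
     ('n::topological_space, 'b::real_inner) chart set \<Rightarrow> ('m \<Rightarrow> 'n) \<Rightarrow>
     'm vfield \<Rightarrow> 'm vfield \<Rightarrow> 'm vfield" where
  "oneill_T A g D B F E G =
     (let \<V> = vert_part A g B F; \<H> = hor_part A g B F
      in \<H> (D (\<V> E) (\<V> G)) + \<V> (D (\<V> E) (\<H> G)))"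

definition oneill_A ::
    "('m::topological_space, 'a::real_inner) chart set \<Rightarrow>
     ('m \<Rightarrow> 'm tvec \<Rightarrow> 'm tvec \<Rightarrow> real) \<Rightarrow> ('m vfield \<Rightarrow> 'm vfield \<Rightarrow> 'm vfield) \<Rightarrow>
     ('n::topological_space, 'b::real_inner) chart set \<Rightarrow> ('m \<Rightarrow> 'n) \<Rightarrow>
     'm vfield \<Rightarrow> 'm vfield \<Rightarrow> 'm vfield" where
  "oneill_A A g D B F E G =
     (let \<V> = vert_part A g B F; \<H> = hor_part A g B F
      in \<V> (D (\<H> E) (\<H> G)) + \<H> (D (\<H> E) (\<V> G)))"

text \<open>
  The pullback connection is the connection on the pullback bundle (whose sections are the vector
  fields along \<open>F\<close>) with \<open>\<nabla>\<^sup>F\<^bsub>v\<^esub> (Z \<circ> F) = \<nabla>\<^sup>N\<^bsub>F\<^sub>* v\<^esub> Z\<close>.  The right-hand side takes a tangent vector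
  as direction; it is expressed by an arbitrary vector field \<open>Y\<close> of \<open>N\<close> with that value at \<open>F p\<close>.
\<close>

definition pullback_connection ::
    "('m::topological_space, 'a::real_inner) chart set \<Rightarrow>
     ('n::topological_space, 'b::real_inner) chart set \<Rightarrow> ('m \<Rightarrow> 'n) \<Rightarrow>
     ('n vfield \<Rightarrow> 'n vfield \<Rightarrow> 'n vfield) \<Rightarrow>
     ('m vfield \<Rightarrow> ('m \<Rightarrow> 'n tvec) \<Rightarrow> ('m \<Rightarrow> 'n tvec)) \<Rightarrow> bool" where
  "pullback_connection A B F DN DF \<longleftrightarrow>
     (\<forall>X\<in>vector_fields A. \<forall>\<sigma>\<in>vector_fields_along A B F.
        DF X \<sigma> \<in> vector_fields_along A B F) \<and>
     (\<forall>X\<in>vector_fields A. \<forall>Y\<in>vector_fields A. \<forall>\<sigma>\<in>vector_fields_along A B F.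
        DF (X + Y) \<sigma> = DF X \<sigma> + DF Y \<sigma>) \<and>
     (\<forall>X\<in>vector_fields A. \<forall>\<sigma>\<in>vector_fields_along A B F. \<forall>\<tau>\<in>vector_fields_along A B F.
        DF X (\<sigma> + \<tau>) = DF X \<sigma> + DF X \<tau>) \<and>
     (\<forall>X\<in>vector_fields A. \<forall>\<sigma>\<in>vector_fields_along A B F. \<forall>f. smooth_fun A f \<longrightarrow>
        DF (vf_scale f X) \<sigma> = vf_scale f (DF X \<sigma>) \<and>
        DF X (vf_scale f \<sigma>) = vf_scale f (DF X \<sigma>) + vf_scale (vf_apply X f) \<sigma>) \<and>
     (\<forall>X\<in>vector_fields A. \<forall>Y\<in>vector_fields B. \<forall>Z\<in>vector_fields B. \<forall>p.
        pushforward B F (X p) = Y (F p) \<longrightarrow> DF X (Z \<circ> F) p = DN Y Z (F p))"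

definition second_fundamental_form ::
    "('n::topological_space, 'b::real_inner) chart set \<Rightarrow> ('m \<Rightarrow> 'n) \<Rightarrow>
     ('m vfield \<Rightarrow> 'm vfield \<Rightarrow> 'm vfield) \<Rightarrow>
     ('m vfield \<Rightarrow> ('m \<Rightarrow> 'n tvec) \<Rightarrow> ('m \<Rightarrow> 'n tvec)) \<Rightarrow>
     'm vfield \<Rightarrow> 'm vfield \<Rightarrow> 'm \<Rightarrow> 'n tvec" where
  "second_fundamental_form B F D DF X Y =
     DF X (\<lambda>p. pushforward B F (Y p)) - (\<lambda>p. pushforward B F (D X Y p))"

definition totally_geodesic ::
    "('m::topological_space, 'a::real_inner) chart set \<Rightarrow>
     ('n::topological_space, 'b::real_inner) chart set \<Rightarrow> ('m \<Rightarrow> 'n) \<Rightarrow>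
     ('m vfield \<Rightarrow> 'm vfield \<Rightarrow> 'm vfield) \<Rightarrow>
     ('m vfield \<Rightarrow> ('m \<Rightarrow> 'n tvec) \<Rightarrow> ('m \<Rightarrow> 'n tvec)) \<Rightarrow> bool" where
  "totally_geodesic A B F D DF \<longleftrightarrow>
     (\<forall>X\<in>vector_fields A. \<forall>Y\<in>vector_fields A. second_fundamental_form B F D DF X Y = 0)"

end

theory Submission
  imports Defs
begin

text \<open>
  On a cosymplectic manifold \<open>\<nabla>\<phi> = 0\<close>, so for vertical \<open>W\<close> the field \<open>\<nabla>\<^bsub>X\<^esub> \<phi>W = \<phi> \<nabla>\<^bsub>X\<^esub> W\<close> has vertical part
  \<open>\<phi> \<H> \<nabla>\<^bsub>X\<^esub> W\<close>, because \<open>\<phi>\<close> exchanges horizontal and vertical vectors (up to the vertical \<open>\<xi>\<close>).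
  Hence the two conditions say that \<open>\<nabla>\<^bsub>X\<^esub> W\<close> is vertical, that is, that the second fundamental form
  \<open>(\<nabla>F\<^sub>*)(X, W) = - F\<^sub>* \<nabla>\<^bsub>X\<^esub> W\<close> vanishes, for vertical \<open>W\<close> and vertical or horizontal \<open>X\<close>.  The
  remaining components vanish for every Riemannian submersion: \<open>\<nabla>F\<^sub>*\<close> is symmetric because the
  pullback connection is torsion-free, and on horizontal fields \<open>\<langle>(\<nabla>F\<^sub>*)(X, Y), F\<^sub>* Z\<rangle>\<close> is in addition
  skew in \<open>Y\<close> and \<open>Z\<close> because the pullback connection is metric.

  Everything is computed with global vector fields.  The bridge to charts is a frame cut off by a
  bump function, in which every vector field, and every vector field along \<open>F\<close>, can be expanded.
\<close>

section \<open>Calculus of smooth functions\<close>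

text \<open>The connections are operations on global smooth fields, so neither \<open>DM\<close> nor
  \<open>DF\<close> can be evaluated on a field that lives only in a chart, and passing to a chart
  would require showing that they are local. A cut-off \<kappa> with value 1 at the base point
  avoids this: \<kappa> times a field is a global combination of frame fields, and the Leibniz rule
  leaves one error term, the derivative of \<kappa>, which occurs on both sides of each comparison
  and cancels. Where a denominator would appear, the identity is multiplied by it, and smoothness is
  recovered by dividing near one point. Beyond linearity and the Leibniz rule, the pullback
  connection is prescribed only on fields \<open>Z \<circ> F\<close>; that it is torsion-free and
  metric is derived from the same properties of \<open>DN\<close> by such expansions. The structure
  equation is derived as well: \<open>cosymplectic\<close> speaks of normality and closed forms, and
  \<nabla>\<phi> = 0 is extracted from them by way of \<nabla>\<xi> = 0. That \<xi> is vertical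
  follows from \<phi> mapping the vertical space onto the horizontal one.\<close>

lemma C_k_on_Suc_has_derivative:
  "C_k_on (Suc k) S f \<Longrightarrow> x \<in> S \<Longrightarrow> (f has_derivative frechet_derivative f (at x)) (at x)"
  using frechet_derivative_works by auto

lemma C_k_on_cong:
  assumes "open S" "\<And>x. x \<in> S \<Longrightarrow> f x = g x" "C_k_on k S f"
  shows "C_k_on k S g"
  using assms(2,3)
proof (induction k arbitrary: f g)
  case 0
  then show ?case using continuous_on_cong by force
next
  case (Suc k)
  have D: "(g has_derivative frechet_derivative f (at x)) (at x)" if "x \<in> S" for x
    using C_k_on_Suc_has_derivative[OF Suc.prems(2) that] Suc.prems(1) assms(1) that
    by (auto intro: has_derivative_transform_within_open)
  have "C_k_on k S (\<lambda>x. frechet_derivative g (at x) v)" for v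
  proof (rule Suc.IH)
    show "C_k_on k S (\<lambda>x. frechet_derivative f (at x) v)" using Suc.prems(2) by simp
    show "frechet_derivative f (at x) v = frechet_derivative g (at x) v" if "x \<in> S" for x
      using frechet_derivative_at[OF D[OF that]] by simp
  qed
  then show ?case using D by (auto simp: differentiable_def)
qed

text \<open>Closure proofs exhibit a derivative \<open>f'\<close> by a differentiation rule; this
  criterion lets the induction run on that explicit \<open>f'\<close> instead of on
  \<open>frechet_derivative\<close>. Openness of \<open>S\<close> allows the exchange at every
  order.\<close>

lemma C_k_on_Suc_iff:
  assumes "open S" "\<And>x. x \<in> S \<Longrightarrow> (f has_derivative f' x) (at x)"
  shows "C_k_on (Suc k) S f \<longleftrightarrow> (\<forall>v. C_k_on k S (\<lambda>x. f' x v))"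
proof -
  have eq: "f' x v = frechet_derivative f (at x) v" if "x \<in> S" for x v
    using frechet_derivative_at[OF assms(2)[OF that]] by simp
  show ?thesis
  proof
    assume "C_k_on (Suc k) S f"
    then show "\<forall>v. C_k_on k S (\<lambda>x. f' x v)"
      using C_k_on_cong[OF assms(1), of "\<lambda>x. frechet_derivative f (at x) v" "\<lambda>x. f' x v" k for v] eq
      by auto
  next
    assume "\<forall>v. C_k_on k S (\<lambda>x. f' x v)"
    then have "C_k_on k S (\<lambda>x. frechet_derivative f (at x) v)" for v
      using C_k_on_cong[OF assms(1), of "\<lambda>x. f' x v" "\<lambda>x. frechet_derivative f (at x) v" k] eq
      by auto
    then show "C_k_on (Suc k) S f"
      using assms(2) by (auto simp: differentiable_def)
  qed
qed

lemma C_k_on_subset: "C_k_on k S f \<Longrightarrow> T \<subseteq> S \<Longrightarrow> C_k_on k T f"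
  by (induction k arbitrary: f) (auto intro: continuous_on_subset)

text \<open>The derivative clauses of \<open>C_k_on\<close> are statements \<open>at x\<close>,
  hence about small neighbourhoods; only order 0 has to pass from \<open>continuous_on\<close> to
  continuity at points.\<close>

lemma C_k_on_local:
  assumes "\<And>x. x \<in> S \<Longrightarrow> \<exists>T. open T \<and> x \<in> T \<and> C_k_on k T f"
  shows "C_k_on k S f"
  using assms
proof (induction k arbitrary: f)
  case 0
  have "isCont f x" if "x \<in> S" for x
    using 0[OF that] by (auto simp: continuous_on_eq_continuous_at)
  then show ?case by (simp add: continuous_at_imp_continuous_on)
next
  case (Suc k)
  have "f differentiable (at x)" if "x \<in> S" for x
    using Suc.prems[OF that] by auto
  moreover have "C_k_on k S (\<lambda>x. frechet_derivative f (at x) v)" for v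
    by (rule Suc.IH) (use Suc.prems in fastforce)
  ultimately show ?case by simp
qed

text \<open>Differentiability contains continuity. Product, inverse and chain rule rely on this:
  there the derivative contains undifferentiated factors, which must be of order
  \<open>k\<close>.\<close>

lemma C_k_on_SucD: "C_k_on (Suc k) S f \<Longrightarrow> C_k_on k S f"
proof (induction k arbitrary: f)
  case 0
  then show ?case
    by (auto intro!: continuous_at_imp_continuous_on differentiable_imp_continuous_within)
next
  case (Suc k)
  then show ?case by (metis C_k_on.simps(2))
qed

lemma C_k_on_const: "open S \<Longrightarrow> C_k_on k S (\<lambda>x. c)"
proof (induction k arbitrary: c)
  case (Suc k)
  then show ?case
    by (subst C_k_on_Suc_iff[where f'="\<lambda>x v. 0"]) auto
qed simp

lemma C_k_on_bounded_linear_compose: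
  assumes "bounded_linear L" "open S" "C_k_on k S f"
  shows "C_k_on k S (\<lambda>x. L (f x))"
  using assms(3)
proof (induction k arbitrary: f)
  case 0
  then show ?case
    using bounded_linear.continuous_on[OF assms(1)] by simp
next
  case (Suc k)
  show ?case
    by (subst C_k_on_Suc_iff[where f'="\<lambda>x v. L (frechet_derivative f (at x) v)"])
      (use Suc assms in \<open>auto intro!: bounded_linear.has_derivative[OF assms(1)]
        C_k_on_Suc_has_derivative simp del: C_k_on.simps, simp add: Suc.IH\<close>)
qed

lemma C_k_on_id: "open S \<Longrightarrow> C_k_on k S (\<lambda>x. x)"
  by (cases k) (simp_all only: C_k_on_Suc_iff[where f'="\<lambda>x v. v"] has_derivative_ident C_k_on_const
      C_k_on.simps(1) continuous_on_id simp_thms)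

lemma C_k_on_bounded_linear: "bounded_linear L \<Longrightarrow> open S \<Longrightarrow> C_k_on k S L"
  using C_k_on_bounded_linear_compose[OF _ _ C_k_on_id] by blast

lemma C_k_on_add:
  assumes "open S" "C_k_on k S f" "C_k_on k S g"
  shows "C_k_on k S (\<lambda>x. f x + g x)"
  using assms(2,3)
proof (induction k arbitrary: f g)
  case 0
  then show ?case by (simp add: continuous_on_add)
next
  case (Suc k)
  show ?case
    using Suc C_k_on_Suc_has_derivative[OF Suc.prems(1)] C_k_on_Suc_has_derivative[OF Suc.prems(2)]
    by (subst C_k_on_Suc_iff[OF assms(1) has_derivative_add]) auto
qed

text \<open>The Leibniz rule turns the derivative into a sum of two values of \<open>m\<close>, each
  with one factor differentiated, so the induction is general in both factors.\<close>

lemma C_k_on_bilinear: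
  assumes "bounded_bilinear m" "open S" "C_k_on k S f" "C_k_on k S g"
  shows "C_k_on k S (\<lambda>x. m (f x) (g x))"
  using assms(3,4)
proof (induction k arbitrary: f g)
  case 0
  then show ?case using bounded_bilinear.continuous_on[OF assms(1)] by simp
next
  case (Suc k)
  note D = C_k_on_Suc_has_derivative[OF Suc.prems(1)] C_k_on_Suc_has_derivative[OF Suc.prems(2)]
  have "C_k_on k S f" "C_k_on k S g"
    using Suc.prems C_k_on_SucD by blast+
  then show ?case
    using Suc.IH Suc.prems D
    by (subst C_k_on_Suc_iff[OF assms(2) bounded_bilinear.FDERIV[OF assms(1)]])
      (auto intro!: C_k_on_add assms)
qed

lemmas C_k_on_mult = C_k_on_bilinear[OF bounded_bilinear_mult]
lemmas C_k_on_scaleR = C_k_on_bilinear[OF bounded_bilinear_scaleR]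

lemma C_k_on_sum:
  "open S \<Longrightarrow> (\<And>i. i \<in> I \<Longrightarrow> C_k_on k S (f i)) \<Longrightarrow> C_k_on k S (\<lambda>x. \<Sum>i\<in>I. f i x)"
  by (induction I rule: infinite_finite_induct) (auto intro: C_k_on_const C_k_on_add)

text \<open>Chain rule: the derivative of \<open>g\<close> in the direction of a variable vector is expanded in a
  basis, which is why the intermediate space has to be finite-dimensional.\<close>

lemma C_k_on_compose:
  fixes f :: "'a::real_normed_vector \<Rightarrow> 'b::real_inner" and g :: "'b \<Rightarrow> 'c::real_normed_vector"
  assumes I: "\<And>v::'b. v = (\<Sum>b\<in>I. (v \<bullet> b) *\<^sub>R b)"
    and "open S" "open T" "f ` S \<subseteq> T" "C_k_on k S f" "C_k_on k T g"
  shows "C_k_on k S (\<lambda>x. g (f x))"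
  using assms(5,6)
proof (induction k arbitrary: g)
  case 0
  then show ?case using assms(4) by (auto intro: continuous_on_compose2)
next
  case (Suc k)
  let ?f = "\<lambda>x. frechet_derivative f (at x)" and ?g = "\<lambda>x. frechet_derivative g (at x)"
  have D: "((\<lambda>x. g (f x)) has_derivative (\<lambda>v. ?g (f x) (?f x v))) (at x)" if "x \<in> S" for x
  proof -
    have "f x \<in> T" using assms(4) that by auto
    then show ?thesis
      using diff_chain_at[OF C_k_on_Suc_has_derivative[OF Suc.prems(1) that]
          C_k_on_Suc_has_derivative[OF Suc.prems(2)]] by (simp add: o_def)
  qed
  have "C_k_on k S (\<lambda>x. \<Sum>b\<in>I. (?f x v \<bullet> b) *\<^sub>R ?g (f x) b)" for v
    using Suc.prems assms(2) C_k_on_SucD[OF Suc.prems(1)]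
    by (intro C_k_on_sum C_k_on_scaleR C_k_on_bounded_linear_compose[OF bounded_linear_inner_left]
        Suc.IH) auto
  moreover have "(\<Sum>b\<in>I. (?f x v \<bullet> b) *\<^sub>R ?g (f x) b) = ?g (f x) (?f x v)" if "x \<in> S" for x v
  proof -
    have "linear (?g (f x))"
      using C_k_on_Suc_has_derivative[OF Suc.prems(2)] assms(4) that
      by (blast intro: has_derivative_linear)
    then have eq: "?g (f x) (\<Sum>b\<in>I. (?f x v \<bullet> b) *\<^sub>R b) = (\<Sum>b\<in>I. (?f x v \<bullet> b) *\<^sub>R ?g (f x) b)"
      by (simp add: linear_sum[of "?g (f x)"] linear_scale[of "?g (f x)"])
    show ?thesis
      using trans[OF eq[symmetric] arg_cong[OF I[of "?f x v", symmetric], of "?g (f x)"]] .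
  qed
  ultimately have "C_k_on k S (\<lambda>x. ?g (f x) (?f x v))" for v
    by (rule C_k_on_cong[OF assms(2), rotated])
  then show ?case by (subst C_k_on_Suc_iff[OF assms(2) D]) auto
qed

text \<open>The derivative is built from the derivative of \<open>f\<close> and the inverse itself
  at the lower order, so the induction closes with \<open>f\<close> fixed.\<close>

lemma C_k_on_inverse:
  fixes f :: "'a::real_normed_vector \<Rightarrow> real"
  assumes "open S" "\<And>x. x \<in> S \<Longrightarrow> f x \<noteq> 0" "C_k_on k S f"
  shows "C_k_on k S (\<lambda>x. inverse (f x))"
  using assms(3)
proof (induction k)
  case 0
  then show ?case using assms(2) by (simp add: continuous_on_inverse)
next
  case (Suc k)
  have D: "((\<lambda>x. inverse (f x)) has_derivative
      (\<lambda>v. - (inverse (f x) * frechet_derivative f (at x) v * inverse (f x)))) (at x)" if "x \<in> S" for x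
    using Deriv.has_derivative_inverse[OF assms(2) C_k_on_Suc_has_derivative[OF Suc.prems]] that by blast
  have "C_k_on k S (\<lambda>x. - 1 * (inverse (f x) * frechet_derivative f (at x) v * inverse (f x)))" for v
    using Suc assms(1) C_k_on_SucD[OF Suc.prems]
    by (intro C_k_on_mult C_k_on_const) auto
  then show ?case
    by (subst C_k_on_Suc_iff[OF assms(1) D]) auto
qed

lemma smooth_on_cong: "open S \<Longrightarrow> (\<And>x. x \<in> S \<Longrightarrow> f x = g x) \<Longrightarrow> smooth_on S f \<Longrightarrow> smooth_on S g"
  using C_k_on_cong unfolding smooth_on_def by blast

lemma smooth_on_subset: "smooth_on S f \<Longrightarrow> T \<subseteq> S \<Longrightarrow> smooth_on T f"
  using C_k_on_subset unfolding smooth_on_def by blast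

lemma smooth_on_local:
  assumes "\<And>x. x \<in> S \<Longrightarrow> \<exists>T. open T \<and> x \<in> T \<and> smooth_on T f"
  shows "smooth_on S f"
  unfolding smooth_on_def
proof
  fix k show "C_k_on k S f"
    by (rule C_k_on_local) (meson assms smooth_on_def)
qed

lemma smooth_on_const: "open S \<Longrightarrow> smooth_on S (\<lambda>x. c)"
  using C_k_on_const unfolding smooth_on_def by blast

lemma smooth_on_bounded_linear: "bounded_linear L \<Longrightarrow> open S \<Longrightarrow> smooth_on S L"
  using C_k_on_bounded_linear unfolding smooth_on_def by blast

lemma smooth_on_add: "open S \<Longrightarrow> smooth_on S f \<Longrightarrow> smooth_on S g \<Longrightarrow> smooth_on S (\<lambda>x. f x + g x)"
  using C_k_on_add unfolding smooth_on_def by blast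

lemma smooth_on_mult:
  fixes f g :: "'a::real_normed_vector \<Rightarrow> real"
  shows "open S \<Longrightarrow> smooth_on S f \<Longrightarrow> smooth_on S g \<Longrightarrow> smooth_on S (\<lambda>x. f x * g x)"
  using C_k_on_mult unfolding smooth_on_def by blast

lemma smooth_on_inner:
  "open S \<Longrightarrow> smooth_on S f \<Longrightarrow> smooth_on S g \<Longrightarrow> smooth_on S (\<lambda>x. f x \<bullet> g x)"
  using C_k_on_bilinear[OF bounded_bilinear_inner] unfolding smooth_on_def by blast

lemma smooth_on_inverse:
  fixes f :: "'a::real_normed_vector \<Rightarrow> real"
  shows "open S \<Longrightarrow> (\<And>x. x \<in> S \<Longrightarrow> f x \<noteq> 0) \<Longrightarrow> smooth_on S f \<Longrightarrow> smooth_on S (\<lambda>x. inverse (f x))"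
  using C_k_on_inverse unfolding smooth_on_def by blast

lemma smooth_on_has_derivative:
  "smooth_on S f \<Longrightarrow> x \<in> S \<Longrightarrow> (f has_derivative frechet_derivative f (at x)) (at x)"
  using C_k_on_Suc_has_derivative unfolding smooth_on_def by blast

lemma smooth_on_frechet_derivative:
  "smooth_on S f \<Longrightarrow> smooth_on S (\<lambda>x. frechet_derivative f (at x) v)"
  unfolding smooth_on_def by (metis C_k_on.simps(2))

lemma smooth_on_continuous_on: "smooth_on S f \<Longrightarrow> continuous_on S f"
  unfolding smooth_on_def by (metis C_k_on.simps(1))

section \<open>Finite-dimensional inner product spaces\<close>

text \<open>Gram--Schmidt, one vector at a time: \<open>n\<close> is the part of the new vector
  \<open>c\<close> orthogonal to the old span, and the projection is corrected by its component
  along \<open>n\<close>. A general positive form \<open>G\<close> is allowed because the lemma also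
  serves a Riemannian metric transported to the model space.\<close>

lemma orthogonal_projection_exists:
  fixes G :: "'a::real_vector \<Rightarrow> 'a \<Rightarrow> real"
  assumes bil: "bilinear G" and sym: "\<And>x y. G x y = G y x" and pos: "\<And>x. x \<noteq> 0 \<Longrightarrow> G x x > 0"
    and "finite C"
  shows "\<exists>w\<in>span C. \<forall>c\<in>span C. G (x - w) c = 0"
  using \<open>finite C\<close>
proof (induction C arbitrary: x rule: finite_induct)
  case empty
  then show ?case by (auto simp: bilinear_rzero[OF bil])
next
  case (insert c C)
  obtain d where d: "d \<in> span C" "\<And>u. u \<in> span C \<Longrightarrow> G (c - d) u = 0"
    using insert.IH by meson
  obtain w where w: "w \<in> span C" "\<And>u. u \<in> span C \<Longrightarrow> G (x - w) u = 0"
    using insert.IH by meson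
  define n where "n = c - d"
  define w' where "w' = w + (G (x - w) n / G n n) *\<^sub>R n"
  have sub: "span C \<subseteq> span (insert c C)" by (rule span_mono) auto
  have "c \<in> span (insert c C)" by (simp add: span_base)
  then have "w' \<in> span (insert c C)"
    unfolding w'_def n_def using sub d(1) w(1) by (blast intro: span_add span_scale span_diff)
  moreover have "G (x - w') u = 0" if u: "u \<in> span (insert c C)" for u
  proof -
    obtain k where k: "u - k *\<^sub>R c \<in> span C"
      using u span_breakdown_eq by blast
    define r where "r = (u - k *\<^sub>R c) + k *\<^sub>R d"
    have r: "r \<in> span C" unfolding r_def using k d(1) by (simp add: span_add span_scale)
    have u: "u = r + k *\<^sub>R n" unfolding r_def n_def by (simp add: algebra_simps)
    have "G (x - w') v = G (x - w) v - G (x - w) n / G n n * G n v" for v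
      unfolding w'_def
      by (simp add: bilinear_lsub[OF bil] bilinear_ladd[OF bil] bilinear_lmul[OF bil])
    moreover have "G n r = 0" using d(2) r n_def by simp
    \<comment> \<open>For \<open>n = 0\<close> the quotient is a division by zero, hence 0, and the
      identity holds because \<open>G\<close> vanishes on 0; so \<open>C\<close> may be linearly
      dependent.\<close>
    moreover have "G (x - w) n - G (x - w) n / G n n * G n n = 0"
      using pos[of n] bilinear_rzero[OF bil] by (cases "n = 0") auto
    ultimately show ?thesis
      using w(2)[OF r] by (simp add: u bilinear_radd[OF bil] bilinear_rmul[OF bil])
  qed
  ultimately show ?case by blast
qed

lemma bilinear_inner: "bilinear ((\<bullet>) :: 'a::real_inner \<Rightarrow> 'a \<Rightarrow> real)"
  by (auto simp: bilinear_def inner_add_right inner_add_left intro!: linearI)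

text \<open>Stands in for \<open>Basis\<close>, since the model space is not assumed to be of class
  \<open>euclidean_space\<close>.\<close>

lemma orthonormal_basis_exists_span:
  fixes C :: "'a::real_inner set"
  assumes "finite C"
  shows "\<exists>I. finite I \<and> span I = span C \<and> (\<forall>a\<in>I. \<forall>b\<in>I. a \<bullet> b = (if a = b then 1 else 0))"
  using assms
proof (induction C rule: finite_induct)
  case empty
  then show ?case by (intro exI[of _ "{}"]) auto
next
  case (insert c C)
  then obtain I where I: "finite I" "span I = span C"
    "\<And>a b. a \<in> I \<Longrightarrow> b \<in> I \<Longrightarrow> a \<bullet> b = (if a = b then 1 else 0)" by blast
  obtain d where d: "d \<in> span C" "\<And>u. u \<in> span C \<Longrightarrow> (c - d) \<bullet> u = 0"
    using orthogonal_projection_exists[OF bilinear_inner inner_commute _ insert.hyps(1)]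
    by (metis inner_gt_zero_iff)
  show ?case
  proof (cases "c = d")
    case True
    then show ?thesis using I span_redundant[OF d(1)] by (intro exI[of _ I]) simp
  next
    case False
    define n where "n = (c - d) /\<^sub>R norm (c - d)"
    have n: "n \<bullet> n = 1" using False by (simp add: n_def dot_square_norm power2_eq_square)
    have n0: "n \<bullet> u = 0" "u \<bullet> n = 0" if "u \<in> I" for u
      using d(2)[of u] I(2) span_base[OF that] by (simp_all add: n_def inner_commute)
    have "c = norm (c - d) *\<^sub>R n + d" using False by (simp add: n_def)
    then have "c \<in> span (insert n I)"
      using d(1) I(2) by (metis span_add span_scale span_base insertI1 span_mono subset_insertI subsetD)
    moreover have "n \<in> span (insert c C)"
      unfolding n_def using d(1)
      by (metis span_scale span_diff span_base insertI1 span_mono subset_insertI subsetD)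
    moreover have "span I \<subseteq> span (insert n I)" "span C \<subseteq> span (insert c C)"
      by (simp_all add: span_mono subset_insertI)
    ultimately have "span (insert n I) = span (insert c C)"
      using I(2) span_superset[of I] span_superset[of C]
      by (intro antisym span_minimal) auto
    moreover have "n \<notin> I" using n n0(1) by fastforce
    ultimately show ?thesis using I(1,3) n n0
      by (intro exI[of _ "insert n I"]) fastforce
  qed
qed

text \<open>The last clause says that \<open>I\<close> spans, in the form of the expansion that is
  used throughout; \<open>I = {}\<close> is the case of dimension 0.\<close>

definition onb :: "'a::real_inner set \<Rightarrow> bool" where
  "onb I \<longleftrightarrow> finite I \<and> (\<forall>a\<in>I. \<forall>b\<in>I. a \<bullet> b = (if a = b then 1 else 0)) \<and> (\<forall>v. v = (\<Sum>b\<in>I. (v \<bullet> b) *\<^sub>R b))"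

lemma onb_exists:
  assumes "finite (B::'a::real_inner set)" "span B = UNIV"
  shows "\<exists>I::'a set. onb I"
proof -
  obtain I :: "'a set" where I: "finite I" "span I = UNIV"
    "\<And>a b. a \<in> I \<Longrightarrow> b \<in> I \<Longrightarrow> a \<bullet> b = (if a = b then 1 else 0)"
    using orthonormal_basis_exists_span[OF assms(1)] assms(2) by blast
  have expand: "v = (\<Sum>b\<in>I. (v \<bullet> b) *\<^sub>R b)" for v
  proof -
    have "v \<in> span I" using I by auto
    then obtain u where u: "v = (\<Sum>b\<in>I. u b *\<^sub>R b)"
      using span_finite[OF I(1)] by auto
    have "v \<bullet> b = u b" if "b \<in> I" for b
    proof -
      have "v \<bullet> b = (\<Sum>a\<in>I. u a * (if a = b then 1 else 0))"
        unfolding u inner_sum_left using I(3) that by (intro sum.cong) auto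
      then show ?thesis using that I(1) by (simp add: if_distrib cong: if_cong)
    qed
    then show ?thesis using u by (metis (no_types, lifting) sum.cong)
  qed
  show ?thesis
    unfolding onb_def by (intro exI[of _ I] conjI ballI allI I expand)
qed

lemma
  assumes "onb (I::'a::real_inner set)"
  shows onb_finite: "finite I"
    and onb_inner: "\<And>a b. a \<in> I \<Longrightarrow> b \<in> I \<Longrightarrow> a \<bullet> b = (if a = b then 1 else 0)"
    and onb_expand: "\<And>v. v = (\<Sum>b\<in>I. (v \<bullet> b) *\<^sub>R b)"
  using assms unfolding onb_def by blast+

text \<open>Heine--Borel for the model space: a coordinate cube is compact, being built up one basis
  vector at a time as a continuous image of an interval times a smaller cube, and the ball is a
  closed subset of such a cube.\<close>

lemma compact_cball_onb:
  fixes I :: "'a::real_inner set"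
  assumes "onb I"
  shows "compact (cball (a::'a) r)"
proof -
  have "compact {\<Sum>b\<in>J. x b *\<^sub>R b | x. \<forall>b\<in>J. \<bar>x b\<bar> \<le> R}" if "finite J" for J :: "'a set" and R :: real
    using that
  proof (induction J rule: finite_induct)
    case empty
    then show ?case by simp
  next
    case (insert c J)
    let ?K = "\<lambda>J. {\<Sum>b\<in>J. x b *\<^sub>R b | x. \<forall>b\<in>J. \<bar>x b\<bar> \<le> R}"
    have "?K (insert c J) = (\<lambda>(t,k). t *\<^sub>R c + k) ` ({-R..R} \<times> ?K J)" (is "?l = ?r")
    proof
      show "?l \<subseteq> ?r"
        using insert.hyps by (force simp: image_iff abs_le_iff)
      show "?r \<subseteq> ?l"
      proof
        fix y assume "y \<in> ?r"
        then obtain t x where y: "y = t *\<^sub>R c + (\<Sum>b\<in>J. x b *\<^sub>R b)" "t \<in> {-R..R}" "\<forall>b\<in>J. \<bar>x b\<bar> \<le> R"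
          by auto
        have "(\<Sum>b\<in>J. (x(c:=t)) b *\<^sub>R b) = (\<Sum>b\<in>J. x b *\<^sub>R b)"
          using insert.hyps by (intro sum.cong) auto
        then have "y = (\<Sum>b\<in>insert c J. (x(c:=t)) b *\<^sub>R b)"
          using y(1) insert.hyps by simp
        moreover have "\<forall>b\<in>insert c J. \<bar>(x(c:=t)) b\<bar> \<le> R" using y by auto
        ultimately show "y \<in> ?l" by blast
      qed
    qed
    moreover have "compact ((\<lambda>(t,k). t *\<^sub>R c + k) ` ({-R..R} \<times> ?K J))"
      by (intro compact_continuous_image compact_Times insert.IH compact_Icc)
        (auto simp: case_prod_beta intro!: continuous_intros)
    ultimately show ?case by simp
  qed
  then have comp: "compact {\<Sum>b\<in>I. x b *\<^sub>R b | x. \<forall>b\<in>I. \<bar>x b\<bar> \<le> norm a + r}" (is "compact ?K")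
    using onb_finite[OF assms] by blast
  \<comment> \<open>Coordinates in an orthonormal basis are bounded by the norm, and vectors of the
    ball have norm at most \<open>norm a + r\<close>; hence this half-width of the cube.\<close>
  have "cball a r \<subseteq> ?K"
  proof
    fix v assume "v \<in> cball a r"
    then have "norm v \<le> norm a + r"
      using norm_triangle_ineq4[of a "a - v"] by (auto simp: dist_norm)
    moreover have "\<bar>v \<bullet> b\<bar> \<le> norm v" if "b \<in> I" for b
      using Cauchy_Schwarz_ineq2[of v b] onb_inner[OF assms that that]
      by (simp add: norm_eq_sqrt_inner)
    ultimately have "\<forall>b\<in>I. \<bar>v \<bullet> b\<bar> \<le> norm a + r" by force
    moreover have "v = (\<Sum>b\<in>I. (v \<bullet> b) *\<^sub>R b)" by (rule onb_expand[OF assms])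
    ultimately show "v \<in> ?K" by blast
  qed
  then show ?thesis
    using compact_Int_closed[OF comp closed_cball[of a r]] by (simp add: Int_absorb1)
qed

lemma smooth_on_compose:
  fixes f :: "'a::real_normed_vector \<Rightarrow> 'b::real_inner"
  assumes "onb (I::'b set)" "open S" "open T" "f ` S \<subseteq> T" "smooth_on S f" "smooth_on T g"
  shows "smooth_on S (\<lambda>x. g (f x))"
  using C_k_on_compose[OF onb_expand[OF assms(1)] assms(2-4)] assms(5,6)
  unfolding smooth_on_def by blast

section \<open>Smooth cut-off functions\<close>

text \<open>The classical exp(-1/t), together with its multiples by powers of 1/t: derivatives of
  members of this family are combinations of members, so one induction proves all of them
  smooth.\<close>

definition flat :: "nat \<Rightarrow> real \<Rightarrow> real" where
  "flat n t = (if t > 0 then inverse t ^ n * exp (- inverse t) else 0)"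

lemma flat_tendsto_0: "(flat n \<longlongrightarrow> 0) (at 0)"
proof -
  have "((\<lambda>t. inverse t ^ n / exp (inverse t)) \<longlongrightarrow> 0) (at_right (0::real))"
    by (rule filterlim_compose[OF tendsto_power_div_exp_0 filterlim_inverse_at_top_right])
  then have "(flat n \<longlongrightarrow> 0) (at_right 0)"
    by (rule Lim_transform_eventually)
      (auto simp: flat_def exp_minus divide_inverse eventually_at_right_field intro!: exI[of _ 1])
  moreover have "(flat n \<longlongrightarrow> 0) (at_left 0)"
    by (rule Lim_transform_eventually[OF tendsto_const])
      (auto simp: flat_def eventually_at_left_field intro!: exI[of _ "-1"])
  ultimately show ?thesis by (simp add: filterlim_split_at)
qed

lemma flat_has_derivative:
  "(flat n has_real_derivative (flat (n + 2) t - real n * flat (n + 1) t)) (at t)"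
proof -
  consider "t > 0" | "t < 0" | "t = 0" by linarith
  then show ?thesis
  proof cases
    case 1
    have "((\<lambda>t. inverse t ^ n) has_real_derivative - (real n * inverse t ^ (n + 1))) (at t)"
      using DERIV_power[OF DERIV_inverse, of t n UNIV] 1
      by (cases n) (auto simp: field_simps power2_eq_square)
    moreover have "((\<lambda>t. exp (- inverse t)) has_real_derivative exp (- inverse t) * inverse t ^ 2) (at t)"
      using 1 by (auto intro!: derivative_eq_intros simp: power2_eq_square)
    ultimately have "((\<lambda>t. inverse t ^ n * exp (- inverse t)) has_real_derivative
        (flat (n + 2) t - real n * flat (n + 1) t)) (at t)"
      using DERIV_mult 1 by (fastforce simp: flat_def field_simps power2_eq_square)
    then show ?thesis
      using has_field_derivative_transform_within_open[of _ _ t "{0<..}" "flat n"] 1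
      by (auto simp: flat_def)
  next
    case 2
    have "((\<lambda>t. 0) has_real_derivative (flat (n + 2) t - real n * flat (n + 1) t)) (at t)"
      using 2 by (simp add: flat_def)
    then show ?thesis
      using has_field_derivative_transform_within_open[of "\<lambda>t. 0" _ t "{..<0}" "flat n"] 2
      by (auto simp: flat_def)
  next
    case 3
    \<comment> \<open>At 0 the difference quotient of \<open>flat n\<close> is
      \<open>flat (n + 1)\<close>, whose limit is known; the derivative 0 agrees with the general
      formula.\<close>
    have "((\<lambda>h. (flat n (0 + h) - flat n 0) / h) \<longlongrightarrow> 0) (at 0)"
      by (rule Lim_transform_eventually[OF flat_tendsto_0[of "n + 1"]])
        (auto simp: flat_def field_simps eventually_at_filter)
    then show ?thesis using 3 by (simp add: DERIV_def flat_def)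
  qed
qed

lemma C_k_on_flat: "C_k_on k UNIV (flat n)"
proof (induction k arbitrary: n)
  case 0
  then show ?case
    using DERIV_isCont[OF flat_has_derivative]
    by (auto intro!: continuous_at_imp_continuous_on)
next
  case (Suc k)
  have "C_k_on k UNIV (\<lambda>t. (flat (n + 2) t + (- real n) * flat (n + 1) t) * v)" for v
    by (intro C_k_on_mult C_k_on_add C_k_on_const Suc.IH open_UNIV)
  then show ?case
    by (subst C_k_on_Suc_iff[OF _ flat_has_derivative[THEN has_field_derivative_imp_has_derivative]])
      auto
qed

text \<open>A step with plateau 1 for t \<le> 1 and plateau 0 for t \<ge> 2. The denominator is
  positive because \<open>2 - t\<close> and \<open>t - 1\<close> are never both nonpositive.\<close>

definition smooth_step :: "real \<Rightarrow> real" where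
  "smooth_step t = flat 0 (2 - t) * inverse (flat 0 (2 - t) + flat 0 (t - 1))"

lemma onb_real: "onb {1::real}"
  by (simp add: onb_def)

lemma smooth_on_smooth_step: "smooth_on UNIV smooth_step"
proof -
  have lin: "smooth_on UNIV (\<lambda>t::real. a * t + b)" for a b
    by (intro smooth_on_add smooth_on_mult smooth_on_const smooth_on_bounded_linear) auto
  have flat: "smooth_on UNIV (flat 0)"
    using C_k_on_flat smooth_on_def by blast
  have 1: "smooth_on UNIV (\<lambda>t. flat 0 (2 - t))"
    using smooth_on_compose[OF onb_real _ _ _ lin[of "-1" 2] flat] by simp
  have 2: "smooth_on UNIV (\<lambda>t. flat 0 (t - 1))"
    using smooth_on_compose[OF onb_real _ _ _ lin[of 1 "-1"] flat] by simp
  have "flat 0 (2 - t) + flat 0 (t - 1) \<noteq> 0" for t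
    by (cases "t < 2") (auto simp: flat_def add_pos_nonneg intro!: less_imp_neq[symmetric] add_pos_nonneg)
  then show ?thesis
    unfolding smooth_step_def[abs_def]
    by (intro smooth_on_mult smooth_on_inverse smooth_on_add 1 2) auto
qed

lemma smooth_step_eq_1: "t \<le> 1 \<Longrightarrow> smooth_step t = 1"
  and smooth_step_eq_0: "t \<ge> 2 \<Longrightarrow> smooth_step t = 0"
  by (auto simp: smooth_step_def flat_def)

text \<open>The squared distance keeps the argument smooth at the centre \<open>a\<close>. The value
  is 1 where \<open>s\<close> times it is at most 1, and 0 where that is at least 2.\<close>

definition bump :: "'a::real_inner \<Rightarrow> real \<Rightarrow> 'a \<Rightarrow> real" where
  "bump a s x = smooth_step (s * ((x - a) \<bullet> (x - a)))"

lemma smooth_on_bump: "smooth_on UNIV (bump a s)"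
proof -
  have d: "smooth_on UNIV (\<lambda>x. x + (- a))"
    by (intro smooth_on_add smooth_on_const smooth_on_bounded_linear bounded_linear_ident) auto
  have "smooth_on UNIV (\<lambda>x. s * ((x + (- a)) \<bullet> (x + (- a))))"
    by (intro smooth_on_mult smooth_on_const smooth_on_inner d) auto
  from smooth_on_compose[OF onb_real _ _ _ this smooth_on_smooth_step]
  show ?thesis by (simp add: bump_def[abs_def])
qed

section \<open>Smooth functions and tangent vectors on a manifold\<close>

text \<open>The directional derivative along \<open>a\<close> in the chart. The value 0 on functions
  that are not smooth matches \<open>velocity\<close>, so that the two can be equal as HOL
  functions.\<close>

definition coord_vec ::
    "('m::topological_space, 'a::real_inner) chart set \<Rightarrow> 'm set \<Rightarrow> ('m \<Rightarrow> 'a) \<Rightarrow> 'm \<Rightarrow> 'a \<Rightarrow> 'm tvec" where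
  "coord_vec A U c p a =
     (\<lambda>f. if smooth_fun A f then frechet_derivative (f \<circ> inv_into U c) (at (c p)) a else 0)"

definition extend_zero :: "'m set \<Rightarrow> ('m \<Rightarrow> 'a) \<Rightarrow> ('a \<Rightarrow> real) \<Rightarrow> 'm \<Rightarrow> real" where
  "extend_zero U c u r = (if r \<in> U then u (c r) else 0)"

locale manifold =
  fixes A :: "('m::{t2_space,second_countable_topology}, 'a::real_inner) chart set"
  assumes smooth_manifold: "smooth_manifold A"
begin

lemma ex_onb: "\<exists>I::'a set. onb I"
  using smooth_manifold onb_exists unfolding smooth_manifold_def by blast

lemma chart_ex: "\<exists>U c. (U, c) \<in> A \<and> p \<in> U"
  using smooth_manifold unfolding smooth_manifold_def by blast

lemma
  assumes "(U, c) \<in> A"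
  shows open_chart: "open U" and open_chart_image: "open (c ` U)"
    and homeomorphism_chart: "homeomorphism U (c ` U) c (inv_into U c)"
  using smooth_manifold assms unfolding smooth_manifold_def by blast+

lemma chart_inverse:
  assumes "(U, c) \<in> A" "p \<in> U"
  shows "inv_into U c (c p) = p"
  using homeomorphism_chart[OF assms(1)] assms(2) by (simp add: homeomorphism_def)

lemma chart_transition:
  "(U, c) \<in> A \<Longrightarrow> (V, d) \<in> A \<Longrightarrow> smooth_on (c ` (U \<inter> V)) (d \<circ> inv_into U c)"
  using smooth_manifold unfolding smooth_manifold_def by blast

lemma open_image_chart:
  assumes "(U, c) \<in> A" "open W" "W \<subseteq> U"
  shows "open (c ` W)"
proof -
  have "openin (top_of_set U) W"
    using assms open_openin_trans open_chart by blast
  then have "openin (top_of_set (c ` U)) (c ` W)"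
    using homeomorphism_imp_open_map[OF homeomorphism_chart[OF assms(1)]] by blast
  then show ?thesis
    using open_chart_image[OF assms(1)] openin_open_eq by blast
qed

lemma smooth_on_chart: "smooth_fun A f \<Longrightarrow> (U, c) \<in> A \<Longrightarrow> smooth_on (c ` U) (f \<circ> inv_into U c)"
  unfolding smooth_fun_def by blast

text \<open>Independence of the chart: near a point the expression in any other chart is the given
  one composed with a transition map. The set \<open>W\<close> may be smaller than the chart domain,
  which suits functions that are understood only near a point.\<close>

lemma smooth_funI_local:
  assumes "\<And>p. \<exists>U c W. (U, c) \<in> A \<and> open W \<and> p \<in> W \<and> W \<subseteq> U \<and> smooth_on (c ` W) (f \<circ> inv_into U c)"
  shows "smooth_fun A f"
  unfolding smooth_fun_def
proof (clarify)
  fix V d assume V: "(V, d) \<in> A"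
  show "smooth_on (d ` V) (f \<circ> inv_into V d)"
  proof (rule smooth_on_local)
    fix x assume x: "x \<in> d ` V"
    define p where "p = inv_into V d x"
    have p: "p \<in> V" "d p = x" unfolding p_def using x by (auto simp: inv_into_into f_inv_into_f)
    obtain U c W where U: "(U, c) \<in> A" "open W" "p \<in> W" "W \<subseteq> U"
      "smooth_on (c ` W) (f \<circ> inv_into U c)"
      using assms by blast
    obtain I :: "'a set" where I: "onb I" using ex_onb by blast
    let ?T = "d ` (W \<inter> V)"
    have oT: "open ?T" "open (c ` W)"
      using open_image_chart[OF V open_Int[OF U(2) open_chart[OF V]]] open_image_chart[OF U(1,2,4)]
      by auto
    have "smooth_on ?T (\<lambda>x. (c \<circ> inv_into V d) x)"
      by (rule smooth_on_subset) (use chart_transition[OF V U(1)] U(4) in \<open>auto simp: o_def\<close>)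
    moreover have "(\<lambda>x. (c \<circ> inv_into V d) x) ` ?T \<subseteq> c ` W"
      using chart_inverse[OF V] by auto
    ultimately have "smooth_on ?T (\<lambda>x. (f \<circ> inv_into U c) ((c \<circ> inv_into V d) x))"
      by (intro smooth_on_compose[OF I oT _ _ U(5)])
    moreover have "(f \<circ> inv_into U c) ((c \<circ> inv_into V d) y) = (f \<circ> inv_into V d) y" if "y \<in> ?T" for y
      using that chart_inverse[OF V] chart_inverse[OF U(1)] U(4) by auto
    ultimately have "smooth_on ?T (f \<circ> inv_into V d)"
      by (rule smooth_on_cong[OF oT(1), rotated])
    then show "\<exists>T. open T \<and> x \<in> T \<and> smooth_on T (f \<circ> inv_into V d)"
      using oT(1) p U(3) by blast
  qed
qed

lemma smooth_fun_const: "smooth_fun A (\<lambda>p. a)"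
  unfolding smooth_fun_def using open_chart_image by (auto simp: o_def intro!: smooth_on_const)

lemma smooth_fun_add: "smooth_fun A f \<Longrightarrow> smooth_fun A g \<Longrightarrow> smooth_fun A (\<lambda>p. f p + g p)"
  unfolding smooth_fun_def using open_chart_image
  by (force simp: o_def intro!: smooth_on_add)

lemma smooth_fun_mult: "smooth_fun A f \<Longrightarrow> smooth_fun A g \<Longrightarrow> smooth_fun A (\<lambda>p. f p * g p)"
  unfolding smooth_fun_def using open_chart_image
  by (force simp: o_def intro!: smooth_on_mult)

lemma smooth_fun_diff: "smooth_fun A f \<Longrightarrow> smooth_fun A g \<Longrightarrow> smooth_fun A (\<lambda>p. f p - g p)"
  using smooth_fun_add[of f "\<lambda>p. -1 * g p"] smooth_fun_mult[OF smooth_fun_const, of g "-1"] by simp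

lemma smooth_fun_sum: "(\<And>i. i \<in> I \<Longrightarrow> smooth_fun A (f i)) \<Longrightarrow> smooth_fun A (\<lambda>p. \<Sum>i\<in>I. f i p)"
  by (induction I rule: infinite_finite_induct) (auto intro: smooth_fun_const smooth_fun_add)

lemma smooth_fun_continuous:
  assumes "smooth_fun A f"
  shows "continuous_on UNIV f"
proof -
  have "isCont f p" for p
  proof -
    obtain U c where U: "(U, c) \<in> A" "p \<in> U" using chart_ex by blast
    have "continuous_on (c ` U) (f \<circ> inv_into U c)"
      using smooth_on_continuous_on smooth_on_chart assms U by blast
    moreover have "continuous_on U c"
      using homeomorphism_chart[OF U(1)] homeomorphism_def by blast
    ultimately have "continuous_on U ((f \<circ> inv_into U c) \<circ> c)"
      by (rule continuous_on_compose[rotated])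
    then have "continuous_on U f"
      using chart_inverse[OF U(1)] by (subst continuous_on_cong[OF refl, of _ _ "(f \<circ> inv_into U c) \<circ> c"]) auto
    then show ?thesis using open_chart U continuous_on_eq_continuous_at by blast
  qed
  then show ?thesis by (simp add: continuous_at_imp_continuous_on)
qed

text \<open>Near each point \<open>u\<close> is the smooth product divided by the nonvanishing
  \<rho>. Thus identities that hold only after multiplication by a cut-off or a cleared denominator
  still give smoothness.\<close>

lemma smooth_fun_cancel:
  assumes "\<And>p. \<exists>\<rho>. smooth_fun A \<rho> \<and> \<rho> p \<noteq> 0 \<and> smooth_fun A (\<lambda>r. \<rho> r * u r)"
  shows "smooth_fun A u"
proof (rule smooth_funI_local)
  fix p
  obtain \<rho> where \<rho>: "smooth_fun A \<rho>" "\<rho> p \<noteq> 0" "smooth_fun A (\<lambda>r. \<rho> r * u r)"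
    using assms by blast
  obtain U c where U: "(U, c) \<in> A" "p \<in> U" using chart_ex by blast
  define W where "W = U \<inter> {r. \<rho> r \<noteq> 0}"
  have "open W"
    unfolding W_def using open_chart[OF U(1)] smooth_fun_continuous[OF \<rho>(1)]
    by (intro open_Int open_Collect_neq) auto
  then have o: "open (c ` W)" using open_image_chart U(1) W_def by blast
  have sub: "c ` W \<subseteq> c ` U" unfolding W_def by blast
  have "smooth_on (c ` W) (\<lambda>x. inverse ((\<rho> \<circ> inv_into U c) x) * ((\<lambda>r. \<rho> r * u r) \<circ> inv_into U c) x)"
    by (intro smooth_on_mult smooth_on_inverse o smooth_on_subset[OF smooth_on_chart[OF _ U(1)] sub] \<rho>)
      (auto simp: W_def chart_inverse[OF U(1)])
  then have "smooth_on (c ` W) (u \<circ> inv_into U c)"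
    by (rule smooth_on_cong[OF o, rotated]) (auto simp: W_def chart_inverse[OF U(1)])
  then show "\<exists>U c W. (U, c) \<in> A \<and> open W \<and> p \<in> W \<and> W \<subseteq> U \<and> smooth_on (c ` W) (u \<circ> inv_into U c)"
    using U \<rho>(2) \<open>open W\<close> W_def by blast
qed

text \<open>The Hausdorff property enters here: the preimage of \<open>K\<close> is compact, hence
  closed in the whole manifold, so a point outside \<open>U\<close> has a neighbourhood on which the
  extension vanishes.\<close>

lemma smooth_fun_extend_zero:
  assumes U: "(U, c) \<in> A" and K: "compact K" "K \<subseteq> c ` U"
    and u: "smooth_on (c ` U) u" "\<And>x. x \<in> c ` U - K \<Longrightarrow> u x = 0"
  shows "smooth_fun A (extend_zero U c u)"
proof (rule smooth_funI_local)
  fix p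
  show "\<exists>V d W. (V, d) \<in> A \<and> open W \<and> p \<in> W \<and> W \<subseteq> V \<and>
      smooth_on (d ` W) (extend_zero U c u \<circ> inv_into V d)"
  proof (cases "p \<in> U")
    case True
    have "smooth_on (c ` U) (extend_zero U c u \<circ> inv_into U c)"
      by (rule smooth_on_cong[OF open_chart_image[OF U] _ u(1)])
        (auto simp: extend_zero_def chart_inverse[OF U])
    then show ?thesis using True U open_chart by blast
  next
    case False
    let ?C = "inv_into U c ` K"
    have "continuous_on K (inv_into U c)"
      using homeomorphism_chart[OF U] K(2) continuous_on_subset homeomorphism_def by blast
    then have "closed ?C" using compact_imp_closed compact_continuous_image K(1) by blast
    obtain V d where V: "(V, d) \<in> A" "p \<in> V" using chart_ex by blast
    have "?C \<subseteq> U" using K(2) inv_into_into[of _ c U] by blast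
    then have p: "p \<in> V - ?C" using False V(2) by blast
    have o: "open (V - ?C)" using \<open>closed ?C\<close> open_chart[OF V(1)] by blast
    have zero: "extend_zero U c u r = 0" if "r \<in> V - ?C" for r
    proof (cases "r \<in> U")
      case True
      then have "c r \<notin> K" using that chart_inverse[OF U True] by force
      then show ?thesis using True u(2) by (simp add: extend_zero_def)
    qed (simp add: extend_zero_def)
    have od: "open (d ` (V - ?C))" using open_image_chart[OF V(1) o] by blast
    have "smooth_on (d ` (V - ?C)) (extend_zero U c u \<circ> inv_into V d)"
      by (rule smooth_on_cong[OF od _ smooth_on_const[OF od, of 0]])
        (use zero chart_inverse[OF V(1)] in auto)
    then show ?thesis using p o V(1) by blast
  qed
qed

section \<open>Tangent vectors in chart coordinates\<close>

text \<open>Realised by the straight line through \<open>c p\<close> in direction \<open>a\<close>,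
  restricted to times at which it stays in the chart image.\<close>

lemma coord_vec_mem_tangent_space:
  assumes U: "(U, c) \<in> A" and p: "p \<in> U"
  shows "coord_vec A U c p a \<in> tangent_space A p"
proof -
  let ?l = "\<lambda>t::real. c p + t *\<^sub>R a"
  define \<gamma> where "\<gamma> t = inv_into U c (?l t)" for t
  have oS: "open (?l -` (c ` U))"
    by (rule continuous_open_vimage[OF open_chart_image[OF U]]) (auto intro!: continuous_intros)
  have "0 \<in> ?l -` (c ` U)" using p by simp
  then obtain e where e: "e > 0" "ball 0 e \<subseteq> ?l -` (c ` U)"
    using oS open_contains_ball by blast
  have I: "{-e<..<e} \<subseteq> ?l -` (c ` U)" using e(2) by (auto simp: subset_eq dist_norm abs_less_iff)
  have c\<gamma>: "c (\<gamma> t) = ?l t" "\<gamma> t \<in> U" if "t \<in> {-e<..<e}" for t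
    using I that unfolding \<gamma>_def by (auto simp: subset_eq f_inv_into_f inv_into_into)
  have l: "smooth_on S ?l" if "open S" for S
    using that by (intro smooth_on_add smooth_on_const smooth_on_bounded_linear
        bounded_linear_scaleR_left)
  have cont: "continuous_on {-e<..<e} \<gamma>"
  proof -
    have "continuous_on (c ` U) (inv_into U c)"
      using homeomorphism_chart[OF U] homeomorphism_def by blast
    then show ?thesis
      unfolding \<gamma>_def by (rule continuous_on_compose2) (use I in \<open>auto intro!: continuous_intros\<close>)
  qed
  have "smooth_on ({-e<..<e} \<inter> \<gamma> -` V) (d \<circ> \<gamma>)" if V: "(V, d) \<in> A" for V d
  proof -
    let ?T = "{-e<..<e} \<inter> \<gamma> -` V"
    have oT: "open ?T"
      by (rule continuous_open_preimage[OF cont open_greaterThanLessThan open_chart[OF V]])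
    obtain J :: "'a set" where J: "onb J" using ex_onb by blast
    have "?l ` ?T \<subseteq> c ` (U \<inter> V)"
      using c\<gamma> by (auto simp: image_iff) (metis IntI vimageI)
    then have "smooth_on ?T (\<lambda>t. (d \<circ> inv_into U c) (?l t))"
      using smooth_on_compose[OF J oT open_image_chart[OF U] _ l[OF oT] chart_transition[OF U V]]
        open_chart U V by blast
    then show ?thesis by (simp add: \<gamma>_def o_def)
  qed
  then have "smooth_curve A {-e<..<e} \<gamma>"
    unfolding smooth_curve_def using cont by blast
  moreover have "\<gamma> 0 = p" by (simp add: \<gamma>_def chart_inverse[OF U p])
  moreover have "velocity A \<gamma> = coord_vec A U c p a"
  proof -
    have "deriv (f \<circ> \<gamma>) 0 = frechet_derivative (f \<circ> inv_into U c) (at (c p)) a" if f: "smooth_fun A f" for f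
    proof -
      let ?D = "frechet_derivative (f \<circ> inv_into U c) (at (c p))"
      have "((f \<circ> inv_into U c) has_derivative ?D) (at (?l 0))"
        using smooth_on_has_derivative[OF smooth_on_chart[OF f U]] p by simp
      moreover have "(?l has_derivative (\<lambda>t. t *\<^sub>R a)) (at 0)"
        by (auto intro!: derivative_eq_intros)
      ultimately have "((f \<circ> inv_into U c) \<circ> ?l has_derivative ?D \<circ> (\<lambda>t. t *\<^sub>R a)) (at 0)"
        by (intro diff_chain_at)
      moreover have "?D \<circ> (\<lambda>t. t *\<^sub>R a) = (*) (?D a)"
        using linear_scale[OF has_derivative_linear[OF calculation(1)]] calculation(1)
        using \<open>((f \<circ> inv_into U c) has_derivative ?D) (at (?l 0))\<close>
        by (auto simp: fun_eq_iff linear_scale[OF has_derivative_linear])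
      ultimately have "((f \<circ> \<gamma>) has_real_derivative ?D a) (at 0)"
        by (simp add: has_field_derivative_def \<gamma>_def o_def)
      then show ?thesis by (rule DERIV_imp_deriv)
    qed
    then show ?thesis unfolding velocity_def coord_vec_def by auto
  qed
  ultimately show ?thesis
    unfolding tangent_space_def using e(1) by (auto intro!: exI[of _ \<gamma>])
qed

text \<open>Curves cannot be added, so the definition by velocities shows no linear structure. By
  the chain rule a velocity depends only on the derivative of the curve in the chart; linearity of
  tangent spaces and the Leibniz rule are read off from this description.\<close>

lemma tangent_space_eq_coord_vec:
  assumes U: "(U, c) \<in> A" and p: "p \<in> U"
  shows "tangent_space A p = range (coord_vec A U c p)"
proof
  show "range (coord_vec A U c p) \<subseteq> tangent_space A p"
    using coord_vec_mem_tangent_space[OF assms] by blast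
  show "tangent_space A p \<subseteq> range (coord_vec A U c p)"
  proof
    fix v assume "v \<in> tangent_space A p"
    then obtain \<gamma> e where \<gamma>: "v = velocity A \<gamma>" "e > 0" "smooth_curve A {-e<..<e} \<gamma>" "\<gamma> 0 = p"
      unfolding tangent_space_def by blast
    let ?T = "{-e<..<e} \<inter> \<gamma> -` U"
    have oT: "open ?T"
      using \<gamma>(3) continuous_open_preimage[OF _ open_greaterThanLessThan open_chart[OF U]]
      unfolding smooth_curve_def by blast
    have T0: "0 \<in> ?T" using \<gamma> p by auto
    let ?D = "frechet_derivative (c \<circ> \<gamma>) (at 0)"
    have D: "((c \<circ> \<gamma>) has_derivative ?D) (at 0)"
      using \<gamma>(3) U T0 smooth_on_has_derivative unfolding smooth_curve_def by blast
    have "deriv (f \<circ> \<gamma>) 0 = frechet_derivative (f \<circ> inv_into U c) (at (c p)) (?D 1)"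
      if f: "smooth_fun A f" for f
    proof -
      let ?E = "frechet_derivative (f \<circ> inv_into U c) (at (c p))"
      have E: "((f \<circ> inv_into U c) has_derivative ?E) (at ((c \<circ> \<gamma>) 0))"
        using smooth_on_has_derivative[OF smooth_on_chart[OF f U]] p \<gamma>(4) by simp
      have "((f \<circ> inv_into U c) \<circ> (c \<circ> \<gamma>) has_derivative ?E \<circ> ?D) (at 0)"
        by (rule diff_chain_at[OF D E])
      then have "((f \<circ> \<gamma>) has_derivative ?E \<circ> ?D) (at 0)"
        by (rule has_derivative_transform_within_open[OF _ oT T0]) (auto simp: chart_inverse[OF U])
      moreover have "?E \<circ> ?D = (*) (?E (?D 1))"
      proof
        fix t :: real
        have "?D t = t *\<^sub>R ?D 1"
          using linear_scale[OF has_derivative_linear[OF D], of t 1] by simp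
        then show "(?E \<circ> ?D) t = ?E (?D 1) * t"
          using linear_scale[OF has_derivative_linear[OF E]] by simp
      qed
      ultimately show ?thesis
        by (intro DERIV_imp_deriv) (simp add: has_field_derivative_def)
    qed
    then have "v = coord_vec A U c p (?D 1)"
      unfolding \<gamma>(1) velocity_def coord_vec_def by auto
    then show "v \<in> range (coord_vec A U c p)" by blast
  qed
qed

lemma coord_vec_has_derivative:
  assumes "(U, c) \<in> A" "p \<in> U" "smooth_fun A f"
  shows "((f \<circ> inv_into U c) has_derivative (\<lambda>a. coord_vec A U c p a f)) (at (c p))"
  using smooth_on_has_derivative[OF smooth_on_chart[OF assms(3,1)], of "c p"] assms
  by (simp add: coord_vec_def)

lemma coord_vec_eqI:
  assumes "(U, c) \<in> A" "p \<in> U" "smooth_fun A f"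
    and "((f \<circ> inv_into U c) has_derivative D) (at (c p))"
  shows "coord_vec A U c p a f = D a"
  using has_derivative_unique[OF coord_vec_has_derivative[OF assms(1-3)] assms(4)] by meson

lemma coord_vec_linear:
  assumes "(U, c) \<in> A" "p \<in> U"
  shows "coord_vec A U c p (a + b) = coord_vec A U c p a + coord_vec A U c p b"
    and "coord_vec A U c p (s *\<^sub>R a) = tv_scale s (coord_vec A U c p a)"
proof -
  have "coord_vec A U c p (a + b) f = coord_vec A U c p a f + coord_vec A U c p b f \<and>
    coord_vec A U c p (s *\<^sub>R a) f = s * coord_vec A U c p a f" for f
  proof (cases "smooth_fun A f")
    case True
    then have "linear (\<lambda>a. coord_vec A U c p a f)"
      using has_derivative_linear[OF coord_vec_has_derivative[OF assms]] by blast
    then show ?thesis using linear_add linear_scale by fastforce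
  qed (simp add: coord_vec_def)
  then show "coord_vec A U c p (a + b) = coord_vec A U c p a + coord_vec A U c p b"
    and "coord_vec A U c p (s *\<^sub>R a) = tv_scale s (coord_vec A U c p a)"
    by (auto simp: tv_scale_def)
qed

lemma tangent_space_zero: "0 \<in> tangent_space A p"
  and tangent_space_add: "v \<in> tangent_space A p \<Longrightarrow> w \<in> tangent_space A p \<Longrightarrow> v + w \<in> tangent_space A p"
  and tangent_space_scale: "v \<in> tangent_space A p \<Longrightarrow> tv_scale s v \<in> tangent_space A p"
proof -
  obtain U c where U: "(U, c) \<in> A" "p \<in> U" using chart_ex by blast
  note eq = tangent_space_eq_coord_vec[OF U]
  show scale: "v \<in> tangent_space A p \<Longrightarrow> tv_scale s v \<in> tangent_space A p" for v s
    unfolding eq using coord_vec_linear(2)[OF U, symmetric] by auto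
  show "v \<in> tangent_space A p \<Longrightarrow> w \<in> tangent_space A p \<Longrightarrow> v + w \<in> tangent_space A p"
    unfolding eq using coord_vec_linear(1)[OF U, symmetric] by auto
  have "coord_vec A U c p 0 = tv_scale 0 (coord_vec A U c p 0)"
    using coord_vec_linear(2)[OF U, of 0 0] by simp
  then have "coord_vec A U c p 0 = 0" by (simp add: tv_scale_def zero_fun_def)
  then show "0 \<in> tangent_space A p" unfolding eq by (metis rangeI)
qed

lemma tangent_vec_not_smooth:
  "v \<in> tangent_space A p \<Longrightarrow> \<not> smooth_fun A f \<Longrightarrow> v f = 0"
  unfolding tangent_space_def velocity_def by auto

lemma tangent_vec_add:
  assumes "v \<in> tangent_space A p" "smooth_fun A f" "smooth_fun A g"
  shows "v (\<lambda>r. f r + g r) = v f + v g"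
proof -
  obtain U c where U: "(U, c) \<in> A" "p \<in> U" using chart_ex by blast
  obtain a where v: "v = coord_vec A U c p a" using assms(1) tangent_space_eq_coord_vec[OF U] by auto
  have "((\<lambda>r. f r + g r) \<circ> inv_into U c has_derivative
      (\<lambda>a. coord_vec A U c p a f + coord_vec A U c p a g)) (at (c p))"
    using has_derivative_add[OF coord_vec_has_derivative[OF U assms(2)]
        coord_vec_has_derivative[OF U assms(3)]] by (simp add: o_def)
  then show ?thesis
    unfolding v by (rule coord_vec_eqI[OF U smooth_fun_add[OF assms(2,3)]])
qed

lemma tangent_vec_mult:
  assumes "v \<in> tangent_space A p" "smooth_fun A f" "smooth_fun A g"
  shows "v (\<lambda>r. f r * g r) = f p * v g + v f * g p"
proof -
  obtain U c where U: "(U, c) \<in> A" "p \<in> U" using chart_ex by blast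
  obtain a where v: "v = coord_vec A U c p a" using assms(1) tangent_space_eq_coord_vec[OF U] by auto
  have "((\<lambda>r. f r * g r) \<circ> inv_into U c has_derivative
      (\<lambda>a. f p * coord_vec A U c p a g + coord_vec A U c p a f * g p)) (at (c p))"
    using has_derivative_mult[OF coord_vec_has_derivative[OF U assms(2)]
        coord_vec_has_derivative[OF U assms(3)]] by (simp add: o_def chart_inverse[OF U])
  then show ?thesis
    unfolding v by (rule coord_vec_eqI[OF U smooth_fun_mult[OF assms(2,3)]])
qed

lemma tangent_vec_const:
  assumes "v \<in> tangent_space A p"
  shows "v (\<lambda>r. a) = 0"
proof -
  obtain U c where U: "(U, c) \<in> A" "p \<in> U" using chart_ex by blast
  obtain b where v: "v = coord_vec A U c p b" using assms(1) tangent_space_eq_coord_vec[OF U] by auto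
  show ?thesis
    unfolding v by (rule coord_vec_eqI[OF U smooth_fun_const]) (simp add: o_def)
qed

lemma tangent_vec_sum:
  assumes "v \<in> tangent_space A p" "\<And>i. i \<in> I \<Longrightarrow> smooth_fun A (f i)"
  shows "v (\<lambda>r. \<Sum>i\<in>I. f i r) = (\<Sum>i\<in>I. v (f i))"
  using assms(2)
  by (induction I rule: infinite_finite_induct)
    (simp_all add: tangent_vec_const[OF assms(1)] tangent_vec_add[OF assms(1)] smooth_fun_sum)

section \<open>Global vector fields and cut-off frames\<close>

lemma vector_fieldsD:
  assumes "X \<in> vector_fields A"
  shows "X p \<in> tangent_space A p" "smooth_fun A f \<Longrightarrow> smooth_fun A (\<lambda>p. X p f)"
  using assms unfolding vector_fields_def vector_fields_along_def by auto

lemma vector_fieldsI: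
  assumes "\<And>p. X p \<in> tangent_space A p" "\<And>f. smooth_fun A f \<Longrightarrow> smooth_fun A (\<lambda>p. X p f)"
  shows "X \<in> vector_fields A"
  using assms unfolding vector_fields_def vector_fields_along_def by auto

text \<open>A frame \<open>E\<close> with coordinate functions \<open>y\<close> near \<open>p\<close>, all cut off so as to be globally smooth:
  the cut-off \<open>\<kappa>\<close> turns the expansion in coordinates into an identity of global vector fields.\<close>

definition local_frame ::
    "'m \<Rightarrow> 'a set \<Rightarrow> ('a \<Rightarrow> 'm vfield) \<Rightarrow> ('a \<Rightarrow> 'm \<Rightarrow> real) \<Rightarrow> ('m \<Rightarrow> real) \<Rightarrow> bool" where
  "local_frame p I E y \<kappa> \<longleftrightarrow> onb I \<and>
     (\<forall>i\<in>I. E i \<in> vector_fields A) \<and> (\<forall>i\<in>I. smooth_fun A (y i)) \<and> smooth_fun A \<kappa> \<and> \<kappa> p = 1 \<and>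
     (\<forall>i\<in>I. \<forall>j\<in>I. E i p (y j) = (if i = j then 1 else 0)) \<and>
     (\<forall>r. \<forall>v\<in>tangent_space A r. tv_scale (\<kappa> r) v = (\<Sum>i\<in>I. tv_scale (v (y i)) (E i r)))"

text \<open>Two nested bumps in one chart: \<psi> cuts off the coordinates and
  \<open>\<kappa>'\<close> the frame, and \<psi> is 1 near every point where
  \<open>\<kappa>'\<close> is nonzero. There the cut-off coordinates differentiate like the true
  ones; elsewhere both sides of the expansion vanish.\<close>

lemma ex_local_frame: "\<exists>I E y \<kappa>. local_frame p I E y \<kappa>"
proof -
  obtain I :: "'a set" where I: "onb I" using ex_onb by blast
  obtain U c where U: "(U, c) \<in> A" "p \<in> U" using chart_ex by blast
  obtain R where R: "R > 0" "cball (c p) R \<subseteq> c ` U"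
    using open_chart_image[OF U(1)] U(2) open_contains_cball by blast
  let ?K = "cball (c p) R"
  \<comment> \<open>With this \<open>s\<close>, \<psi> vanishes at distance \<open>R\<close> and
    beyond, where \<open>s\<close> times the squared distance is at least 2. The factor 4 below
    makes \<open>\<kappa>'\<close> vanish already from radius \<open>R / 2\<close> on, well inside
    the ball of squared radius \<open>R\<^sup>2 / 2\<close> on which \<psi> is 1.\<close>
  define s where "s = 2 / R\<^sup>2"
  have s: "s > 0" using R s_def by simp
  define \<psi> where "\<psi> = bump (c p) s"
  define \<kappa>' where "\<kappa>' = bump (c p) (4 * s)"
  have \<psi>0: "\<psi> x = 0" "\<kappa>' x = 0" if "x \<notin> ?K" for x
  proof -
    have "R\<^sup>2 \<le> (x - c p) \<bullet> (x - c p)"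
      using that R by (simp add: dist_norm norm_minus_commute dot_square_norm power_mono)
    then have "s * ((x - c p) \<bullet> (x - c p)) \<ge> 2"
      using R by (simp add: s_def field_simps)
    then show "\<psi> x = 0" "\<kappa>' x = 0"
      unfolding \<psi>_def \<kappa>'_def bump_def by (auto intro!: smooth_step_eq_0)
  qed
  have sm: "smooth_on S \<psi>" "smooth_on S \<kappa>'" for S
    using smooth_on_bump smooth_on_subset unfolding \<psi>_def \<kappa>'_def by blast+
  define y where "y b = extend_zero U c (\<lambda>x. \<psi> x * (x \<bullet> b))" for b
  define \<kappa> where "\<kappa> = extend_zero U c \<kappa>'"
  define E where "E b r = (if r \<in> U then tv_scale (\<kappa>' (c r)) (coord_vec A U c r b) else 0)" for b r
  note oU = open_chart_image[OF U(1)]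
  have inner: "smooth_on (c ` U) (\<lambda>x. x \<bullet> b)" for b
    by (intro smooth_on_bounded_linear bounded_linear_inner_left oU)
  have y: "smooth_fun A (y b)" for b
    unfolding y_def
    by (rule smooth_fun_extend_zero[OF U(1) compact_cball_onb[OF I] R(2)])
      (use \<psi>0 oU in \<open>auto intro!: smooth_on_mult sm inner\<close>)
  have \<kappa>: "smooth_fun A \<kappa>"
    unfolding \<kappa>_def
    by (rule smooth_fun_extend_zero[OF U(1) compact_cball_onb[OF I] R(2)]) (use \<psi>0 sm in auto)
  have E: "E b \<in> vector_fields A" for b
  proof (rule vector_fieldsI)
    show "E b r \<in> tangent_space A r" for r
      unfolding E_def using tangent_space_scale coord_vec_mem_tangent_space[OF U(1)] tangent_space_zero
      by auto
    show "smooth_fun A (\<lambda>r. E b r f)" if f: "smooth_fun A f" for f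
    proof -
      have "smooth_fun A (extend_zero U c (\<lambda>x. \<kappa>' x * frechet_derivative (f \<circ> inv_into U c) (at x) b))"
        by (rule smooth_fun_extend_zero[OF U(1) compact_cball_onb[OF I] R(2)])
          (use \<psi>0 oU in \<open>auto intro!: smooth_on_mult sm smooth_on_frechet_derivative smooth_on_chart f U(1)\<close>)
      moreover have "extend_zero U c (\<lambda>x. \<kappa>' x * frechet_derivative (f \<circ> inv_into U c) (at x) b)
          = (\<lambda>r. E b r f)"
        using f by (auto simp: extend_zero_def E_def tv_scale_def coord_vec_def)
      ultimately show ?thesis by simp
    qed
  qed
  have y_coord: "coord_vec A U c r a (y b) = a \<bullet> b" if r: "r \<in> U" "\<kappa>' (c r) \<noteq> 0" for r a b
  proof (rule coord_vec_eqI[OF U(1) r(1) y])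
    \<comment> \<open>On this open set \<psi> is 1. Nonvanishing of \<open>\<kappa>'\<close> at
      \<open>c r\<close> puts \<open>4 * s\<close> times the squared distance below 2, so
      \<open>c r\<close> belongs to it.\<close>
    let ?W = "c ` U \<inter> {x. s * ((x - c p) \<bullet> (x - c p)) < 1}"
    have "open ?W"
      using oU by (intro open_Int open_Collect_less continuous_intros)
    moreover have "4 * s * ((c r - c p) \<bullet> (c r - c p)) < 2"
      using r(2) smooth_step_eq_0 unfolding \<kappa>'_def bump_def by (metis not_less)
    then have "c r \<in> ?W" using r(1) by (auto simp: algebra_simps)
    moreover have "((\<lambda>x. x \<bullet> b) has_derivative (\<lambda>a. a \<bullet> b)) (at (c r))"
      by (auto intro!: derivative_eq_intros)
    moreover have "x \<bullet> b = (y b \<circ> inv_into U c) x" if "x \<in> ?W" for x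
      using that smooth_step_eq_1
      by (auto simp: y_def extend_zero_def inv_into_into f_inv_into_f chart_inverse[OF U(1)] \<psi>_def bump_def)
    ultimately show "(y b \<circ> inv_into U c has_derivative (\<lambda>a. a \<bullet> b)) (at (c r))"
      using has_derivative_transform_within_open by blast
  qed
  have \<kappa>'p: "\<kappa>' (c p) = 1" unfolding \<kappa>'_def bump_def by (simp add: smooth_step_eq_1)
  have "local_frame p I E y \<kappa>"
    unfolding local_frame_def
  proof (intro conjI ballI allI I E y \<kappa>)
    show "\<kappa> p = 1" using U(2) \<kappa>'p by (simp add: \<kappa>_def extend_zero_def)
    show "E i p (y j) = (if i = j then 1 else 0)" if "i \<in> I" "j \<in> I" for i j
      using onb_inner[OF I that] y_coord[of p] U(2) \<kappa>'p by (simp add: E_def tv_scale_def)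
    show "tv_scale (\<kappa> r) v = (\<Sum>i\<in>I. tv_scale (v (y i)) (E i r))" if v: "v \<in> tangent_space A r" for r v
    proof (cases "r \<in> U \<and> \<kappa>' (c r) \<noteq> 0")
      case True
      then have r: "r \<in> U" "\<kappa>' (c r) \<noteq> 0" by auto
      obtain a where a: "v = coord_vec A U c r a"
        using v tangent_space_eq_coord_vec[OF U(1) r(1)] by auto
      have lin: "coord_vec A U c r (\<Sum>i\<in>J. k i *\<^sub>R i) = (\<Sum>i\<in>J. tv_scale (k i) (coord_vec A U c r i))"
        if "finite J" for J k
        using that
      proof (induction J rule: finite_induct)
        case empty
        have "coord_vec A U c r 0 = tv_scale 0 (coord_vec A U c r 0)"
          using coord_vec_linear(2)[OF U(1) r(1), of 0 0] by simp
        then show ?case by (simp add: tv_scale_def zero_fun_def)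
      qed (simp add: coord_vec_linear[OF U(1) r(1)])
      have scale_sum: "tv_scale k (\<Sum>i\<in>J. w i) = (\<Sum>i\<in>J. tv_scale k (w i))" for k J and w :: "_ \<Rightarrow> 'm tvec"
        by (induction J rule: infinite_finite_induct) (auto simp: tv_scale_def fun_eq_iff algebra_simps)
      have "v = (\<Sum>i\<in>I. tv_scale (a \<bullet> i) (coord_vec A U c r i))"
        using lin[OF onb_finite[OF I], of "\<lambda>i. a \<bullet> i"] onb_expand[OF I, of a] a by metis
      then have "tv_scale (\<kappa> r) v = (\<Sum>i\<in>I. tv_scale (\<kappa> r) (tv_scale (a \<bullet> i) (coord_vec A U c r i)))"
        using scale_sum by metis
      also have "\<dots> = (\<Sum>i\<in>I. tv_scale (v (y i)) (E i r))"
        using r y_coord[OF r] a by (auto simp: E_def \<kappa>_def extend_zero_def tv_scale_def mult_ac intro!: sum.cong)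
      finally show ?thesis .
    next
      case False
      then have "\<kappa> r = 0" "E i r = 0" for i
        by (auto simp: \<kappa>_def E_def extend_zero_def tv_scale_def zero_fun_def)
      moreover have "tv_scale k (0 :: 'm tvec) = 0" "tv_scale 0 w = 0" for k and w :: "'m tvec"
        by (auto simp: tv_scale_def)
      ultimately show ?thesis by simp
    qed
  qed
  then show ?thesis by blast
qed

lemma
  assumes "local_frame p I E y \<kappa>"
  shows frame_onb: "onb I" and frame_finite: "finite I"
    and frame_fields: "\<And>i. i \<in> I \<Longrightarrow> E i \<in> vector_fields A"
    and frame_coords: "\<And>i. i \<in> I \<Longrightarrow> smooth_fun A (y i)"
    and frame_cutoff: "smooth_fun A \<kappa>" "\<kappa> p = 1"
    and frame_dual: "\<And>i j. i \<in> I \<Longrightarrow> j \<in> I \<Longrightarrow> E i p (y j) = (if i = j then 1 else 0)"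
    and frame_expand: "\<And>r v. v \<in> tangent_space A r \<Longrightarrow>
      tv_scale (\<kappa> r) v = (\<Sum>i\<in>I. tv_scale (v (y i)) (E i r))"
  using assms onb_finite[of I] unfolding local_frame_def by blast+

end

lemma smooth_fun_compose:
  fixes A :: "('m::{t2_space,second_countable_topology}, 'a::real_inner) chart set"
    and B :: "('n::{t2_space,second_countable_topology}, 'b::real_inner) chart set"
  assumes "manifold A" "manifold B" and F: "smooth_map A B F" and f: "smooth_fun B f"
  shows "smooth_fun A (f \<circ> F)"
proof -
  interpret A: manifold A by fact
  interpret B: manifold B by fact
  show ?thesis
  proof (rule A.smooth_funI_local)
    fix p
    obtain U c where U: "(U, c) \<in> A" "p \<in> U" using A.chart_ex by blast
    obtain V d where V: "(V, d) \<in> B" "F p \<in> V" using B.chart_ex by blast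
    obtain J :: "'b set" where J: "onb J" using B.ex_onb by blast
    let ?W = "U \<inter> F -` V"
    have "open (F -` V)"
      using F B.open_chart[OF V(1)] open_vimage unfolding smooth_map_def by blast
    then have oW: "open ?W" using A.open_chart[OF U(1)] by blast
    have oc: "open (c ` ?W)" using A.open_image_chart[OF U(1) oW] by blast
    have "smooth_on (c ` ?W) (d \<circ> F \<circ> inv_into U c)"
      using F U(1) V(1) unfolding smooth_map_def by blast
    moreover have "(d \<circ> F \<circ> inv_into U c) ` (c ` ?W) \<subseteq> d ` V"
      using A.chart_inverse[OF U(1)] by auto
    ultimately have "smooth_on (c ` ?W) (\<lambda>x. (f \<circ> inv_into V d) ((d \<circ> F \<circ> inv_into U c) x))"
      using smooth_on_compose[OF J oc B.open_chart_image[OF V(1)] _ _ B.smooth_on_chart[OF f V(1)]]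
      by blast
    then have "smooth_on (c ` ?W) (f \<circ> F \<circ> inv_into U c)"
      by (rule smooth_on_cong[OF oc, rotated])
        (auto simp: A.chart_inverse[OF U(1)] B.chart_inverse[OF V(1)])
    then show "\<exists>U c W. (U, c) \<in> A \<and> open W \<and> p \<in> W \<and> W \<subseteq> U \<and> smooth_on (c ` W) (f \<circ> F \<circ> inv_into U c)"
      using U V(2) oW by blast
  qed
qed

section \<open>Vector fields and Riemannian metrics\<close>

lemma tv_scale_apply [simp]: "tv_scale a v f = a * v f"
  by (simp add: tv_scale_def)

lemma tv_scale_simps [simp]: "tv_scale 1 v = v" "tv_scale 0 v = 0" "tv_scale a 0 = 0"
  by (auto simp: fun_eq_iff)

lemma vf_scale_apply [simp]: "vf_scale f X p = tv_scale (f p) (X p)"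
  by (simp add: vf_scale_def)

lemma sum_fun_apply: "(\<Sum>i\<in>I. f i) x = (\<Sum>i\<in>I. f i x)"
  by (induction I rule: infinite_finite_induct) auto

lemma diff_eq_tv_scale: "v - w = v + tv_scale (-1) w"
  by (auto simp: fun_eq_iff)

context manifold
begin

lemma tangent_space_diff:
  "v \<in> tangent_space A p \<Longrightarrow> w \<in> tangent_space A p \<Longrightarrow> v - w \<in> tangent_space A p"
  unfolding diff_eq_tv_scale by (intro tangent_space_add tangent_space_scale)

lemma tangent_space_sum:
  "(\<And>i. i \<in> I \<Longrightarrow> v i \<in> tangent_space A p) \<Longrightarrow> (\<Sum>i\<in>I. v i) \<in> tangent_space A p"
  by (induction I rule: infinite_finite_induct) (auto intro: tangent_space_zero tangent_space_add)

lemma vector_fields_zero: "0 \<in> vector_fields A"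
  by (rule vector_fieldsI) (auto simp: tangent_space_zero smooth_fun_const)

lemma vector_fields_add: "X \<in> vector_fields A \<Longrightarrow> Y \<in> vector_fields A \<Longrightarrow> X + Y \<in> vector_fields A"
  by (rule vector_fieldsI) (auto simp: vector_fieldsD tangent_space_add smooth_fun_add)

lemma vector_fields_diff: "X \<in> vector_fields A \<Longrightarrow> Y \<in> vector_fields A \<Longrightarrow> X - Y \<in> vector_fields A"
  by (rule vector_fieldsI) (auto simp: vector_fieldsD tangent_space_diff smooth_fun_diff)

lemma vector_fields_scale: "smooth_fun A f \<Longrightarrow> X \<in> vector_fields A \<Longrightarrow> vf_scale f X \<in> vector_fields A"
  by (rule vector_fieldsI) (auto simp: vector_fieldsD tangent_space_scale smooth_fun_mult)

lemma vector_fields_sum: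
  "(\<And>i. i \<in> I \<Longrightarrow> X i \<in> vector_fields A) \<Longrightarrow> (\<Sum>i\<in>I. X i) \<in> vector_fields A"
  by (induction I rule: infinite_finite_induct) (auto intro: vector_fields_zero vector_fields_add)

text \<open>Constant coefficients in a frame cut off around \<open>p\<close> suffice. This turns a
  single tangent vector into an argument that a connection accepts.\<close>

lemma vector_field_through:
  assumes "v \<in> tangent_space A p"
  shows "\<exists>X\<in>vector_fields A. X p = v"
proof -
  obtain I E y \<kappa> where F: "local_frame p I E y \<kappa>"
    using ex_local_frame by blast
  have "(\<Sum>i\<in>I. vf_scale (\<lambda>r. v (y i)) (E i)) \<in> vector_fields A"
    by (intro vector_fields_sum vector_fields_scale smooth_fun_const frame_fields[OF F])
  moreover have "(\<Sum>i\<in>I. vf_scale (\<lambda>r. v (y i)) (E i)) p = v"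
    using frame_expand[OF F assms] frame_cutoff(2)[OF F] by (simp add: sum_fun_apply)
  ultimately show ?thesis by blast
qed

end

section \<open>Riemannian metrics\<close>

locale riemannian = manifold A
  for A :: "('m::{t2_space,second_countable_topology}, 'a::real_inner) chart set" +
  fixes g :: "'m \<Rightarrow> 'm tvec \<Rightarrow> 'm tvec \<Rightarrow> real"
  assumes metric: "riemannian_metric A g"
begin

context
  fixes p :: 'm
begin

lemma metric_sym: "v \<in> tangent_space A p \<Longrightarrow> w \<in> tangent_space A p \<Longrightarrow> g p v w = g p w v"
  using metric unfolding riemannian_metric_def by blast

lemma metric_pos: "v \<in> tangent_space A p \<Longrightarrow> v \<noteq> 0 \<Longrightarrow> g p v v > 0"
  using metric unfolding riemannian_metric_def by blast

lemma metric_comb: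
  "u \<in> tangent_space A p \<Longrightarrow> v \<in> tangent_space A p \<Longrightarrow> w \<in> tangent_space A p \<Longrightarrow>
    g p (tv_scale a u + tv_scale b v) w = a * g p u w + b * g p v w"
  using metric unfolding riemannian_metric_def by blast

lemma metric_add_left:
  "u \<in> tangent_space A p \<Longrightarrow> v \<in> tangent_space A p \<Longrightarrow> w \<in> tangent_space A p \<Longrightarrow>
    g p (u + v) w = g p u w + g p v w"
  using metric_comb[of u v w 1 1] by simp

lemma metric_scale_left:
  "u \<in> tangent_space A p \<Longrightarrow> w \<in> tangent_space A p \<Longrightarrow> g p (tv_scale a u) w = a * g p u w"
  using metric_comb[of u u w a 0] by simp

lemma metric_diff_left:
  "u \<in> tangent_space A p \<Longrightarrow> v \<in> tangent_space A p \<Longrightarrow> w \<in> tangent_space A p \<Longrightarrow>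
    g p (u - v) w = g p u w - g p v w"
  using metric_comb[of u v w 1 "-1"] by (simp add: diff_eq_tv_scale)

lemma metric_minus_left: "v \<in> tangent_space A p \<Longrightarrow> w \<in> tangent_space A p \<Longrightarrow> g p (- v) w = - g p v w"
  using metric_diff_left[of 0 v w] metric_scale_left[of v w 0] tangent_space_zero by simp

lemma metric_zero_left: "w \<in> tangent_space A p \<Longrightarrow> g p 0 w = 0"
  using metric_scale_left[of 0 w 0] tangent_space_zero by simp

lemma metric_add_right:
  "u \<in> tangent_space A p \<Longrightarrow> v \<in> tangent_space A p \<Longrightarrow> w \<in> tangent_space A p \<Longrightarrow>
    g p w (u + v) = g p w u + g p w v"
  using metric_add_left metric_sym tangent_space_add by metis

lemma metric_scale_right:
  "u \<in> tangent_space A p \<Longrightarrow> w \<in> tangent_space A p \<Longrightarrow> g p w (tv_scale a u) = a * g p w u"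
  using metric_scale_left metric_sym tangent_space_scale by metis

lemma metric_diff_right:
  "u \<in> tangent_space A p \<Longrightarrow> v \<in> tangent_space A p \<Longrightarrow> w \<in> tangent_space A p \<Longrightarrow>
    g p w (u - v) = g p w u - g p w v"
  using metric_diff_left metric_sym tangent_space_diff by metis

lemma metric_zero_right: "w \<in> tangent_space A p \<Longrightarrow> g p w 0 = 0"
  using metric_zero_left metric_sym tangent_space_zero by metis

lemma metric_sum_left:
  "(\<And>i. i \<in> I \<Longrightarrow> v i \<in> tangent_space A p) \<Longrightarrow> w \<in> tangent_space A p \<Longrightarrow>
    g p (\<Sum>i\<in>I. v i) w = (\<Sum>i\<in>I. g p (v i) w)"
  by (induction I rule: infinite_finite_induct)
    (simp_all add: metric_zero_left metric_add_left tangent_space_sum)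

lemma metric_sum_right:
  "(\<And>i. i \<in> I \<Longrightarrow> v i \<in> tangent_space A p) \<Longrightarrow> w \<in> tangent_space A p \<Longrightarrow>
    g p w (\<Sum>i\<in>I. v i) = (\<Sum>i\<in>I. g p w (v i))"
  by (induction I rule: infinite_finite_induct)
    (simp_all add: metric_zero_right metric_add_right tangent_space_sum)

lemma metric_nondegenerate: "v \<in> tangent_space A p \<Longrightarrow> g p v v = 0 \<Longrightarrow> v = 0"
  using metric_pos by force

end

lemma smooth_fun_metric:
  "X \<in> vector_fields A \<Longrightarrow> Y \<in> vector_fields A \<Longrightarrow> smooth_fun A (\<lambda>p. g p (X p) (Y p))"
  using metric unfolding riemannian_metric_def by blast

text \<open>Division-free Gram--Schmidt: \<open>\<rho>\<close> collects the denominators, so that all fields involved stay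
  globally defined and smooth.\<close>

lemma gram_solve:
  assumes "finite I" "\<forall>i\<in>I. E i \<in> vector_fields A"
    and "\<forall>a. (\<Sum>i\<in>I. tv_scale (a i) (E i p)) = 0 \<longrightarrow> (\<forall>i\<in>I. a i = 0)"
  shows "\<exists>\<rho>. smooth_fun A \<rho> \<and> \<rho> p \<noteq> 0 \<and>
    (\<forall>Z. (\<forall>r. Z r \<in> tangent_space A r) \<longrightarrow> (\<forall>i\<in>I. smooth_fun A (\<lambda>r. g r (Z r) (E i r))) \<longrightarrow>
      (\<exists>W\<in>vector_fields A. (\<exists>a. W p = (\<Sum>i\<in>I. tv_scale (a i) (E i p))) \<and>
        (\<forall>i\<in>I. \<forall>r. g r (W r) (E i r) = \<rho> r * g r (Z r) (E i r))))"
  using assms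
proof (induction I rule: finite_induct)
  case empty
  show ?case
    by (intro exI[of _ "\<lambda>r. 1"]) (auto simp: smooth_fun_const intro!: bexI[OF _ vector_fields_zero])
next
  case (insert e I)
  have indep: "\<forall>a. (\<Sum>i\<in>I. tv_scale (a i) (E i p)) = 0 \<longrightarrow> (\<forall>i\<in>I. a i = 0)"
  proof (intro allI impI)
    fix a assume that: "(\<Sum>i\<in>I. tv_scale (a i) (E i p)) = 0"
    have "(\<Sum>i\<in>I. tv_scale ((a(e := 0)) i) (E i p)) = (\<Sum>i\<in>I. tv_scale (a i) (E i p))"
      using insert.hyps(2) by (intro sum.cong) auto
    then have "(\<Sum>i\<in>insert e I. tv_scale ((a(e := 0)) i) (E i p)) = 0"
      using insert.hyps that by simp
    then have "\<forall>i\<in>insert e I. (a(e := 0)) i = 0"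
      using insert.prems(2) by blast
    then show "\<forall>i\<in>I. a i = 0" using insert.hyps(2) by (metis fun_upd_other insertI2)
  qed
  have EI': "\<forall>i\<in>I. E i \<in> vector_fields A" using insert.prems(1) by blast
  have EI: "E i \<in> vector_fields A" if "i \<in> I" for i
    using insert.prems(1) that by blast
  have Ee: "E e \<in> vector_fields A" using insert.prems(1) by blast
  obtain \<rho> where \<rho>: "smooth_fun A \<rho>" "\<rho> p \<noteq> 0"
    and solve: "\<forall>Z. (\<forall>r. Z r \<in> tangent_space A r) \<longrightarrow> (\<forall>i\<in>I. smooth_fun A (\<lambda>r. g r (Z r) (E i r))) \<longrightarrow>
      (\<exists>W\<in>vector_fields A. (\<exists>a. W p = (\<Sum>i\<in>I. tv_scale (a i) (E i p))) \<and>
        (\<forall>i\<in>I. \<forall>r. g r (W r) (E i r) = \<rho> r * g r (Z r) (E i r)))"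
    using insert.IH[OF EI' indep] by (elim exE conjE) (rule that)
  obtain We a where We: "We \<in> vector_fields A" "We p = (\<Sum>i\<in>I. tv_scale (a i) (E i p))"
    "\<And>i r. i \<in> I \<Longrightarrow> g r (We r) (E i r) = \<rho> r * g r (E e r) (E i r)"
    using solve[rule_format, of "E e"] vector_fieldsD(1)[OF Ee] smooth_fun_metric[OF Ee EI] by blast
  \<comment> \<open>At \<open>p\<close> this is \<rho> times the component of \<open>E e\<close>
    orthogonal to the other fields, with the denominator already cleared; the new denominator will
    be \<rho> times \<open>n\<close>.\<close>
  define N where "N = vf_scale \<rho> (E e) - We"
  define n where "n r = g r (N r) (E e r)" for r
  have N: "N \<in> vector_fields A"
    unfolding N_def by (intro vector_fields_diff vector_fields_scale \<rho>(1) Ee We(1))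
  note T = vector_fieldsD(1)[OF N] vector_fieldsD(1)[OF Ee] vector_fieldsD(1)[OF We(1)]
    vector_fieldsD(1)[OF EI]
  have N_orth: "g r (N r) (E i r) = 0" if "i \<in> I" for i r
    unfolding N_def using We(3)[OF that] that
    by (simp add: metric_diff_left metric_scale_left T tangent_space_scale)
  have n: "smooth_fun A n" unfolding n_def by (rule smooth_fun_metric[OF N Ee])
  \<comment> \<open>If \<open>n p\<close> vanished, so would \<open>N p\<close>, because
    \<open>We p\<close> lies in the span of the earlier fields, to which \<open>N p\<close> is
    orthogonal. That would be a linear relation with coefficient \<open>\<rho> p\<close> at
    \<open>e\<close>, against independence.\<close>
  have "n p \<noteq> 0"
  proof
    assume n0: "n p = 0"
    have "g p (N p) (We p) = (\<Sum>i\<in>I. a i * g p (N p) (E i p))"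
      unfolding We(2) by (simp add: metric_sum_right metric_scale_right T tangent_space_scale)
    also have "\<dots> = 0" using N_orth by simp
    moreover have "g p (N p) (N p) = \<rho> p * n p - g p (N p) (We p)"
      unfolding n_def by (subst (2) N_def)
        (simp add: metric_diff_right metric_scale_right T tangent_space_scale)
    ultimately have "N p = 0" using n0 metric_nondegenerate[OF T(1)] by simp
    define b where "b = (\<lambda>i. - a i)(e := \<rho> p)"
    have "(\<Sum>i\<in>I. tv_scale (b i) (E i p)) = - (\<Sum>i\<in>I. tv_scale (a i) (E i p))"
      unfolding sum_negf[symmetric] using insert.hyps(2)
      by (intro sum.cong) (auto simp: b_def fun_eq_iff)
    then have "(\<Sum>i\<in>insert e I. tv_scale (b i) (E i p)) = 0"
      using insert.hyps \<open>N p = 0\<close> by (simp add: N_def We(2) b_def)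
    then have "b e = 0" using insert.prems(2) by blast
    then show False using \<rho>(2) by (simp add: b_def)
  qed
  have "\<exists>W\<in>vector_fields A. (\<exists>a. W p = (\<Sum>i\<in>insert e I. tv_scale (a i) (E i p))) \<and>
        (\<forall>i\<in>insert e I. \<forall>r. g r (W r) (E i r) = \<rho> r * n r * g r (Z r) (E i r))"
    if Z: "\<And>r. Z r \<in> tangent_space A r"
      "\<And>i. i \<in> insert e I \<Longrightarrow> smooth_fun A (\<lambda>r. g r (Z r) (E i r))" for Z
  proof -
    obtain V c where V: "V \<in> vector_fields A" "V p = (\<Sum>i\<in>I. tv_scale (c i) (E i p))"
      "\<And>i r. i \<in> I \<Longrightarrow> g r (V r) (E i r) = \<rho> r * g r (Z r) (E i r)"
    proof -
      have "\<forall>r. Z r \<in> tangent_space A r" "\<forall>i\<in>I. smooth_fun A (\<lambda>r. g r (Z r) (E i r))"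
        using Z by blast+
      from solve[THEN spec, THEN mp, THEN mp, OF this] show ?thesis
        by (elim bexE conjE exE) (rule that, assumption, assumption, blast)
    qed
    \<comment> \<open>The defect of \<open>V\<close> against \<open>E e\<close>: adding \<beta>
      times \<open>N\<close> to \<open>n\<close> times \<open>V\<close> corrects the product with
      \<open>E e\<close> by \<beta> times \<open>n\<close> and leaves the products with the earlier
      fields unchanged.\<close>
    define \<beta> where "\<beta> r = \<rho> r * g r (Z r) (E e r) - g r (V r) (E e r)" for r
    have \<beta>: "smooth_fun A \<beta>"
      unfolding \<beta>_def
      by (intro smooth_fun_diff smooth_fun_mult \<rho>(1) smooth_fun_metric V(1) Ee Z(2)) simp
    define W where "W = vf_scale n V + vf_scale \<beta> N"
    have W: "W \<in> vector_fields A"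
      unfolding W_def by (intro vector_fields_add vector_fields_scale n \<beta> N V(1))
    have W_metric: "g r (W r) w = n r * g r (V r) w + \<beta> r * g r (N r) w"
      if "w \<in> tangent_space A r" for r w
      unfolding W_def using that vector_fieldsD(1)[OF V(1)]
      by (simp add: metric_add_left metric_scale_left T tangent_space_scale)
    have "g r (W r) (E i r) = \<rho> r * n r * g r (Z r) (E i r)" if i: "i \<in> insert e I" for i r
    proof (cases "i = e")
      case True
      then show ?thesis
        by (simp add: W_metric T \<beta>_def n_def[symmetric] algebra_simps)
    next
      case False
      then have "i \<in> I" using i by simp
      then show ?thesis by (simp add: W_metric T N_orth V(3))
    qed
    moreover have "\<exists>b. W p = (\<Sum>i\<in>insert e I. tv_scale (b i) (E i p))"
    proof
      let ?b = "(\<lambda>i. n p * c i - \<beta> p * a i)(e := \<beta> p * \<rho> p)"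
      have "(\<Sum>i\<in>insert e I. tv_scale (?b i) (E i p))
          = tv_scale (\<beta> p * \<rho> p) (E e p) + (\<Sum>i\<in>I. tv_scale (n p * c i - \<beta> p * a i) (E i p))"
        using insert.hyps by (auto intro!: sum.cong)
      also have "\<dots> = W p"
        by (auto simp: W_def N_def V(2) We(2) fun_eq_iff sum_fun_apply algebra_simps
            sum_distrib_left sum_subtractf)
      finally show "W p = (\<Sum>i\<in>insert e I. tv_scale (?b i) (E i p))" by simp
    qed
    ultimately show ?thesis using W by blast
  qed
  moreover have "smooth_fun A (\<lambda>r. \<rho> r * n r)" by (intro smooth_fun_mult \<rho>(1) n)
  ultimately show ?case
    using \<rho>(2) \<open>n p \<noteq> 0\<close>
    by (intro exI[of _ "\<lambda>r. \<rho> r * n r"] conjI allI impI) (assumption, simp, blast)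
qed

lemma frame_independent:
  assumes F: "local_frame p I E y \<kappa>"
  shows "\<forall>a. (\<Sum>i\<in>I. tv_scale (a i) (E i p)) = 0 \<longrightarrow> (\<forall>i\<in>I. a i = 0)"
proof (intro allI impI ballI)
  fix a j assume 0: "(\<Sum>i\<in>I. tv_scale (a i) (E i p)) = 0" and "j \<in> I"
  have "0 = (\<Sum>i\<in>I. tv_scale (a i) (E i p)) (y j)" using 0 by simp
  also have "\<dots> = (\<Sum>i\<in>I. a i * (if i = j then 1 else 0))"
    using frame_dual[OF F] \<open>j \<in> I\<close> by (auto simp: sum_fun_apply intro!: sum.cong)
  also have "\<dots> = a j" using frame_finite[OF F] \<open>j \<in> I\<close> by (simp add: if_distrib cong: if_cong)
  finally show "a j = 0" by simp
qed

text \<open>Meant for the horizontal projection, which is defined pointwise but has computable inner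
  products. \<open>gram_solve\<close> yields a smooth \<open>W\<close> with the same products
  against a frame as \<rho> times \<open>Z\<close>; near \<open>p\<close> the frame spans, so the
  two agree there and \<rho> can be cancelled.\<close>

lemma vector_fieldsI_metric:
  assumes Z: "\<And>p. Z p \<in> tangent_space A p"
    and sm: "\<And>Y. Y \<in> vector_fields A \<Longrightarrow> smooth_fun A (\<lambda>p. g p (Z p) (Y p))"
  shows "Z \<in> vector_fields A"
proof (rule vector_fieldsI[OF Z])
  fix f assume f: "smooth_fun A f"
  show "smooth_fun A (\<lambda>p. Z p f)"
  proof (rule smooth_fun_cancel)
    fix p
    obtain I E y \<kappa> where F: "local_frame p I E y \<kappa>"
      using ex_local_frame by blast
    note E = frame_fields[OF F] and \<kappa> = frame_cutoff[OF F] and frame = frame_expand[OF F]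
    obtain \<rho> W where \<rho>: "smooth_fun A \<rho>" "\<rho> p \<noteq> 0" and W: "W \<in> vector_fields A"
      "\<And>i r. i \<in> I \<Longrightarrow> g r (W r) (E i r) = \<rho> r * g r (Z r) (E i r)"
    proof -
      have "\<forall>i\<in>I. E i \<in> vector_fields A" using E by blast
      from gram_solve[OF frame_finite[OF F] this frame_independent[OF F]]
      obtain \<rho> where "smooth_fun A \<rho>" "\<rho> p \<noteq> 0"
        "\<exists>W\<in>vector_fields A. \<forall>i\<in>I. \<forall>r. g r (W r) (E i r) = \<rho> r * g r (Z r) (E i r)"
        using Z sm[OF E] by blast
      then show ?thesis using that by blast
    qed
    have "\<kappa> r * \<rho> r * Z r f = \<kappa> r * W r f" for r
    proof -
      \<comment> \<open>The difference is orthogonal to every \<open>E i\<close>, hence to its own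
        multiple by \<kappa>, which is a combination of the \<open>E i\<close>.\<close>
      let ?d = "W r - tv_scale (\<rho> r) (Z r)"
      note T = vector_fieldsD(1)[OF W(1)] vector_fieldsD(1)[OF E] Z
      have d: "?d \<in> tangent_space A r" by (intro tangent_space_diff tangent_space_scale T)
      have "g r ?d (E i r) = 0" if "i \<in> I" for i
        using W(2)[OF that] that
        by (simp add: metric_diff_left metric_scale_left T tangent_space_scale)
      then have "g r ?d (tv_scale (\<kappa> r) ?d) = 0"
        unfolding frame[OF d]
        by (simp add: metric_sum_right metric_scale_right d T tangent_space_scale)
      then have "\<kappa> r = 0 \<or> ?d = 0"
        using metric_nondegenerate[OF d] by (auto simp: metric_scale_right d)
      then show ?thesis by (auto simp: fun_eq_iff)
    qed
    then have "smooth_fun A (\<lambda>r. \<kappa> r * \<rho> r * Z r f)"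
      using smooth_fun_mult[OF \<kappa>(1) vector_fieldsD(2)[OF W(1) f]] by presburger
    then show "\<exists>\<rho>. smooth_fun A \<rho> \<and> \<rho> p \<noteq> 0 \<and> smooth_fun A (\<lambda>r. \<rho> r * Z r f)"
      using smooth_fun_mult[OF \<kappa>(1) \<rho>(1)] \<kappa>(2) \<rho>(2) by (intro exI[of _ "\<lambda>r. \<kappa> r * \<rho> r"]) simp
  qed
qed

text \<open>Tangent vectors are scaled by \<open>tv_scale\<close>, not \<open>scaleR\<close>, so the
  problem is moved to the model space by the linear bijection \<open>L\<close> coming from a frame
  at \<open>p\<close>. There \<open>S'\<close> is a subspace with a finite basis and
  \<open>G\<close> is the metric as a positive form.\<close>

lemma orthogonal_decomposition:
  assumes S: "S \<subseteq> tangent_space A p" "0 \<in> S" "\<And>u v. u \<in> S \<Longrightarrow> v \<in> S \<Longrightarrow> u + v \<in> S"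
      "\<And>a u. u \<in> S \<Longrightarrow> tv_scale a u \<in> S"
    and v: "v \<in> tangent_space A p"
  shows "\<exists>w\<in>S. \<forall>u\<in>S. g p (v - w) u = 0"
proof -
  obtain I E y \<kappa> where F: "local_frame p I E y \<kappa>"
    using ex_local_frame by blast
  note I = frame_onb[OF F] and E = frame_fields[OF F] and \<kappa> = frame_cutoff[OF F]
    and frame = frame_expand[OF F]
  define L where "L a = (\<Sum>i\<in>I. tv_scale (a \<bullet> i) (E i p))" for a
  have L: "L a \<in> tangent_space A p" for a
    unfolding L_def by (intro tangent_space_sum tangent_space_scale vector_fieldsD(1) E)
  have L_add: "L (a + b) = L a + L b" and L_scale: "L (k *\<^sub>R a) = tv_scale k (L a)" for a b k
    by (auto simp: L_def fun_eq_iff sum_fun_apply inner_add_left algebra_simps sum.distrib sum_distrib_left)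
  have L_inj: "a = 0" if "L a = 0" for a
  proof -
    have "\<forall>i\<in>I. a \<bullet> i = 0" using frame_independent[OF F] that unfolding L_def by blast
    then have "(\<Sum>i\<in>I. (a \<bullet> i) *\<^sub>R i) = 0" by simp
    then show ?thesis using onb_expand[OF I, of a] by metis
  qed
  have L_surj: "\<exists>a. L a = u" if "u \<in> tangent_space A p" for u
  proof
    have "(\<Sum>i\<in>I. u (y i) *\<^sub>R i) \<bullet> j = u (y j)" if "j \<in> I" for j
    proof -
      have "(\<Sum>i\<in>I. u (y i) *\<^sub>R i) \<bullet> j = (\<Sum>i\<in>I. u (y i) * (if i = j then 1 else 0))"
        using onb_inner[OF I] that by (auto simp: inner_sum_left intro!: sum.cong)
      then show ?thesis using onb_finite[OF I] that by (simp add: if_distrib cong: if_cong)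
    qed
    then have "L (\<Sum>i\<in>I. u (y i) *\<^sub>R i) = (\<Sum>i\<in>I. tv_scale (u (y i)) (E i p))"
      unfolding L_def by simp
    then show "L (\<Sum>i\<in>I. u (y i) *\<^sub>R i) = u" using frame[OF that] \<kappa>(2) by simp
  qed
  define G where "G a b = g p (L a) (L b)" for a b
  have bil: "bilinear G"
    unfolding bilinear_def G_def
    by (auto intro!: linearI simp: L_add L_scale metric_add_left metric_add_right L
        metric_scale_left metric_scale_right)
  have sym: "G a b = G b a" for a b unfolding G_def by (rule metric_sym[OF L L])
  have pos: "G a a > 0" if "a \<noteq> 0" for a unfolding G_def using L_inj metric_pos[OF L] that by blast
  define S' where "S' = {a. L a \<in> S}"
  have L0: "L 0 = 0" using L_scale[of 0 0] by simp
  have sub: "subspace S'"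
    unfolding subspace_def S'_def using L_add L_scale L0 S(2-4) by auto
  obtain C where C: "C \<subseteq> S'" "independent C" "S' \<subseteq> span C" using basis_exists by metis
  have "a \<in> span I" for a
    by (subst onb_expand[OF I, of a]) (intro span_sum span_scale span_base)
  then have "span I = UNIV" by blast
  then have "finite C" using independent_span_bound[OF onb_finite[OF I] C(2)] by simp
  have span: "span C = S'" using C(1,3) sub span_minimal by blast
  obtain a where a: "L a = v" using L_surj v by blast
  obtain b where b: "b \<in> S'" "\<And>c. c \<in> S' \<Longrightarrow> G (a - b) c = 0"
    using orthogonal_projection_exists[OF bil sym pos \<open>finite C\<close>, of a] span by blast
  have "L (a - b) = v - L b"
    using L_add[of a "(-1) *\<^sub>R b"] a by (simp add: diff_eq_tv_scale flip: L_scale)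
  then have "g p (v - L b) u = 0" if "u \<in> S" for u
    using b(2) L_surj S(1) that unfolding G_def S'_def by (metis mem_Collect_eq subsetD)
  then show ?thesis using b(1) S'_def by blast
qed

end

section \<open>The Levi-Civita connection\<close>

locale levi_civita_manifold = riemannian A g
  for A :: "('m::{t2_space,second_countable_topology}, 'a::real_inner) chart set" and g +
  fixes D :: "'m vfield \<Rightarrow> 'm vfield \<Rightarrow> 'm vfield"
  assumes levi_civita: "levi_civita A g D"
begin

lemma connection_closed: "X \<in> vector_fields A \<Longrightarrow> Y \<in> vector_fields A \<Longrightarrow> D X Y \<in> vector_fields A"
  and connection_add_left: "X \<in> vector_fields A \<Longrightarrow> Y \<in> vector_fields A \<Longrightarrow> Z \<in> vector_fields A \<Longrightarrow>
    D (X + Y) Z = D X Z + D Y Z"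
  and connection_add_right: "X \<in> vector_fields A \<Longrightarrow> Y \<in> vector_fields A \<Longrightarrow> Z \<in> vector_fields A \<Longrightarrow>
    D X (Y + Z) = D X Y + D X Z"
  and connection_scale_left: "X \<in> vector_fields A \<Longrightarrow> Y \<in> vector_fields A \<Longrightarrow> smooth_fun A f \<Longrightarrow>
    D (vf_scale f X) Y = vf_scale f (D X Y)"
  and connection_scale_right: "X \<in> vector_fields A \<Longrightarrow> Y \<in> vector_fields A \<Longrightarrow> smooth_fun A f \<Longrightarrow>
    D X (vf_scale f Y) = vf_scale f (D X Y) + vf_scale (vf_apply X f) Y"
  using levi_civita unfolding levi_civita_def affine_connection_def by blast+

lemma torsion_free: "X \<in> vector_fields A \<Longrightarrow> Y \<in> vector_fields A \<Longrightarrow> lie_bracket X Y = D X Y - D Y X"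
  using levi_civita unfolding levi_civita_def by metis

lemma metric_compatible:
  "X \<in> vector_fields A \<Longrightarrow> Y \<in> vector_fields A \<Longrightarrow> Z \<in> vector_fields A \<Longrightarrow>
    X p (\<lambda>q. g q (Y q) (Z q)) = g p (D X Y p) (Z p) + g p (Y p) (D X Z p)"
  using levi_civita unfolding levi_civita_def vf_apply_def by blast

lemma connection_zero_right: "X \<in> vector_fields A \<Longrightarrow> D X 0 = 0"
  using connection_add_right[of X 0 0] vector_fields_zero by simp

lemma connection_zero_left: "X \<in> vector_fields A \<Longrightarrow> D 0 X = 0"
  using connection_add_left[of 0 0 X] vector_fields_zero by simp

lemma connection_sum_left:
  "(\<And>i. i \<in> I \<Longrightarrow> X i \<in> vector_fields A) \<Longrightarrow> Y \<in> vector_fields A \<Longrightarrow> D (\<Sum>i\<in>I. X i) Y = (\<Sum>i\<in>I. D (X i) Y)"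
  by (induction I rule: infinite_finite_induct)
    (simp_all add: connection_zero_left connection_add_left vector_fields_sum)

lemma connection_diff_right:
  assumes "X \<in> vector_fields A" "Y \<in> vector_fields A" "Z \<in> vector_fields A"
  shows "D X (Y - Z) = D X Y - D X Z"
  using connection_add_right[OF assms(1) vector_fields_diff[OF assms(2,3)] assms(3)] by simp

end

section \<open>The second fundamental form of a Riemannian submersion\<close>

locale submersion =
  M: levi_civita_manifold A gM DM + N: levi_civita_manifold B gN DN
  for A :: "('m::{t2_space,second_countable_topology}, 'a::real_inner) chart set" and gM DM
    and B :: "('n::{t2_space,second_countable_topology}, 'b::real_inner) chart set" and gN DN +
  fixes F :: "'m \<Rightarrow> 'n" and DF :: "'m vfield \<Rightarrow> ('m \<Rightarrow> 'n tvec) \<Rightarrow> ('m \<Rightarrow> 'n tvec)"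
  assumes submersion: "riemannian_submersion A gM B gN F"
    and pullback: "pullback_connection A B F DN DF"
begin

abbreviation push :: "'m tvec \<Rightarrow> 'n tvec" where
  "push \<equiv> pushforward B F"

abbreviation along_fields :: "('m \<Rightarrow> 'n tvec) set" where
  "along_fields \<equiv> vector_fields_along A B F"

lemma smooth_fun_comp: "smooth_fun B f \<Longrightarrow> smooth_fun A (\<lambda>r. f (F r))"
  using smooth_fun_compose[OF M.manifold_axioms N.manifold_axioms] submersion
  unfolding riemannian_submersion_def o_def by blast

lemma push_apply: "smooth_fun B f \<Longrightarrow> push v f = v (\<lambda>r. f (F r))"
  by (simp add: pushforward_def o_def)

lemma push_image: "push ` tangent_space A p = tangent_space B (F p)"
  using submersion unfolding riemannian_submersion_def by blast

lemma push_mem: "v \<in> tangent_space A p \<Longrightarrow> push v \<in> tangent_space B (F p)"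
  using push_image by blast

lemma push_add: "push (v + w) = push v + push w"
  and push_diff: "push (v - w) = push v - push w"
  and push_scale: "push (tv_scale a v) = tv_scale a (push v)"
  and push_zero: "push 0 = 0"
  by (auto simp: pushforward_def fun_eq_iff)

lemma along_fieldsD:
  assumes "\<sigma> \<in> along_fields"
  shows "\<sigma> p \<in> tangent_space B (F p)" "smooth_fun B f \<Longrightarrow> smooth_fun A (\<lambda>p. \<sigma> p f)"
  using assms unfolding vector_fields_along_def by auto

lemma push_field: "X \<in> vector_fields A \<Longrightarrow> (\<lambda>p. push (X p)) \<in> along_fields"
  unfolding vector_fields_along_def
  by (auto simp: push_mem M.vector_fieldsD push_apply smooth_fun_comp)

lemma comp_field: "Z \<in> vector_fields B \<Longrightarrow> Z \<circ> F \<in> along_fields"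
  unfolding vector_fields_along_def
  using N.vector_fieldsD smooth_fun_comp[OF N.vector_fieldsD(2)] by simp

lemma along_fields_scale: "smooth_fun A f \<Longrightarrow> \<sigma> \<in> along_fields \<Longrightarrow> vf_scale f \<sigma> \<in> along_fields"
  unfolding vector_fields_along_def by (auto simp: N.tangent_space_scale M.smooth_fun_mult)

lemma along_fields_zero: "0 \<in> along_fields"
  unfolding vector_fields_along_def by (auto simp: N.tangent_space_zero M.smooth_fun_const)

lemma along_fields_add: "\<sigma> \<in> along_fields \<Longrightarrow> \<tau> \<in> along_fields \<Longrightarrow> \<sigma> + \<tau> \<in> along_fields"
  unfolding vector_fields_along_def by (auto simp: N.tangent_space_add M.smooth_fun_add)

lemma along_fields_sum: "(\<And>i. i \<in> I \<Longrightarrow> \<sigma> i \<in> along_fields) \<Longrightarrow> (\<Sum>i\<in>I. \<sigma> i) \<in> along_fields"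
  by (induction I rule: infinite_finite_induct) (auto intro: along_fields_zero along_fields_add)

lemma pullback_closed: "X \<in> vector_fields A \<Longrightarrow> \<sigma> \<in> along_fields \<Longrightarrow> DF X \<sigma> \<in> along_fields"
  and pullback_add_left: "X \<in> vector_fields A \<Longrightarrow> Y \<in> vector_fields A \<Longrightarrow> \<sigma> \<in> along_fields \<Longrightarrow>
    DF (X + Y) \<sigma> = DF X \<sigma> + DF Y \<sigma>"
  and pullback_add_right: "X \<in> vector_fields A \<Longrightarrow> \<sigma> \<in> along_fields \<Longrightarrow> \<tau> \<in> along_fields \<Longrightarrow>
    DF X (\<sigma> + \<tau>) = DF X \<sigma> + DF X \<tau>"
  and pullback_scale_right: "X \<in> vector_fields A \<Longrightarrow> \<sigma> \<in> along_fields \<Longrightarrow> smooth_fun A f \<Longrightarrow>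
    DF X (vf_scale f \<sigma>) = vf_scale f (DF X \<sigma>) + vf_scale (vf_apply X f) \<sigma>"
  and pullback_comp: "X \<in> vector_fields A \<Longrightarrow> W \<in> vector_fields B \<Longrightarrow> Z \<in> vector_fields B \<Longrightarrow>
    push (X p) = W (F p) \<Longrightarrow> DF X (Z \<circ> F) p = DN W Z (F p)"
  using pullback unfolding pullback_connection_def by blast+

lemma pullback_zero_right: "X \<in> vector_fields A \<Longrightarrow> DF X 0 = 0"
  using pullback_add_right[of X 0 0] along_fields_zero by simp

lemma pullback_sum_right:
  "X \<in> vector_fields A \<Longrightarrow> (\<And>i. i \<in> I \<Longrightarrow> \<sigma> i \<in> along_fields) \<Longrightarrow> DF X (\<Sum>i\<in>I. \<sigma> i) = (\<Sum>i\<in>I. DF X (\<sigma> i))"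
  by (induction I rule: infinite_finite_induct)
    (simp_all add: pullback_zero_right pullback_add_right along_fields_sum)

section \<open>The pullback connection in a frame of the target\<close>

context
  fixes p :: 'm and I :: "'b set" and E y \<kappa>
  assumes frame: "N.local_frame (F p) I E y \<kappa>"
begin

text \<open>Apply \<open>DF X\<close> to the global expansion of \<open>\<kappa> \<circ> F\<close>
  times \<sigma> in the fields \<open>E i \<circ> F\<close> and use the Leibniz rule on both sides;
  \<kappa> is 1 at \<open>F p\<close>. The field \<open>Z\<close> supplies the direction in which
  the defining property of \<open>DF\<close> evaluates \<open>E i \<circ> F\<close>.\<close>

lemma pullback_frame:
  assumes X: "X \<in> vector_fields A" and \<sigma>: "\<sigma> \<in> along_fields"
    and Z: "Z \<in> vector_fields B" "push (X p) = Z (F p)"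
  shows "DF X \<sigma> p + tv_scale (X p (\<lambda>r. \<kappa> (F r))) (\<sigma> p) =
    (\<Sum>i\<in>I. tv_scale (\<sigma> p (y i)) (DN Z (E i) (F p)) + tv_scale (X p (\<lambda>r. \<sigma> r (y i))) (E i (F p)))"
proof -
  let ?\<kappa> = "\<lambda>r. \<kappa> (F r)"
  have coords: "smooth_fun A (\<lambda>r. \<sigma> r (y i))" if "i \<in> I" for i
    using along_fieldsD(2)[OF \<sigma> N.frame_coords[OF frame that]] .
  have field: "E i \<circ> F \<in> along_fields" if "i \<in> I" for i
    by (rule comp_field[OF N.frame_fields[OF frame that]])
  have "vf_scale ?\<kappa> \<sigma> = (\<Sum>i\<in>I. vf_scale (\<lambda>r. \<sigma> r (y i)) (E i \<circ> F))"
    using N.frame_expand[OF frame along_fieldsD(1)[OF \<sigma>]] by (intro ext) (simp add: sum_fun_apply)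
  then have "DF X (vf_scale ?\<kappa> \<sigma>) p = (\<Sum>i\<in>I. DF X (vf_scale (\<lambda>r. \<sigma> r (y i)) (E i \<circ> F))) p"
    using pullback_sum_right[OF X, of I "\<lambda>i. vf_scale (\<lambda>r. \<sigma> r (y i)) (E i \<circ> F)"]
      along_fields_scale[OF coords field] by simp
  also have "\<dots> = (\<Sum>i\<in>I. DF X (vf_scale (\<lambda>r. \<sigma> r (y i)) (E i \<circ> F)) p)"
    by (rule sum_fun_apply)
  also have "\<dots> = (\<Sum>i\<in>I. tv_scale (\<sigma> p (y i)) (DN Z (E i) (F p)) +
      tv_scale (X p (\<lambda>r. \<sigma> r (y i))) (E i (F p)))"
    by (intro sum.cong refl)
      (simp add: pullback_scale_right[OF X field coords] pullback_comp[OF X Z(1) N.frame_fields[OF frame] Z(2)]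
        vf_apply_def)
  finally show ?thesis
    using pullback_scale_right[OF X \<sigma> smooth_fun_comp[OF N.frame_cutoff(1)[OF frame]]]
      N.frame_cutoff(2)[OF frame]
    by (simp add: vf_apply_def)
qed

lemma push_frame:
  assumes "v \<in> tangent_space A p"
  shows "push v = (\<Sum>i\<in>I. tv_scale (v (\<lambda>r. y i (F r))) (E i (F p)))"
proof -
  have "push v = (\<Sum>i\<in>I. tv_scale (push v (y i)) (E i (F p)))"
    using N.frame_expand[OF frame push_mem[OF assms]] N.frame_cutoff(2)[OF frame] by simp
  also have "\<dots> = (\<Sum>i\<in>I. tv_scale (v (\<lambda>r. y i (F r))) (E i (F p)))"
    by (intro sum.cong refl) (simp add: push_apply N.frame_coords[OF frame])
  finally show ?thesis .
qed

text \<open>The Hessian-like expression on the left is symmetric in \<open>X\<close> and \<open>Y\<close> because \<open>DN\<close> is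
  torsion-free; this is the symmetry of the second fundamental form.\<close>

lemma pullback_hessian:
  assumes X: "X \<in> vector_fields A" and Y: "Y \<in> vector_fields A" and f: "smooth_fun B f"
  shows "DF X (\<lambda>r. push (Y r)) p f - X p (\<lambda>r. Y r (\<lambda>s. f (F s))) =
    (\<Sum>i\<in>I. \<Sum>j\<in>I. Y p (\<lambda>r. y i (F r)) * X p (\<lambda>r. y j (F r)) *
      (DN (E j) (E i) (F p) f - E j (F p) (\<lambda>r. E i r f)))"
proof -
  let ?q = "F p" and ?\<kappa> = "\<lambda>r. \<kappa> (F r)" and ?y = "\<lambda>i r. y i (F r)"
  note T = M.vector_fieldsD(1)[OF X, of p]
  note E = N.frame_fields[OF frame] and sm_y = smooth_fun_comp[OF N.frame_coords[OF frame]]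
  note sm_\<kappa> = smooth_fun_comp[OF N.frame_cutoff(1)[OF frame]]
  have sm_Yy: "smooth_fun A (\<lambda>r. Y r (?y i))" if "i \<in> I" for i
    using M.vector_fieldsD(2)[OF Y] sm_y that by blast
  have sm_Ef: "smooth_fun B (\<lambda>s. E i s f)" if "i \<in> I" for i
    using N.vector_fieldsD(2)[OF E f] that by blast
  \<comment> \<open>A global field with value \<open>push (X p)\<close> at \<open>F p\<close>. Its
    coefficients are constants, so linearity in the first argument expresses
    \<open>DN Z (E i)\<close> by the \<open>DN (E j) (E i)\<close>.\<close>
  define Z where "Z = (\<Sum>j\<in>I. vf_scale (\<lambda>r. X p (?y j)) (E j))"
  have Z: "Z \<in> vector_fields B"
    unfolding Z_def by (intro N.vector_fields_sum N.vector_fields_scale N.smooth_fun_const E)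
  have ZX: "push (X p) = Z ?q"
    by (simp add: push_frame[OF T] Z_def sum_fun_apply)
  have DZ: "DN Z (E i) ?q f = (\<Sum>j\<in>I. X p (?y j) * DN (E j) (E i) ?q f)" if "i \<in> I" for i
  proof -
    have "DN Z (E i) = (\<Sum>j\<in>I. DN (vf_scale (\<lambda>r. X p (?y j)) (E j)) (E i))"
      unfolding Z_def using E that
      by (intro N.connection_sum_left N.vector_fields_scale N.smooth_fun_const)
    also have "\<dots> = (\<Sum>j\<in>I. vf_scale (\<lambda>r. X p (?y j)) (DN (E j) (E i)))"
      using E that by (intro sum.cong refl N.connection_scale_left N.smooth_fun_const)
    finally show ?thesis by (simp add: sum_fun_apply)
  qed
  have coord: "push (Y r) (y i) = Y r (?y i)" if "i \<in> I" for i r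
    using push_apply N.frame_coords[OF frame that] by blast
  have "DF X (\<lambda>r. push (Y r)) p f + X p ?\<kappa> * push (Y p) f =
      (\<Sum>i\<in>I. push (Y p) (y i) * DN Z (E i) ?q f + X p (\<lambda>r. push (Y r) (y i)) * E i ?q f)"
    using fun_cong[OF pullback_frame[OF X push_field[OF Y] Z ZX], of f] by (simp add: sum_fun_apply)
  also have "\<dots> = (\<Sum>i\<in>I. Y p (?y i) * (\<Sum>j\<in>I. X p (?y j) * DN (E j) (E i) ?q f)
      + X p (\<lambda>r. Y r (?y i)) * E i ?q f)"
    by (intro sum.cong refl) (simp add: DZ coord)
  finally have 1: "DF X (\<lambda>r. push (Y r)) p f + X p ?\<kappa> * Y p (\<lambda>s. f (F s)) =
      (\<Sum>i\<in>I. Y p (?y i) * (\<Sum>j\<in>I. X p (?y j) * DN (E j) (E i) ?q f)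
      + X p (\<lambda>r. Y r (?y i)) * E i ?q f)"
    by (simp add: push_apply[OF f])
  have expand: "?\<kappa> r * Y r (\<lambda>s. f (F s)) = (\<Sum>i\<in>I. Y r (?y i) * E i (F r) f)" for r
  proof -
    have "?\<kappa> r * push (Y r) f = (\<Sum>i\<in>I. push (Y r) (y i) * E i (F r) f)"
      using fun_cong[OF N.frame_expand[OF frame push_mem[OF M.vector_fieldsD(1)[OF Y]]], where x = f]
      by (simp add: sum_fun_apply)
    then show ?thesis using coord by (simp add: push_apply[OF f])
  qed
  have XE: "X p (\<lambda>r. E i (F r) f) = (\<Sum>j\<in>I. X p (?y j) * E j ?q (\<lambda>s. E i s f))" if "i \<in> I" for i
  proof -
    have "X p (\<lambda>r. E i (F r) f) = push (X p) (\<lambda>s. E i s f)"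
      by (simp add: push_apply[OF sm_Ef[OF that]])
    then show ?thesis by (simp add: push_frame[OF T] sum_fun_apply)
  qed
  have "X p (\<lambda>r. Y r (\<lambda>s. f (F s))) + X p ?\<kappa> * Y p (\<lambda>s. f (F s)) = X p (\<lambda>r. ?\<kappa> r * Y r (\<lambda>s. f (F s)))"
    using M.tangent_vec_mult[OF T sm_\<kappa> M.vector_fieldsD(2)[OF Y smooth_fun_comp[OF f]]]
      N.frame_cutoff(2)[OF frame] by simp
  also have "\<dots> = (\<Sum>i\<in>I. X p (\<lambda>r. Y r (?y i) * E i (F r) f))"
    unfolding expand
    by (rule M.tangent_vec_sum[OF T]) (intro M.smooth_fun_mult sm_Yy smooth_fun_comp sm_Ef)
  also have "\<dots> = (\<Sum>i\<in>I. Y p (?y i) * (\<Sum>j\<in>I. X p (?y j) * E j ?q (\<lambda>s. E i s f))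
      + X p (\<lambda>r. Y r (?y i)) * E i ?q f)"
    by (intro sum.cong refl)
      (simp add: M.tangent_vec_mult[OF T sm_Yy smooth_fun_comp[OF sm_Ef]] XE)
  finally have 2: "X p (\<lambda>r. Y r (\<lambda>s. f (F s))) + X p ?\<kappa> * Y p (\<lambda>s. f (F s)) =
    (\<Sum>i\<in>I. Y p (?y i) * (\<Sum>j\<in>I. X p (?y j) * E j ?q (\<lambda>s. E i s f)) + X p (\<lambda>r. Y r (?y i)) * E i ?q f)" .
  \<comment> \<open>The cut-off term \<open>X p ?\<kappa>\<close> and the second derivatives
    \<open>X p (\<lambda>r. Y r (?y i))\<close> of the coordinates occur in both 1 and 2 and
    cancel.\<close>
  have "DF X (\<lambda>r. push (Y r)) p f - X p (\<lambda>r. Y r (\<lambda>s. f (F s))) =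
    (\<Sum>i\<in>I. Y p (?y i) * (\<Sum>j\<in>I. X p (?y j) * DN (E j) (E i) ?q f) -
      Y p (?y i) * (\<Sum>j\<in>I. X p (?y j) * E j ?q (\<lambda>s. E i s f)))"
    using 1 2 by (simp add: sum.distrib sum_subtractf)
  then show ?thesis
    by (simp add: sum_distrib_left sum_subtractf algebra_simps)
qed

lemma metric_along_expand:
  assumes "\<sigma> \<in> along_fields" "\<tau> \<in> along_fields"
  shows "\<kappa> (F r) * \<kappa> (F r) * gN (F r) (\<sigma> r) (\<tau> r) =
    (\<Sum>i\<in>I. \<Sum>j\<in>I. \<sigma> r (y i) * (\<tau> r (y j) * gN (F r) (E i (F r)) (E j (F r))))"
proof -
  let ?q = "F r"
  note T = along_fieldsD(1)[OF assms(1), of r] along_fieldsD(1)[OF assms(2), of r]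
    N.vector_fieldsD(1)[OF N.frame_fields[OF frame], of _ ?q]
  have "\<kappa> ?q * \<kappa> ?q * gN ?q (\<sigma> r) (\<tau> r) = gN ?q (tv_scale (\<kappa> ?q) (\<sigma> r)) (tv_scale (\<kappa> ?q) (\<tau> r))"
    by (simp add: N.metric_scale_left N.metric_scale_right T N.tangent_space_scale)
  also have "\<dots> = (\<Sum>i\<in>I. \<sigma> r (y i) * gN ?q (E i ?q) (tv_scale (\<kappa> ?q) (\<tau> r)))"
    unfolding N.frame_expand[OF frame T(1)]
    by (simp add: N.metric_sum_left N.metric_scale_left T N.tangent_space_scale)
  also have "\<dots> = (\<Sum>i\<in>I. \<Sum>j\<in>I. \<sigma> r (y i) * (\<tau> r (y j) * gN ?q (E i ?q) (E j ?q)))"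
    unfolding N.frame_expand[OF frame T(2)]
    by (simp add: N.metric_sum_right N.metric_scale_right T N.tangent_space_scale sum_distrib_left)
  finally show ?thesis .
qed

lemma smooth_metric_along_frame:
  assumes "\<sigma> \<in> along_fields" "\<tau> \<in> along_fields"
  shows "smooth_fun A (\<lambda>r. \<kappa> (F r) * \<kappa> (F r) * gN (F r) (\<sigma> r) (\<tau> r))"
  unfolding metric_along_expand[OF assms]
  by (intro M.smooth_fun_sum M.smooth_fun_mult along_fieldsD(2) assms N.frame_coords[OF frame]
      smooth_fun_comp[OF N.smooth_fun_metric] N.frame_fields[OF frame])

text \<open>The product rule is applied to the frame expansion of \<kappa> squared times the inner
  product, and metricity of \<open>DN\<close> differentiates the coefficients \<open>?h\<close>.
  Smoothness of the inner product is a premise because the product rule asks for it; it is obtained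
  separately by cancelling the cut-off.\<close>

lemma pullback_metric_frame:
  assumes X: "X \<in> vector_fields A" and \<sigma>: "\<sigma> \<in> along_fields" and \<tau>: "\<tau> \<in> along_fields"
    and sm: "smooth_fun A (\<lambda>r. gN (F r) (\<sigma> r) (\<tau> r))"
  shows "X p (\<lambda>r. gN (F r) (\<sigma> r) (\<tau> r)) =
    gN (F p) (DF X \<sigma> p) (\<tau> p) + gN (F p) (\<sigma> p) (DF X \<tau> p)"
proof -
  let ?q = "F p" and ?\<kappa> = "\<lambda>r. \<kappa> (F r)" and ?u = "\<lambda>r. gN (F r) (\<sigma> r) (\<tau> r)"
  note T = M.vector_fieldsD(1)[OF X, of p]
  note E = N.frame_fields[OF frame]
  note sm_\<kappa> = smooth_fun_comp[OF N.frame_cutoff(1)[OF frame]]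
  obtain Z where Z: "Z \<in> vector_fields B" "push (X p) = Z ?q"
    using N.vector_field_through[OF push_mem[OF T]] by metis
  define c where "c = X p ?\<kappa>"
  define s where "s i = \<sigma> p (y i)" for i
  define s' where "s' i = X p (\<lambda>r. \<sigma> r (y i))" for i
  define t where "t i = \<tau> p (y i)" for i
  define t' where "t' i = X p (\<lambda>r. \<tau> r (y i))" for i
  define G where "G i = DN Z (E i) ?q" for i
  define h where "h i j = gN ?q (E i ?q) (E j ?q)" for i j
  let ?h = "\<lambda>i j r. gN (F r) (E i (F r)) (E j (F r))"
  have sm_h: "smooth_fun A (?h i j)" if "i \<in> I" "j \<in> I" for i j
    using smooth_fun_comp[OF N.smooth_fun_metric[OF E[OF that(1)] E[OF that(2)]]] .
  have sm_s: "smooth_fun A (\<lambda>r. \<sigma> r (y i))" "smooth_fun A (\<lambda>r. \<tau> r (y i))" if "i \<in> I" for i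
    using along_fieldsD(2) \<sigma> \<tau> N.frame_coords[OF frame that] by blast+
  have EG: "E i ?q \<in> tangent_space B ?q" "G i \<in> tangent_space B ?q" if "i \<in> I" for i
    unfolding G_def using that Z E N.vector_fieldsD(1) N.connection_closed by blast+
  have dh: "X p (?h i j) = gN ?q (G i) (E j ?q) + gN ?q (E i ?q) (G j)" if "i \<in> I" "j \<in> I" for i j
  proof -
    have "X p (?h i j) = Z ?q (\<lambda>q. gN q (E i q) (E j q))"
      using push_apply[OF N.smooth_fun_metric[OF E[OF that(1)] E[OF that(2)]], of "X p"] Z(2) by simp
    then show ?thesis
      using N.metric_compatible[OF Z(1) E[OF that(1)] E[OF that(2)]] by (simp add: G_def)
  qed
  note T\<sigma> = along_fieldsD(1)[OF \<sigma>, of p] along_fieldsD(1)[OF pullback_closed[OF X \<sigma>], of p]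
  note T\<tau> = along_fieldsD(1)[OF \<tau>, of p] along_fieldsD(1)[OF pullback_closed[OF X \<tau>], of p]
  have \<sigma>p: "\<sigma> p = (\<Sum>i\<in>I. tv_scale (s i) (E i ?q))" and \<tau>p: "\<tau> p = (\<Sum>i\<in>I. tv_scale (t i) (E i ?q))"
    using N.frame_expand[OF frame T\<sigma>(1)] N.frame_expand[OF frame T\<tau>(1)] N.frame_cutoff(2)[OF frame]
    by (simp_all add: s_def t_def)
  have d\<sigma>: "DF X \<sigma> p + tv_scale c (\<sigma> p) = (\<Sum>i\<in>I. tv_scale (s i) (G i) + tv_scale (s' i) (E i ?q))"
    and d\<tau>: "DF X \<tau> p + tv_scale c (\<tau> p) = (\<Sum>i\<in>I. tv_scale (t i) (G i) + tv_scale (t' i) (E i ?q))"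
    using pullback_frame[OF X \<sigma> Z] pullback_frame[OF X \<tau> Z]
    by (simp_all add: c_def s_def s'_def t_def t'_def G_def)
  have g\<tau>: "gN ?q w (\<tau> p) = (\<Sum>j\<in>I. t j * gN ?q w (E j ?q))" if "w \<in> tangent_space B ?q" for w
    unfolding \<tau>p
    by (simp add: N.metric_sum_right N.metric_scale_right that EG N.tangent_space_scale)
  have "gN ?q (DF X \<sigma> p + tv_scale c (\<sigma> p)) (\<tau> p) =
      (\<Sum>i\<in>I. s i * gN ?q (G i) (\<tau> p) + s' i * gN ?q (E i ?q) (\<tau> p))"
    unfolding d\<sigma>
    by (simp add: N.metric_sum_left N.metric_add_left N.metric_scale_left EG T\<tau>
        N.tangent_space_scale N.tangent_space_add)
  also have "\<dots> = (\<Sum>i\<in>I. \<Sum>j\<in>I. (s i * gN ?q (G i) (E j ?q) + s' i * h i j) * t j)"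
    by (simp add: g\<tau> EG h_def sum.distrib sum_distrib_left algebra_simps)
  finally have 1: "gN ?q (DF X \<sigma> p) (\<tau> p) + c * ?u p =
      (\<Sum>i\<in>I. \<Sum>j\<in>I. (s i * gN ?q (G i) (E j ?q) + s' i * h i j) * t j)"
    by (simp add: N.metric_add_left N.metric_scale_left T\<sigma> T\<tau> N.tangent_space_scale)
  have "gN ?q (\<sigma> p) (DF X \<tau> p + tv_scale c (\<tau> p)) =
      (\<Sum>i\<in>I. s i * gN ?q (E i ?q) (DF X \<tau> p + tv_scale c (\<tau> p)))"
    unfolding \<sigma>p
    by (simp add: N.metric_sum_left N.metric_scale_left EG T\<tau> N.tangent_space_scale
        N.tangent_space_add)
  also have "\<dots> = (\<Sum>i\<in>I. \<Sum>j\<in>I. s i * (t j * gN ?q (E i ?q) (G j) + t' j * h i j))"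
    unfolding d\<tau>
    by (simp add: N.metric_sum_right N.metric_add_right N.metric_scale_right EG
        N.tangent_space_scale N.tangent_space_add N.tangent_space_sum h_def sum.distrib
        sum_distrib_left algebra_simps)
  finally have 2: "gN ?q (\<sigma> p) (DF X \<tau> p) + c * ?u p =
      (\<Sum>i\<in>I. \<Sum>j\<in>I. s i * (t j * gN ?q (E i ?q) (G j) + t' j * h i j))"
    by (simp add: N.metric_add_right N.metric_scale_right T\<sigma> T\<tau> N.tangent_space_scale)
  \<comment> \<open>As \<kappa> is 1 at \<open>F p\<close>, its square contributes
    \<open>c * ?u p\<close> twice, once for each of the expansions 1 and 2.\<close>
  have "X p ?u + c * ?u p + c * ?u p = X p (\<lambda>r. ?\<kappa> r * ?\<kappa> r * ?u r)"
    using M.tangent_vec_mult[OF T M.smooth_fun_mult[OF sm_\<kappa> sm_\<kappa>] sm] M.tangent_vec_mult[OF T sm_\<kappa> sm_\<kappa>]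
      N.frame_cutoff(2)[OF frame] by (simp add: c_def algebra_simps)
  also have "\<dots> = X p (\<lambda>r. \<Sum>i\<in>I. \<Sum>j\<in>I. \<sigma> r (y i) * (\<tau> r (y j) * ?h i j r))"
    unfolding metric_along_expand[OF \<sigma> \<tau>] ..
  also have "\<dots> = (\<Sum>i\<in>I. X p (\<lambda>r. \<Sum>j\<in>I. \<sigma> r (y i) * (\<tau> r (y j) * ?h i j r)))"
    by (rule M.tangent_vec_sum[OF T]) (intro M.smooth_fun_sum M.smooth_fun_mult sm_s sm_h)
  also have "\<dots> = (\<Sum>i\<in>I. \<Sum>j\<in>I. X p (\<lambda>r. \<sigma> r (y i) * (\<tau> r (y j) * ?h i j r)))"
    by (intro sum.cong refl M.tangent_vec_sum[OF T] M.smooth_fun_mult sm_s sm_h)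
  also have "\<dots> = (\<Sum>i\<in>I. \<Sum>j\<in>I. s i * (t j * X p (?h i j) + t' j * h i j) + s' i * (t j * h i j))"
    by (intro sum.cong refl)
      (simp add: M.tangent_vec_mult[OF T] M.smooth_fun_mult sm_s sm_h s_def s'_def t_def t'_def h_def)
  also have "\<dots> = (\<Sum>i\<in>I. \<Sum>j\<in>I. (s i * gN ?q (G i) (E j ?q) + s' i * h i j) * t j) +
      (\<Sum>i\<in>I. \<Sum>j\<in>I. s i * (t j * gN ?q (E i ?q) (G j) + t' j * h i j))"
    unfolding sum.distrib[symmetric]
    by (intro sum.cong refl) (simp add: dh algebra_simps)
  finally show ?thesis using 1 2 by simp
qed

end

lemma smooth_metric_along:
  assumes "\<sigma> \<in> along_fields" "\<tau> \<in> along_fields"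
  shows "smooth_fun A (\<lambda>r. gN (F r) (\<sigma> r) (\<tau> r))"
proof (rule M.smooth_fun_cancel)
  fix p
  obtain I E y \<kappa> where frame: "N.local_frame (F p) I E y \<kappa>" using N.ex_local_frame by blast
  show "\<exists>\<rho>. smooth_fun A \<rho> \<and> \<rho> p \<noteq> 0 \<and> smooth_fun A (\<lambda>r. \<rho> r * gN (F r) (\<sigma> r) (\<tau> r))"
    using smooth_metric_along_frame[OF frame assms] smooth_fun_comp[OF N.frame_cutoff(1)[OF frame]]
      N.frame_cutoff(2)[OF frame]
    by (intro exI[of _ "\<lambda>r. \<kappa> (F r) * \<kappa> (F r)"]) (simp add: M.smooth_fun_mult)
qed

lemma pullback_metric:
  assumes "X \<in> vector_fields A" "\<sigma> \<in> along_fields" "\<tau> \<in> along_fields"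
  shows "X p (\<lambda>r. gN (F r) (\<sigma> r) (\<tau> r)) =
    gN (F p) (DF X \<sigma> p) (\<tau> p) + gN (F p) (\<sigma> p) (DF X \<tau> p)"
proof -
  obtain I E y \<kappa> where frame: "N.local_frame (F p) I E y \<kappa>" using N.ex_local_frame by blast
  show ?thesis
    by (rule pullback_metric_frame[OF frame assms smooth_metric_along[OF assms(2,3)]])
qed

text \<open>The two Hessian expressions agree by torsion-freeness of \<open>DN\<close>, so the
  difference of the covariant derivatives is the commutator of \<open>X\<close> and \<open>Y\<close>
  on \<open>f \<circ> F\<close>. For \<open>f\<close> not smooth both sides are 0 by
  convention.\<close>

lemma pullback_torsion_free:
  assumes X: "X \<in> vector_fields A" and Y: "Y \<in> vector_fields A"
  shows "DF X (\<lambda>r. push (Y r)) p - DF Y (\<lambda>r. push (X r)) p = push (lie_bracket X Y p)"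
proof
  fix f
  let ?q = "F p"
  show "(DF X (\<lambda>r. push (Y r)) p - DF Y (\<lambda>r. push (X r)) p) f = push (lie_bracket X Y p) f"
  proof (cases "smooth_fun B f")
    case True
    obtain I E y \<kappa> where frame: "N.local_frame ?q I E y \<kappa>" using N.ex_local_frame by blast
    note E = N.frame_fields[OF frame]
    have sym: "DN (E j) (E i) ?q f - E j ?q (\<lambda>r. E i r f) = DN (E i) (E j) ?q f - E i ?q (\<lambda>r. E j r f)"
      if "i \<in> I" "j \<in> I" for i j
    proof -
      have "lie_bracket (E j) (E i) ?q f = (DN (E j) (E i) - DN (E i) (E j)) ?q f"
        using N.torsion_free[OF E[OF that(2)] E[OF that(1)]] by simp
      then show ?thesis by (simp add: lie_bracket_def vf_apply_def)
    qed
    have "DF X (\<lambda>r. push (Y r)) p f - X p (\<lambda>r. Y r (\<lambda>s. f (F s))) =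
        (\<Sum>i\<in>I. \<Sum>j\<in>I. X p (\<lambda>r. y i (F r)) * Y p (\<lambda>r. y j (F r)) *
          (DN (E i) (E j) ?q f - E i ?q (\<lambda>r. E j r f)))"
      unfolding pullback_hessian[OF frame X Y True]
      by (subst sum.swap) (intro sum.cong refl, simp)
    also have "\<dots> = (\<Sum>i\<in>I. \<Sum>j\<in>I. X p (\<lambda>r. y i (F r)) * Y p (\<lambda>r. y j (F r)) *
          (DN (E j) (E i) ?q f - E j ?q (\<lambda>r. E i r f)))"
      by (intro sum.cong refl) (metis sym)
    also have "\<dots> = DF Y (\<lambda>r. push (X r)) p f - Y p (\<lambda>r. X r (\<lambda>s. f (F s)))"
      unfolding pullback_hessian[OF frame Y X True] ..
    finally show ?thesis
      by (simp add: push_apply[OF True] lie_bracket_def vf_apply_def)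
  next
    case False
    then have "DF X (\<lambda>r. push (Y r)) p f = 0" "DF Y (\<lambda>r. push (X r)) p f = 0"
      using N.tangent_vec_not_smooth along_fieldsD(1) pullback_closed push_field X Y by metis+
    then show ?thesis using False by (simp add: pushforward_def)
  qed
qed

section \<open>Vertical and horizontal vectors\<close>

lemma verticalD: "v \<in> vertical_space A B F p \<Longrightarrow> v \<in> tangent_space A p" "v \<in> vertical_space A B F p \<Longrightarrow> push v = 0"
  and verticalI: "v \<in> tangent_space A p \<Longrightarrow> push v = 0 \<Longrightarrow> v \<in> vertical_space A B F p"
  unfolding vertical_space_def by auto

lemma horizontalD: "v \<in> horizontal_space A gM B F p \<Longrightarrow> v \<in> tangent_space A p"
    "v \<in> horizontal_space A gM B F p \<Longrightarrow> w \<in> vertical_space A B F p \<Longrightarrow> gM p v w = 0"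
  and horizontalI: "v \<in> tangent_space A p \<Longrightarrow> (\<And>w. w \<in> vertical_space A B F p \<Longrightarrow> gM p v w = 0) \<Longrightarrow>
    v \<in> horizontal_space A gM B F p"
  unfolding horizontal_space_def by auto

lemma vertical_zero: "0 \<in> vertical_space A B F p"
  and vertical_add: "v \<in> vertical_space A B F p \<Longrightarrow> w \<in> vertical_space A B F p \<Longrightarrow> v + w \<in> vertical_space A B F p"
  and vertical_diff: "v \<in> vertical_space A B F p \<Longrightarrow> w \<in> vertical_space A B F p \<Longrightarrow> v - w \<in> vertical_space A B F p"
  and vertical_scale: "v \<in> vertical_space A B F p \<Longrightarrow> tv_scale a v \<in> vertical_space A B F p"
  by (auto intro!: verticalI simp: verticalD push_zero push_add push_diff push_scale
      M.tangent_space_zero M.tangent_space_add M.tangent_space_diff M.tangent_space_scale)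

lemma horizontal_zero: "0 \<in> horizontal_space A gM B F p"
  and horizontal_add: "v \<in> horizontal_space A gM B F p \<Longrightarrow> w \<in> horizontal_space A gM B F p \<Longrightarrow>
    v + w \<in> horizontal_space A gM B F p"
  and horizontal_diff: "v \<in> horizontal_space A gM B F p \<Longrightarrow> w \<in> horizontal_space A gM B F p \<Longrightarrow>
    v - w \<in> horizontal_space A gM B F p"
  by (auto intro!: horizontalI simp: horizontalD verticalD M.tangent_space_zero M.tangent_space_add
      M.tangent_space_diff M.metric_zero_left M.metric_add_left M.metric_diff_left)

lemma vertical_horizontal_eq_0:
  "v \<in> vertical_space A B F p \<Longrightarrow> v \<in> horizontal_space A gM B F p \<Longrightarrow> v = 0"
  using M.metric_nondegenerate horizontalD by blast

lemma vertical_decomposition: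
  assumes "v \<in> tangent_space A p"
  shows "\<exists>w\<in>vertical_space A B F p. v - w \<in> horizontal_space A gM B F p"
proof -
  obtain w where w: "w \<in> vertical_space A B F p"
    "\<And>u. u \<in> vertical_space A B F p \<Longrightarrow> gM p (v - w) u = 0"
    using M.orthogonal_decomposition[of "vertical_space A B F p" p v]
      vertical_zero vertical_add vertical_scale verticalD(1) assms by (metis subsetI)
  then have "v - w \<in> horizontal_space A gM B F p"
    using assms verticalD(1) by (intro horizontalI M.tangent_space_diff) auto
  then show ?thesis using w(1) by blast
qed

text \<open>The \<open>THE\<close> is resolved by uniqueness: the difference of two candidates is
  both vertical and horizontal, hence 0. Only the value of \<open>X\<close> at \<open>p\<close>
  matters.\<close>

lemma vert_part_eqI:
  assumes "w \<in> vertical_space A B F p" "X p - w \<in> horizontal_space A gM B F p"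
  shows "vert_part A gM B F X p = w"
  unfolding vert_part_def
proof (rule the_equality)
  fix v assume "v \<in> vertical_space A B F p \<and> X p - v \<in> horizontal_space A gM B F p"
  then have "v - w \<in> vertical_space A B F p" "(X p - w) - (X p - v) \<in> horizontal_space A gM B F p"
    using assms vertical_diff horizontal_diff by blast+
  then show "v = w" using vertical_horizontal_eq_0[of "v - w"] by simp
qed (use assms in blast)

lemma hor_part_eqI:
  assumes "w \<in> horizontal_space A gM B F p" "X p - w \<in> vertical_space A B F p"
  shows "hor_part A gM B F X p = w"
  unfolding hor_part_def
proof (rule the_equality)
  fix v assume "v \<in> horizontal_space A gM B F p \<and> X p - v \<in> vertical_space A B F p"
  then have "v - w \<in> horizontal_space A gM B F p" "(X p - w) - (X p - v) \<in> vertical_space A B F p"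
    using assms vertical_diff horizontal_diff by blast+
  then show "v = w" using vertical_horizontal_eq_0[of "v - w"] by simp
qed (use assms in blast)

lemma
  assumes "X p \<in> tangent_space A p"
  shows vert_part_mem: "vert_part A gM B F X p \<in> vertical_space A B F p"
    and hor_part_mem: "hor_part A gM B F X p \<in> horizontal_space A gM B F p"
    and vert_hor_part: "vert_part A gM B F X p + hor_part A gM B F X p = X p"
proof -
  obtain w where w: "w \<in> vertical_space A B F p" "X p - w \<in> horizontal_space A gM B F p"
    using vertical_decomposition[OF assms] by blast
  have "vert_part A gM B F X p = w" "hor_part A gM B F X p = X p - w"
    using vert_part_eqI[of w p X, OF w] hor_part_eqI[of "X p - w" p X, OF w(2)] w(1) by auto
  then show "vert_part A gM B F X p \<in> vertical_space A B F p"
    "hor_part A gM B F X p \<in> horizontal_space A gM B F p"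
    "vert_part A gM B F X p + hor_part A gM B F X p = X p" using w by auto
qed

text \<open>Polarisation of the length condition, applied to \<open>u\<close>, \<open>v\<close> and
  \<open>u + v\<close>.\<close>

lemma push_isometry:
  assumes "u \<in> horizontal_space A gM B F p" "v \<in> horizontal_space A gM B F p"
  shows "gN (F p) (push u) (push v) = gM p u v"
proof -
  have len: "gN (F p) (push w) (push w) = gM p w w" if "w \<in> horizontal_space A gM B F p" for w
    using submersion that unfolding riemannian_submersion_def by (metis real_sqrt_eq_iff)
  note T = horizontalD(1)[OF assms(1)] horizontalD(1)[OF assms(2)]
  note T' = push_mem[OF T(1)] push_mem[OF T(2)]
  have "gN (F p) (push u) (push u) + 2 * gN (F p) (push u) (push v) + gN (F p) (push v) (push v)
      = gN (F p) (push (u + v)) (push (u + v))"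
    using N.metric_sym[OF T'] T'
    by (simp add: push_add N.metric_add_left N.metric_add_right N.tangent_space_add)
  also have "\<dots> = gM p u u + 2 * gM p u v + gM p v v"
    unfolding len[OF horizontal_add[OF assms]] using M.metric_sym[OF T] T
    by (simp add: M.metric_add_left M.metric_add_right M.tangent_space_add)
  finally show ?thesis using len assms by simp
qed

text \<open>Pushing forward forgets vertical parts and is isometric on horizontal ones. The
  right-hand side is smooth along smooth fields, which is how \<open>hor_part\<close> is shown to
  preserve smoothness.\<close>

lemma metric_hor_part:
  assumes "X p \<in> tangent_space A p" "v \<in> tangent_space A p"
  shows "gM p (hor_part A gM B F X p) v = gN (F p) (push (X p)) (push v)"
proof -
  let ?h = "hor_part A gM B F X p"
  obtain w where w: "w \<in> vertical_space A B F p" "v - w \<in> horizontal_space A gM B F p"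
    using vertical_decomposition[OF assms(2)] by blast
  note h = hor_part_mem[of X p, OF assms(1)]
  have "push (X p) = push (vert_part A gM B F X p + ?h)"
    by (simp add: vert_hor_part[of X p, OF assms(1)])
  also have "\<dots> = push ?h"
    using verticalD(2)[OF vert_part_mem[of X p, OF assms(1)]] by (simp add: push_add)
  finally have "gN (F p) (push (X p)) (push v) = gN (F p) (push ?h) (push (v - w))"
    using verticalD(2)[OF w(1)] by (simp add: push_diff)
  also have "\<dots> = gM p ?h (v - w)" by (rule push_isometry[OF h w(2)])
  also have "\<dots> = gM p ?h v"
    using horizontalD[OF h] w(1) verticalD(1)[OF w(1)] assms(2) by (simp add: M.metric_diff_right)
  finally show ?thesis by simp
qed

text \<open>O'Neill's tensors feed projected fields into \<open>DM\<close>, whose laws hold for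
  smooth fields only. Smoothness of the horizontal part is tested on inner products; the vertical
  part is the difference.\<close>

lemma hor_part_field: "X \<in> vector_fields A \<Longrightarrow> hor_part A gM B F X \<in> horizontal_fields A gM B F"
  and vert_part_field: "X \<in> vector_fields A \<Longrightarrow> vert_part A gM B F X \<in> vertical_fields A B F"
  and vert_hor_part_field: "X \<in> vector_fields A \<Longrightarrow> vert_part A gM B F X + hor_part A gM B F X = X"
proof -
  assume X: "X \<in> vector_fields A"
  note T = M.vector_fieldsD(1)[OF X]
  have hor: "hor_part A gM B F X \<in> vector_fields A"
  proof (rule M.vector_fieldsI_metric)
    show "hor_part A gM B F X p \<in> tangent_space A p" for p
      using horizontalD(1) hor_part_mem T by blast
    show "smooth_fun A (\<lambda>p. gM p (hor_part A gM B F X p) (Y p))" if Y: "Y \<in> vector_fields A" for Y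
      using smooth_metric_along[OF push_field[OF X] push_field[OF Y]]
      by (simp add: metric_hor_part T M.vector_fieldsD(1)[OF Y])
  qed
  then show "hor_part A gM B F X \<in> horizontal_fields A gM B F"
    unfolding horizontal_fields_def using hor_part_mem T by blast
  show sum: "vert_part A gM B F X + hor_part A gM B F X = X"
    by (rule ext) (simp add: vert_hor_part T)
  then have "vert_part A gM B F X = X - hor_part A gM B F X" by (metis add_diff_cancel_right')
  then have "vert_part A gM B F X \<in> vector_fields A" using M.vector_fields_diff[OF X hor] by simp
  then show "vert_part A gM B F X \<in> vertical_fields A B F"
    unfolding vertical_fields_def using vert_part_mem T by blast
qed

lemma vertical_fieldsD:
  assumes "V \<in> vertical_fields A B F"
  shows "V \<in> vector_fields A" "V p \<in> vertical_space A B F p"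
  using assms unfolding vertical_fields_def by auto

lemma horizontal_fieldsD:
  assumes "X \<in> horizontal_fields A gM B F"
  shows "X \<in> vector_fields A" "X p \<in> horizontal_space A gM B F p"
  using assms unfolding horizontal_fields_def by auto

section \<open>Components of the second fundamental form\<close>

abbreviation sff :: "'m vfield \<Rightarrow> 'm vfield \<Rightarrow> 'm \<Rightarrow> 'n tvec" where
  "sff \<equiv> second_fundamental_form B F DM DF"

lemma sff_apply: "sff X Y p = DF X (\<lambda>r. push (Y r)) p - push (DM X Y p)"
  by (simp add: second_fundamental_form_def)

lemma sff_sym:
  assumes "X \<in> vector_fields A" "Y \<in> vector_fields A"
  shows "sff X Y p = sff Y X p"
  using pullback_torsion_free[OF assms, of p] M.torsion_free[OF assms]
  by (simp add: sff_apply push_diff algebra_simps)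

lemma sff_add_left:
  assumes "X \<in> vector_fields A" "X' \<in> vector_fields A" "Y \<in> vector_fields A"
  shows "sff (X + X') Y p = sff X Y p + sff X' Y p"
  by (simp add: sff_apply M.connection_add_left assms pullback_add_left push_field push_add)

lemma sff_add_right:
  assumes "X \<in> vector_fields A" "Y \<in> vector_fields A" "Y' \<in> vector_fields A"
  shows "sff X (Y + Y') p = sff X Y p + sff X Y' p"
  using sff_add_left[of Y Y' X p] sff_sym assms M.vector_fields_add by simp

lemma sff_vertical:
  assumes "X \<in> vector_fields A" "V \<in> vertical_fields A B F"
  shows "sff X V p = - push (DM X V p)"
proof -
  have "(\<lambda>r. push (V r)) = 0"
    using vertical_fieldsD(2)[OF assms(2)] verticalD(2) by fastforce
  then show ?thesis using pullback_zero_right[OF assms(1)] by (simp add: sff_apply)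
qed

lemma sff_vertical_eq_0_iff:
  assumes "X \<in> vector_fields A" "V \<in> vertical_fields A B F"
  shows "sff X V p = 0 \<longleftrightarrow> DM X V p \<in> vertical_space A B F p"
  using sff_vertical[OF assms, of p] M.vector_fieldsD(1) M.connection_closed vertical_fieldsD(1)[OF assms(2)]
    assms(1) verticalI verticalD(2) by (metis neg_equal_0_iff_equal)

text \<open>The trilinear form \<open>\<langle>sff X Y, F\<^sub>* Z\<rangle>\<close> on horizontal fields is symmetric in its first and
  skew in its last two arguments.\<close>

lemma sff_horizontal:
  assumes "X \<in> horizontal_fields A gM B F" "Y \<in> horizontal_fields A gM B F"
  shows "sff X Y p = 0"
proof -
  let ?C = "\<lambda>X Y Z. gN (F p) (sff X Y p) (push (Z p))"
  have sff_mem: "sff X Y p \<in> tangent_space B (F p)"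
    if "X \<in> vector_fields A" "Y \<in> vector_fields A" for X Y
    unfolding sff_apply using that
    by (intro N.tangent_space_diff push_mem M.vector_fieldsD(1)[OF M.connection_closed]
        along_fieldsD(1)[OF pullback_closed] push_field)
  have skew: "?C X Y Z = - ?C X Z Y"
    if X: "X \<in> vector_fields A" and Y: "Y \<in> horizontal_fields A gM B F"
      and Z: "Z \<in> horizontal_fields A gM B F" for X Y Z
  proof -
    note Y' = horizontal_fieldsD[OF Y] and Z' = horizontal_fieldsD[OF Z]
    note TY = M.vector_fieldsD(1)[OF Y'(1), of p] M.vector_fieldsD(1)[OF M.connection_closed[OF X Y'(1)], of p]
    note TZ = M.vector_fieldsD(1)[OF Z'(1), of p] M.vector_fieldsD(1)[OF M.connection_closed[OF X Z'(1)], of p]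
    note T' = TY[THEN push_mem] TZ[THEN push_mem]
      along_fieldsD(1)[OF pullback_closed[OF X push_field[OF Y'(1)]], of p]
      along_fieldsD(1)[OF pullback_closed[OF X push_field[OF Z'(1)]], of p]
    \<comment> \<open>\<open>metric_hor_part\<close> concerns a single point, so it applies to the
      constant assignment \<open>\<lambda>_. v\<close>, which need not be a vector field.\<close>
    have hor: "gM p v w = gN (F p) (push v) (push w)"
      if v: "v \<in> horizontal_space A gM B F p" and w: "w \<in> tangent_space A p" for v w
    proof -
      have "hor_part A gM B F (\<lambda>_. v) p = v" by (rule hor_part_eqI) (use v vertical_zero in auto)
      then show ?thesis using metric_hor_part[of "\<lambda>_. v" p w] horizontalD(1)[OF v] w by simp
    qed
    have "(\<lambda>r. gN (F r) (push (Y r)) (push (Z r))) = (\<lambda>r. gM r (Y r) (Z r))"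
      using push_isometry Y'(2) Z'(2) by blast
    then have "gN (F p) (DF X (\<lambda>r. push (Y r)) p) (push (Z p)) + gN (F p) (push (Y p)) (DF X (\<lambda>r. push (Z r)) p)
        = gM p (DM X Y p) (Z p) + gM p (Y p) (DM X Z p)"
      using pullback_metric[OF X push_field[OF Y'(1)] push_field[OF Z'(1)], of p]
        M.metric_compatible[OF X Y'(1) Z'(1), of p] by simp
    also have "\<dots> = gN (F p) (push (DM X Y p)) (push (Z p)) + gN (F p) (push (Y p)) (push (DM X Z p))"
      using hor[OF Z'(2) TY(2)] hor[OF Y'(2) TZ(2)] M.metric_sym[OF TY(2) TZ(1)] N.metric_sym[OF T'(2,3)]
      by simp
    finally show ?thesis
      using N.metric_sym[OF T'(1,6)] N.metric_sym[OF T'(1,4)] T'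
      by (simp add: sff_apply N.metric_diff_left)
  qed
  note X = assms(1) and Y = assms(2)
  note X' = horizontal_fieldsD(1)[OF X] and Y' = horizontal_fieldsD(1)[OF Y]
  \<comment> \<open>Surjectivity of the pushforward and projection to the horizontal part give a
    test field \<open>Z\<close> with \<open>push (Z p) = sff X Y p\<close>, so that the trilinear
    form becomes a squared length.\<close>
  obtain v where v: "v \<in> tangent_space A p" "push v = sff X Y p"
    using sff_mem[OF X' Y'] push_image[of p] by (metis imageE)
  obtain Z0 where Z0: "Z0 \<in> vector_fields A" "Z0 p = v" using M.vector_field_through[OF v(1)] by blast
  define Z where "Z = hor_part A gM B F Z0"
  have Z: "Z \<in> horizontal_fields A gM B F" unfolding Z_def by (rule hor_part_field[OF Z0(1)])
  note Z' = horizontal_fieldsD(1)[OF Z]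
  have "v = vert_part A gM B F Z0 p + Z p"
    unfolding Z_def using vert_hor_part[of Z0 p] Z0(2) v(1) by simp
  then have "push (Z p) = sff X Y p"
    using v(2) verticalD(2)[OF vert_part_mem[of Z0 p]] Z0(2) v(1) by (simp add: push_add)
  \<comment> \<open>Alternating the two symmetries leads back to the original order of arguments
    after three skew exchanges, hence with the opposite sign.\<close>
  moreover have "?C X Y Z = - ?C X Y Z"
  proof -
    have "?C X Y Z = - ?C Z X Y" using skew[OF X' Y Z] sff_sym[OF X' Z'] by simp
    also have "\<dots> = ?C Y Z X" using skew[OF Z' X Y] sff_sym[OF Z' Y'] by simp
    also have "\<dots> = - ?C X Y Z" using skew[OF Y' Z X] sff_sym[OF X' Y'] by simp
    finally show ?thesis .
  qed
  ultimately show ?thesis using N.metric_nondegenerate[OF sff_mem[OF X' Y']] by simp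
qed

text \<open>Both arguments are split into vertical and horizontal parts. With a vertical second
  argument, vanishing means verticality of a covariant derivative; a vertical first and horizontal
  second argument is reduced to this by symmetry; the purely horizontal component always
  vanishes.\<close>

lemma totally_geodesic_iff:
  "totally_geodesic A B F DM DF \<longleftrightarrow>
    (\<forall>W\<in>vertical_fields A B F. \<forall>V\<in>vertical_fields A B F. \<forall>p. DM W V p \<in> vertical_space A B F p) \<and>
    (\<forall>X\<in>horizontal_fields A gM B F. \<forall>V\<in>vertical_fields A B F. \<forall>p. DM X V p \<in> vertical_space A B F p)"
  (is "?l \<longleftrightarrow> ?r")
proof
  assume ?l
  then have "DM X V p \<in> vertical_space A B F p"
    if "X \<in> vector_fields A" "V \<in> vertical_fields A B F" for X V p
    using sff_vertical_eq_0_iff[OF that] vertical_fieldsD(1)[OF that(2)] that(1)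
    unfolding totally_geodesic_def by simp
  then show ?r using vertical_fieldsD(1) horizontal_fieldsD(1) by blast
next
  assume r: ?r
  have "sff X Y p = 0" if X: "X \<in> vector_fields A" and Y: "Y \<in> vector_fields A" for X Y p
  proof -
    let ?V = "vert_part A gM B F" and ?H = "hor_part A gM B F"
    note fields = vert_part_field[OF X] vert_part_field[OF Y] hor_part_field[OF X] hor_part_field[OF Y]
    note fields' = vertical_fieldsD(1)[OF fields(1)] vertical_fieldsD(1)[OF fields(2)]
      horizontal_fieldsD(1)[OF fields(3)] horizontal_fieldsD(1)[OF fields(4)]
    have "sff (?V X) (?V Y) p = 0" "sff (?H X) (?V Y) p = 0" "sff (?H Y) (?V X) p = 0"
      using r sff_vertical_eq_0_iff fields fields' by blast+
    moreover have "sff (?H X) (?H Y) p = 0" by (rule sff_horizontal[OF fields(3,4)])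
    moreover have "sff X Y p = sff (?V X + ?H X) (?V Y + ?H Y) p"
      using vert_hor_part_field[OF X] vert_hor_part_field[OF Y] by simp
    ultimately show ?thesis
      using sff_sym[OF fields'(1,4), of p]
      by (simp add: sff_add_left sff_add_right fields' M.vector_fields_add)
  qed
  then show ?l unfolding totally_geodesic_def by (simp add: fun_eq_iff)
qed

end

section \<open>Cosymplectic manifolds\<close>

locale cosymplectic_manifold = levi_civita_manifold A g D
  for A :: "('m::{t2_space,second_countable_topology}, 'a::real_inner) chart set" and g D +
  fixes \<phi> :: "'m \<Rightarrow> 'm tvec \<Rightarrow> 'm tvec" and \<xi> :: "'m vfield" and \<eta> :: "'m \<Rightarrow> 'm tvec \<Rightarrow> real"
  assumes cosymplectic: "cosymplectic A \<phi> \<xi> \<eta> g"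
begin

lemma almost_contact: "almost_contact_metric A \<phi> \<xi> \<eta> g"
  using cosymplectic unfolding cosymplectic_def by blast

lemma endo: "endo_field A \<phi>"
  using almost_contact unfolding almost_contact_metric_def by blast

lemma phi_mem: "v \<in> tangent_space A p \<Longrightarrow> \<phi> p v \<in> tangent_space A p"
  using endo unfolding endo_field_def by blast

lemma phi_comb: "v \<in> tangent_space A p \<Longrightarrow> w \<in> tangent_space A p \<Longrightarrow>
    \<phi> p (tv_scale a v + tv_scale b w) = tv_scale a (\<phi> p v) + tv_scale b (\<phi> p w)"
  using endo unfolding endo_field_def by blast

lemma phi_add: "v \<in> tangent_space A p \<Longrightarrow> w \<in> tangent_space A p \<Longrightarrow> \<phi> p (v + w) = \<phi> p v + \<phi> p w"
  using phi_comb[of v p w 1 1] by simp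

lemma phi_diff: "v \<in> tangent_space A p \<Longrightarrow> w \<in> tangent_space A p \<Longrightarrow> \<phi> p (v - w) = \<phi> p v - \<phi> p w"
  using phi_comb[of v p w 1 "-1"] by (simp add: diff_eq_tv_scale)

lemma endo_apply_apply [simp]: "endo_apply \<phi> X p = \<phi> p (X p)"
  by (simp add: endo_apply_def)

lemma phi_field: "X \<in> vector_fields A \<Longrightarrow> endo_apply \<phi> X \<in> vector_fields A"
  using endo unfolding endo_field_def endo_apply_def by blast

lemma xi_field: "\<xi> \<in> vector_fields A"
  using almost_contact unfolding almost_contact_metric_def by blast

lemma phi_xi: "\<phi> p (\<xi> p) = 0" and eta_xi: "\<eta> p (\<xi> p) = 1"
  using almost_contact unfolding almost_contact_metric_def by blast+

lemma
  assumes "v \<in> tangent_space A p"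
  shows phi_phi: "\<phi> p (\<phi> p v) = tv_scale (\<eta> p v) (\<xi> p) - v"
    and eta_phi: "\<eta> p (\<phi> p v) = 0" and eta_eq: "\<eta> p v = g p v (\<xi> p)"
  using almost_contact assms unfolding almost_contact_metric_def by auto

lemma phi_metric:
  "v \<in> tangent_space A p \<Longrightarrow> w \<in> tangent_space A p \<Longrightarrow> g p (\<phi> p v) (\<phi> p w) = g p v w - \<eta> p v * \<eta> p w"
  using almost_contact unfolding almost_contact_metric_def by blast

lemma metric_phi_xi: "v \<in> tangent_space A p \<Longrightarrow> g p (\<phi> p v) (\<xi> p) = 0"
  using eta_phi eta_eq phi_mem by metis

text \<open>Compatibility is applied to \<open>v\<close> and \<open>\<phi> p w\<close>; the
  \<xi>-term of \<phi> squared drops out because \<open>\<phi> p v\<close> is orthogonal to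
  \<xi>.\<close>

lemma phi_skew:
  assumes "v \<in> tangent_space A p" "w \<in> tangent_space A p"
  shows "g p (\<phi> p v) w = - g p v (\<phi> p w)"
  using phi_metric[OF assms(1) phi_mem[OF assms(2)]] metric_phi_xi[OF assms(1)] assms
  by (simp add: phi_phi eta_phi metric_diff_right metric_scale_right phi_mem tangent_space_scale
      vector_fieldsD(1)[OF xi_field])

section \<open>The covariant derivatives of \<phi> and \<xi>\<close>

text \<open>The tensor (\<nabla>_X \<phi>) Y, whose vanishing is the structure equation.\<close>

definition dphi :: "'m vfield \<Rightarrow> 'm vfield \<Rightarrow> 'm vfield" where
  "dphi X Y = D X (endo_apply \<phi> Y) - endo_apply \<phi> (D X Y)"

lemma connection_phi_apply: "D X (endo_apply \<phi> Y) p = dphi X Y p + \<phi> p (D X Y p)"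
  by (simp add: dphi_def)

lemma dphi_field: "X \<in> vector_fields A \<Longrightarrow> Y \<in> vector_fields A \<Longrightarrow> dphi X Y \<in> vector_fields A"
  unfolding dphi_def by (intro vector_fields_diff connection_closed phi_field)

context
  fixes p :: 'm
begin

lemma field_at: "X \<in> vector_fields A \<Longrightarrow> X p \<in> tangent_space A p"
  by (rule vector_fieldsD(1))

lemmas fields = phi_field xi_field connection_closed dphi_field
lemmas at = field_at fields phi_mem tangent_space_scale tangent_space_diff tangent_space_add

definition dphi_form :: "'m vfield \<Rightarrow> 'm vfield \<Rightarrow> 'm vfield \<Rightarrow> real" where
  "dphi_form X Y Z = g p (dphi X Y p) (Z p)"

definition dxi_form :: "'m vfield \<Rightarrow> 'm vfield \<Rightarrow> real" where
  "dxi_form X Y = g p (D X \<xi> p) (Y p)"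

text \<open>Under a metric connection the derivative of a skew endomorphism is skew: differentiate
  the identity \<open>phi_skew\<close> along \<open>X\<close>.\<close>

lemma dphi_form_skew:
  assumes X: "X \<in> vector_fields A" and Y: "Y \<in> vector_fields A" and Z: "Z \<in> vector_fields A"
  shows "dphi_form X Y Z = - dphi_form X Z Y"
proof -
  let ?f = "\<lambda>q. g q (endo_apply \<phi> Y q) (Z q)" and ?h = "\<lambda>q. g q (Y q) (endo_apply \<phi> Z q)"
  have "(\<lambda>q. ?f q + ?h q) = (\<lambda>q. 0)"
    using phi_skew vector_fieldsD(1) Y Z by fastforce
  moreover have "X p (\<lambda>q. ?f q + ?h q) = X p ?f + X p ?h"
    by (intro tangent_vec_add[of _ p] at smooth_fun_metric X Y Z)
  ultimately have "X p ?f + X p ?h = 0"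
    using tangent_vec_const[OF field_at[OF X]] by simp
  then have "g p (dphi X Y p + \<phi> p (D X Y p)) (Z p) + g p (\<phi> p (Y p)) (D X Z p) +
      (g p (D X Y p) (\<phi> p (Z p)) + g p (Y p) (dphi X Z p + \<phi> p (D X Z p))) = 0"
    using metric_compatible[OF X phi_field[OF Y] Z] metric_compatible[OF X Y phi_field[OF Z]]
    by (simp add: connection_phi_apply)
  then show ?thesis
    using phi_skew[OF field_at field_at, OF connection_closed Z, OF X Y]
      phi_skew[OF field_at field_at, OF Y connection_closed, OF X Z]
      metric_sym[OF field_at field_at, OF Y dphi_field, OF X Z]
    by (simp add: dphi_form_def metric_add_left metric_add_right at X Y Z)
qed

text \<open>This is closedness of \<eta>: for a torsion-free metric connection,
  \<open>2 * ext_deriv1 \<eta> X Y p\<close> is the antisymmetrisation of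
  \<open>dxi_form\<close>.\<close>

lemma dxi_form_sym:
  assumes X: "X \<in> vector_fields A" and Y: "Y \<in> vector_fields A"
  shows "dxi_form X Y = dxi_form Y X"
proof -
  have eta: "(\<lambda>q. \<eta> q (Z q)) = (\<lambda>q. g q (Z q) (\<xi> q))" if "Z \<in> vector_fields A" for Z
    using eta_eq vector_fieldsD(1)[OF that] by fastforce
  have "ext_deriv1 \<eta> X Y p = 0"
    using cosymplectic X Y unfolding cosymplectic_def by blast
  then have "g p (D X Y p) (\<xi> p) + g p (Y p) (D X \<xi> p) - (g p (D Y X p) (\<xi> p) + g p (X p) (D Y \<xi> p)) -
      g p (D X Y p - D Y X p) (\<xi> p) = 0"
    using metric_compatible[OF X Y xi_field] metric_compatible[OF Y X xi_field]
    by (simp add: ext_deriv1_def vf_apply_def eta X Y torsion_free eta_eq at)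
  then show ?thesis
    using metric_sym[OF field_at field_at, OF Y connection_closed, OF X xi_field]
      metric_sym[OF field_at field_at, OF X connection_closed, OF Y xi_field]
    by (simp add: dxi_form_def metric_diff_left at X Y)
qed

lemma dxi_form_xi:
  assumes X: "X \<in> vector_fields A"
  shows "dxi_form X \<xi> = 0"
proof -
  have "(\<lambda>q. g q (\<xi> q) (\<xi> q)) = (\<lambda>q. 1)"
    using eta_xi eta_eq vector_fieldsD(1)[OF xi_field] by metis
  then show ?thesis
    using metric_compatible[OF X xi_field xi_field, of p] tangent_vec_const[OF field_at[OF X]]
      metric_sym[OF field_at field_at, OF xi_field connection_closed, OF X xi_field]
    by (simp add: dxi_form_def)
qed

lemma endo_apply_xi: "endo_apply \<phi> \<xi> = 0"
  by (rule ext) (simp add: phi_xi)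

lemma phi_zero: "\<phi> q 0 = 0"
  using phi_diff[OF tangent_space_zero tangent_space_zero] by simp

lemma dphi_form_xi:
  assumes X: "X \<in> vector_fields A" and Y: "Y \<in> vector_fields A"
  shows "dphi_form X \<xi> Y = dxi_form X (endo_apply \<phi> Y)"
proof -
  have "dphi X \<xi> p = - \<phi> p (D X \<xi> p)"
    by (simp add: dphi_def endo_apply_xi connection_zero_right X)
  then show ?thesis
    by (simp add: dphi_form_def dxi_form_def metric_minus_left phi_skew at X Y)
qed

text \<open>This is closedness of the fundamental form: writing brackets through the torsion-free
  connection cancels every derivative of \<open>X\<close>, \<open>Y\<close> and \<open>Z\<close> and
  leaves a cyclic sum of \<nabla>\<phi>.\<close>

lemma dphi_form_cyclic:
  assumes X: "X \<in> vector_fields A" and Y: "Y \<in> vector_fields A" and Z: "Z \<in> vector_fields A"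
  shows "dphi_form X Y Z + dphi_form Y Z X + dphi_form Z X Y = 0"
proof -
  let ?\<Phi> = "\<lambda>U V W. g p (D U V p) (\<phi> p (W p))"
  have deriv: "U p (\<lambda>q. g q (V q) (\<phi> q (W q))) = ?\<Phi> U V W + dphi_form U W V - ?\<Phi> U W V"
    if U: "U \<in> vector_fields A" and V: "V \<in> vector_fields A" and W: "W \<in> vector_fields A" for U V W
    using metric_compatible[OF U V phi_field[OF W], of p]
      metric_sym[OF field_at field_at, OF V dphi_field, OF U W]
      metric_sym[OF field_at phi_mem[OF field_at], OF V connection_closed, OF U W]
      phi_skew[OF field_at field_at, OF connection_closed V, OF U W]
    by (simp add: connection_phi_apply dphi_form_def metric_add_right at U V W)
  have bracket: "g p (lie_bracket U V p) (\<phi> p (W p)) = ?\<Phi> U V W - ?\<Phi> V U W"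
    if U: "U \<in> vector_fields A" and V: "V \<in> vector_fields A" and W: "W \<in> vector_fields A" for U V W
    by (simp add: torsion_free U V metric_diff_left at W)
  have "ext_deriv2 (fundamental_form \<phi> g) X Y Z p = 0"
    using cosymplectic X Y Z unfolding cosymplectic_def by blast
  then have "dphi_form X Z Y + dphi_form Y X Z + dphi_form Z Y X = 0"
    by (simp add: ext_deriv2_def fundamental_form_def vf_apply_def deriv bracket X Y Z)
  then show ?thesis
    using dphi_form_skew[OF X Y Z] dphi_form_skew[OF Y Z X] dphi_form_skew[OF Z X Y] by simp
qed

text \<open>Normality together with closedness of \<eta> makes the Nijenhuis tensor vanish.
  Expanding its brackets through the connection cancels all terms without \<nabla>\<phi>, and
  skewness moves the remaining outer \<phi> onto \<open>Z\<close>.\<close>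

lemma dphi_form_nijenhuis:
  assumes X: "X \<in> vector_fields A" and Y: "Y \<in> vector_fields A" and Z: "Z \<in> vector_fields A"
  shows "dphi_form (endo_apply \<phi> X) Y Z - dphi_form (endo_apply \<phi> Y) X Z
    - dphi_form Y X (endo_apply \<phi> Z) + dphi_form X Y (endo_apply \<phi> Z) = 0"
proof -
  have "ext_deriv1 \<eta> X Y q = 0" for q
    using cosymplectic X Y unfolding cosymplectic_def by blast
  moreover have "nijenhuis \<phi> X Y + vf_scale (\<lambda>q. 2 * ext_deriv1 \<eta> X Y q) \<xi> = 0"
    using cosymplectic X Y unfolding cosymplectic_def by blast
  ultimately have "nijenhuis \<phi> X Y p = 0"
    by (metis (no_types, lifting) add.right_neutral mult_zero_right plus_fun_apply tv_scale_simps(2)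
        vf_scale_apply zero_fun_apply)
  then have "dphi (endo_apply \<phi> X) Y p - dphi (endo_apply \<phi> Y) X p + \<phi> p (dphi Y X p) - \<phi> p (dphi X Y p) = 0"
    by (simp add: nijenhuis_def torsion_free fields X Y connection_phi_apply phi_diff phi_add at
        algebra_simps)
  then have "g p (dphi (endo_apply \<phi> X) Y p - dphi (endo_apply \<phi> Y) X p + \<phi> p (dphi Y X p)
      - \<phi> p (dphi X Y p)) (Z p) = 0"
    using metric_zero_left[OF field_at[OF Z]] by simp
  then show ?thesis
    by (simp add: dphi_form_def metric_diff_left metric_add_left phi_skew at X Y Z)
qed

lemma dxi_form_phi_phi:
  assumes X: "X \<in> vector_fields A" and Y: "Y \<in> vector_fields A"
  shows "dxi_form X (endo_apply \<phi> (endo_apply \<phi> Y)) = - dxi_form X Y"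
  using dxi_form_xi[OF X]
  by (simp add: dxi_form_def phi_phi metric_diff_right metric_scale_right at X Y)

text \<open>Normality with second argument \<xi> and the cyclic identity both express the derivative
  of \<phi> in direction \<xi> by \<open>dxi_form\<close>. Comparing them makes
  \<open>dxi_form\<close> skew on pairs of images under \<phi>, while closedness of \<eta> makes it
  symmetric. Then \<phi> is removed from both arguments: applied twice it is minus the identity up
  to \<xi>, on which the form vanishes.\<close>

lemma dxi_form_eq_0:
  assumes X: "X \<in> vector_fields A" and Y: "Y \<in> vector_fields A"
  shows "dxi_form X Y = 0"
proof -
  let ?p = "endo_apply \<phi>"
  have phi2: "dxi_form (?p X) (?p Z) = 0" if X: "X \<in> vector_fields A" and Z: "Z \<in> vector_fields A" for X Z
  proof -
    have "dphi (?p \<xi>) X p = 0"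
      unfolding endo_apply_xi by (simp add: dphi_def connection_zero_left phi_field X phi_zero)
    then have "dphi_form (?p \<xi>) X Z = 0" by (simp add: dphi_form_def metric_zero_left at Z)
    then have "dxi_form (?p X) (?p Z) - dphi_form \<xi> X (?p Z) + dxi_form X (?p (?p Z)) = 0"
      using dphi_form_nijenhuis[OF X xi_field Z] by (simp add: dphi_form_xi fields X Z)
    moreover have "dphi_form \<xi> X (?p Z) = dxi_form X (?p (?p Z)) - dxi_form (?p Z) (?p X)"
      using dphi_form_cyclic[OF X phi_field[OF Z] xi_field] dphi_form_skew[OF X phi_field[OF Z] xi_field]
      by (simp add: dphi_form_xi fields X Z)
    ultimately show ?thesis using dxi_form_sym[OF phi_field[OF X] phi_field[OF Z]] by simp
  qed
  have phi1: "dxi_form (?p Z) X = 0" if X: "X \<in> vector_fields A" and Z: "Z \<in> vector_fields A" for X Z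
    using phi2[OF Z phi_field[OF X]] dxi_form_phi_phi[OF phi_field[OF Z] X] by simp
  show ?thesis
    using phi1[OF X phi_field[OF Y]] dxi_form_sym[OF X phi_field[OF phi_field[OF Y]]]
      dxi_form_phi_phi[OF X Y] by simp
qed

end

lemma connection_xi:
  assumes "X \<in> vector_fields A"
  shows "D X \<xi> = 0"
proof
  fix p
  show "D X \<xi> p = 0 p"
    using metric_nondegenerate[OF vector_fieldsD(1)] dxi_form_eq_0[OF assms, of "D X \<xi>" p]
      connection_closed[OF assms xi_field] by (auto simp: dxi_form_def)
qed

text \<open>The derivative of \<open>\<phi>\<^sup>2 = \<eta> \<otimes> \<xi> - I\<close> vanishes because \<open>\<xi>\<close> is parallel.\<close>

lemma dphi_phi:
  assumes X: "X \<in> vector_fields A" and Y: "Y \<in> vector_fields A"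
  shows "dphi X (endo_apply \<phi> Y) p = - \<phi> p (dphi X Y p)"
proof -
  let ?p = "endo_apply \<phi>" and ?e = "\<lambda>q. g q (Y q) (\<xi> q)"
  note at = vector_fieldsD(1) phi_field xi_field connection_closed dphi_field phi_mem
  have e: "smooth_fun A ?e" by (rule smooth_fun_metric[OF Y xi_field])
  have "?p (?p Y) = vf_scale ?e \<xi> - Y"
    by (rule ext) (simp add: phi_phi eta_eq at Y)
  then have "D X (?p (?p Y)) p = tv_scale (X p ?e) (\<xi> p) - D X Y p"
    using connection_diff_right[OF X vector_fields_scale[OF e xi_field] Y]
      connection_scale_right[OF X xi_field e] connection_xi[OF X]
    by (simp add: vf_apply_def)
  also have "X p ?e = \<eta> p (D X Y p)"
    using metric_compatible[OF X Y xi_field, of p] connection_xi[OF X]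
    by (simp add: eta_eq at X Y metric_zero_right)
  finally have "D X (?p (?p Y)) p = \<phi> p (\<phi> p (D X Y p))"
    unfolding phi_phi[OF vector_fieldsD(1)[OF connection_closed[OF X Y]]] .
  then show ?thesis
    by (simp add: connection_phi_apply phi_add at X Y eq_neg_iff_add_eq_0)
qed

text \<open>\<nabla>\<phi> anticommutes with \<phi>, so \<phi> can be shifted between the last two
  arguments of the form. The cyclic identities for (\<phi>U, V, Z) and (\<phi>V, U, Z) and the
  normality identity then combine, up to sign, to twice \<open>?B Z U (?p V)\<close>.\<close>

lemma dphi_eq_0:
  assumes X: "X \<in> vector_fields A" and Y: "Y \<in> vector_fields A"
  shows "dphi X Y p = 0"
proof -
  let ?p = "endo_apply \<phi>" and ?B = "dphi_form p"
  note at = vector_fieldsD(1) phi_field xi_field connection_closed dphi_field phi_mem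
  have shift: "?B U (?p V) W = ?B U V (?p W)"
    if "U \<in> vector_fields A" "V \<in> vector_fields A" "W \<in> vector_fields A" for U V W
    using phi_skew[of "dphi U V p" p "W p"] that
    by (simp add: dphi_form_def dphi_phi at metric_minus_left)
  have phi: "?B Z U (?p V) = 0"
    if U: "U \<in> vector_fields A" and V: "V \<in> vector_fields A" and Z: "Z \<in> vector_fields A" for U V Z
    using dphi_form_cyclic[OF phi_field[OF U] V Z, of p] dphi_form_cyclic[OF phi_field[OF V] U Z, of p]
      dphi_form_nijenhuis[OF U V Z, of p] shift[OF V Z U] shift[OF U Z V] shift[OF Z U V]
      dphi_form_skew[OF V phi_field[OF Z] U, of p] dphi_form_skew[OF U phi_field[OF Z] V, of p]
      dphi_form_skew[OF Z U phi_field[OF V], of p]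
    by linarith
  let ?u = "dphi X Y p"
  note u = vector_fieldsD(1)[OF dphi_field[OF X Y], of p]
  have "g p ?u (\<xi> p) = 0"
    using dphi_form_skew[OF X Y xi_field, of p] dphi_form_xi[OF X Y, of p]
      dxi_form_eq_0[OF X phi_field[OF Y], of p] by (simp add: dphi_form_def)
  \<comment> \<open>The test vector is \<phi> applied twice to \<open>?u\<close>, which is
    \<open>- ?u\<close> up to a multiple of \<xi>; as \<open>?u\<close> is orthogonal to \<xi>, its
    squared length vanishes.\<close>
  moreover have "g p ?u (\<phi> p (\<phi> p ?u)) = 0"
    using phi[OF Y phi_field[OF dphi_field[OF X Y]] X] by (simp add: dphi_form_def)
  ultimately have "g p ?u ?u = 0"
    by (simp add: phi_phi u metric_diff_right metric_scale_right tangent_space_scale at)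
  then show ?thesis by (rule metric_nondegenerate[OF u])
qed

lemma connection_phi:
  assumes "X \<in> vector_fields A" "Y \<in> vector_fields A"
  shows "D X (endo_apply \<phi> Y) p = \<phi> p (D X Y p)"
  using dphi_eq_0[OF assms] connection_phi_apply by simp

end

section \<open>Anti-invariant submersions with \<open>\<phi> (ker F\<^sub>*) = (ker F\<^sub>*)\<^sup>\<bottom>\<close>\<close>

locale lagrangian_submersion =
  submersion A gM DM B gN DN F DF + cosymplectic_manifold A gM DM \<phi> \<xi> \<eta>
  for A :: "('m::{t2_space,second_countable_topology}, 'a::real_inner) chart set" and gM DM
    and B :: "('n::{t2_space,second_countable_topology}, 'b::real_inner) chart set" and gN DN
    and F DF \<phi> \<xi> \<eta> +
  assumes phi_vertical_space: "\<phi> p ` vertical_space A B F p = horizontal_space A gM B F p"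
begin

lemma phi_vertical: "v \<in> vertical_space A B F p \<Longrightarrow> \<phi> p v \<in> horizontal_space A gM B F p"
  using phi_vertical_space by blast

lemma eta_horizontal:
  assumes "h \<in> horizontal_space A gM B F p"
  shows "\<eta> p h = 0"
proof -
  obtain v where "v \<in> vertical_space A B F p" "h = \<phi> p v" using assms phi_vertical_space by blast
  then show ?thesis using eta_phi verticalD(1) by blast
qed

text \<open>Horizontal vectors are images under \<phi>, so \<eta> vanishes on them; the horizontal
  component of \<xi> is therefore orthogonal to \<xi>, hence to itself.\<close>

lemma xi_vertical: "\<xi> p \<in> vertical_space A B F p"
proof -
  note xi = M.vector_fieldsD(1)[OF xi_field, of p]
  obtain w where w: "w \<in> vertical_space A B F p" "\<xi> p - w \<in> horizontal_space A gM B F p"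
    using vertical_decomposition[OF xi] by blast
  note T = horizontalD(1)[OF w(2)]
  have "gM p (\<xi> p - w) (\<xi> p - w) = gM p (\<xi> p - w) (\<xi> p) - gM p (\<xi> p - w) w"
    using xi verticalD(1)[OF w(1)] T by (simp add: M.metric_diff_right)
  also have "\<dots> = 0"
    using eta_horizontal[OF w(2)] eta_eq[OF T] horizontalD(2)[OF w(2,1)] by simp
  finally have "\<xi> p - w = 0" by (rule M.metric_nondegenerate[OF T])
  then show ?thesis using w(1) by simp
qed

text \<open>A horizontal vector is \<phi> of a vertical one, and \<phi> squared is minus the
  identity up to the vertical \<xi>.\<close>

lemma phi_horizontal:
  assumes "h \<in> horizontal_space A gM B F p"
  shows "\<phi> p h \<in> vertical_space A B F p"
proof -
  obtain v where v: "v \<in> vertical_space A B F p" "h = \<phi> p v" using assms phi_vertical_space by blast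
  have "\<phi> p h = tv_scale (\<eta> p v) (\<xi> p) - v" unfolding v(2) by (rule phi_phi[OF verticalD(1)[OF v(1)]])
  then show ?thesis using vertical_diff[OF vertical_scale[OF xi_vertical] v(1)] by simp
qed

lemma phi_horizontal_eq_0:
  assumes "h \<in> horizontal_space A gM B F p" "\<phi> p h = 0"
  shows "h = 0"
proof (rule M.metric_nondegenerate)
  note T = horizontalD(1)[OF assms(1)]
  show "h \<in> tangent_space A p" by (rule T)
  show "gM p h h = 0"
    using phi_metric[OF T T] eta_horizontal[OF assms(1)] assms(2) M.metric_zero_left M.tangent_space_zero
    by simp
qed

text \<open>The vertical part of \<phi>X is \<phi> of the horizontal part of X, and \<phi> is
  injective on horizontal vectors.\<close>

lemma vert_part_phi_eq_0_iff:
  assumes X: "X p \<in> tangent_space A p"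
  shows "vert_part A gM B F (endo_apply \<phi> X) p = 0 \<longleftrightarrow> X p \<in> vertical_space A B F p"
proof -
  obtain w where w: "w \<in> vertical_space A B F p" "X p - w \<in> horizontal_space A gM B F p"
    using vertical_decomposition[OF X] by blast
  have "\<phi> p (X p) - \<phi> p (X p - w) = \<phi> p w"
    using X verticalD(1)[OF w(1)] by (simp add: phi_diff)
  then have "vert_part A gM B F (endo_apply \<phi> X) p = \<phi> p (X p - w)"
    using phi_horizontal[OF w(2)] phi_vertical[OF w(1)] by (intro vert_part_eqI) simp_all
  moreover have "\<phi> p (X p - w) = 0 \<longleftrightarrow> X p \<in> vertical_space A B F p"
  proof
    assume "\<phi> p (X p - w) = 0"
    then have "X p - w = 0" by (rule phi_horizontal_eq_0[OF w(2)])
    then show "X p \<in> vertical_space A B F p" using w(1) by simp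
  next
    assume "X p \<in> vertical_space A B F p"
    then have "X p - w = 0"
      using vertical_horizontal_eq_0[OF vertical_diff w(2)] w(1) by blast
    then show "\<phi> p (X p - w) = 0" by (simp add: phi_zero)
  qed
  ultimately show ?thesis by simp
qed

lemma
  assumes "V \<in> vertical_fields A B F"
  shows vert_part_vertical: "vert_part A gM B F V = V"
    and vert_part_phi_vertical: "vert_part A gM B F (endo_apply \<phi> V) = 0"
    and hor_part_phi_vertical: "hor_part A gM B F (endo_apply \<phi> V) = endo_apply \<phi> V"
proof -
  note V = vertical_fieldsD(2)[OF assms]
  show "vert_part A gM B F V = V"
    by (rule ext, rule vert_part_eqI) (use V horizontal_zero in auto)
  show "vert_part A gM B F (endo_apply \<phi> V) = 0"
    by (rule ext, simp, rule vert_part_eqI) (use phi_vertical[OF V] vertical_zero in auto)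
  show "hor_part A gM B F (endo_apply \<phi> V) = endo_apply \<phi> V"
    by (rule ext, rule hor_part_eqI) (use phi_vertical[OF V] vertical_zero in auto)
qed

lemma hor_part_horizontal:
  assumes "X \<in> horizontal_fields A gM B F"
  shows "hor_part A gM B F X = X"
  by (rule ext, rule hor_part_eqI) (use horizontal_fieldsD(2)[OF assms] vertical_zero in auto)

lemma hor_part_zero: "hor_part A gM B F 0 = 0"
  by (rule ext, rule hor_part_eqI) (use vertical_zero horizontal_zero in auto)

lemma vert_part_connection_phi_eq_0_iff:
  assumes "X \<in> vector_fields A" "V \<in> vector_fields A"
  shows "vert_part A gM B F (DM X (endo_apply \<phi> V)) = 0 \<longleftrightarrow> (\<forall>p. DM X V p \<in> vertical_space A B F p)"
proof -
  have "DM X (endo_apply \<phi> V) = endo_apply \<phi> (DM X V)"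
    by (rule ext) (simp add: connection_phi assms)
  then have "vert_part A gM B F (DM X (endo_apply \<phi> V)) p = 0 \<longleftrightarrow> DM X V p \<in> vertical_space A B F p" for p
    using vert_part_phi_eq_0_iff[of "DM X V" p, OF M.vector_fieldsD(1)[OF M.connection_closed[OF assms]]]
    by simp
  then show ?thesis by (simp only: fun_eq_iff[of _ 0] zero_fun_apply)
qed

text \<open>As \<phi>V is horizontal, only the second summand of \<open>oneill_T\<close> survives,
  the vertical part of the derivative of \<phi>V; commuting \<phi> with the connection turns its
  vanishing into verticality of \<open>DM W V\<close>.\<close>

lemma oneill_T_phi:
  assumes "W \<in> vertical_fields A B F" "V \<in> vertical_fields A B F"
  shows "oneill_T A gM DM B F W (endo_apply \<phi> V) = 0 \<longleftrightarrow> (\<forall>p. DM W V p \<in> vertical_space A B F p)"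
  using vert_part_connection_phi_eq_0_iff[OF vertical_fieldsD(1)[OF assms(1)] vertical_fieldsD(1)[OF assms(2)]]
  by (simp add: oneill_T_def vert_part_vertical vert_part_phi_vertical hor_part_phi_vertical assms
      M.connection_zero_right vertical_fieldsD(1) hor_part_zero)

lemma oneill_A_phi:
  assumes "X \<in> horizontal_fields A gM B F" "W \<in> vertical_fields A B F"
  shows "oneill_A A gM DM B F X (endo_apply \<phi> W) = 0 \<longleftrightarrow> (\<forall>p. DM X W p \<in> vertical_space A B F p)"
  using vert_part_connection_phi_eq_0_iff[OF horizontal_fieldsD(1)[OF assms(1)] vertical_fieldsD(1)[OF assms(2)]]
  by (simp add: oneill_A_def hor_part_horizontal vert_part_phi_vertical hor_part_phi_vertical assms
      M.connection_zero_right horizontal_fieldsD(1) hor_part_zero)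

end

theorem theorem6:
  fixes A :: "('m::{t2_space,second_countable_topology}, 'a::real_inner) chart set"
    and B :: "('n::{t2_space,second_countable_topology}, 'b::real_inner) chart set"
    and \<phi> :: "'m \<Rightarrow> 'm tvec \<Rightarrow> 'm tvec"
    and \<xi> :: "'m vfield"
    and \<eta> :: "'m \<Rightarrow> 'm tvec \<Rightarrow> real"
    and gM :: "'m \<Rightarrow> 'm tvec \<Rightarrow> 'm tvec \<Rightarrow> real"
    and gN :: "'n \<Rightarrow> 'n tvec \<Rightarrow> 'n tvec \<Rightarrow> real"
    and DM :: "'m vfield \<Rightarrow> 'm vfield \<Rightarrow> 'm vfield"
    and DN :: "'n vfield \<Rightarrow> 'n vfield \<Rightarrow> 'n vfield"
    and DF :: "'m vfield \<Rightarrow> ('m \<Rightarrow> 'n tvec) \<Rightarrow> ('m \<Rightarrow> 'n tvec)"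
    and F :: "'m \<Rightarrow> 'n"
  assumes "cosymplectic A \<phi> \<xi> \<eta> gM"
    and "riemannian_manifold B gN"
    and "levi_civita A gM DM"
    and "levi_civita B gN DN"
    and "pullback_connection A B F DN DF"
    and "riemannian_submersion A gM B gN F"
    and "anti_invariant A \<phi> gM B F"
    and "\<forall>p. \<phi> p ` vertical_space A B F p = horizontal_space A gM B F p"
  shows "totally_geodesic A B F DM DF \<longleftrightarrow>
     (\<forall>W\<in>vertical_fields A B F. \<forall>V\<in>vertical_fields A B F.
        oneill_T A gM DM B F W (endo_apply \<phi> V) = 0) \<and>
     (\<forall>X\<in>horizontal_fields A gM B F. \<forall>W\<in>vertical_fields A B F.
        oneill_A A gM DM B F X (endo_apply \<phi> W) = 0)"
proof -
  have "riemannian_manifold A gM"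
    using assms(1) unfolding cosymplectic_def almost_contact_metric_def by blast
  then interpret lagrangian_submersion A gM DM B gN DN F DF \<phi> \<xi> \<eta>
    using assms by unfold_locales (auto simp: riemannian_manifold_def)
  show ?thesis
    using totally_geodesic_iff oneill_T_phi oneill_A_phi by auto
qed

end
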